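(* Let $G$ be a $p$-valuable group. Let $\gamma_1=G$, $\gamma_{i+1}=[\gamma_i,G]$ and $\mathcal{D}_0=G$, $\mathcal{D}_{i+1}=[\mathcal{D}_i,\mathcal{D}_i]$ (abstract lower central and derived series), and set $G_i=\mathrm{i}_G(\overline{\gamma_i})$ and $G^{(i)}=\mathrm{i}_G(\overline{\mathcal{D}_i})$, bars denoting closure in $G$. Then each $G_i$ and each $G^{(i)}$ is an isolated orbital closed characteristic subgroup of $G$, and the quotients $G_i/G_{i+1}$ and $G^{(i)}/G^{(i+1)}$ are abelian and torsion-free (hence $p$-valuable). If $G$ is nilpotent, then $(G_i)$ is a strongly central series of $G$: $[G,G_i]\le G_{i+1}$ and $[G_i,G_j]\le G_{i+j}$ for all $i,j$, and $G_r=1$ for some $r$; conversely if $G_r=1$ for some $r$ then $G$ is nilpotent. If $G$ is soluble, then $(G^{(i)})$ is an abelian series of $G$ with $G^{(r)}=1$ for some $r$; conversely if $G^{(r)}=1$ for some $r$ then $G$ is soluble.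
   Context: A $p$-valuation on a group $G$ is a function $\omega:G\to\mathbb{R}\cup\{\infty\}$ with, for all $x,y$: $\omega(x)=\infty$ iff $x=1$; $\omega(x)>(p-1)^{-1}$; $\omega(x^{-1}y)\ge\min\{\omega(x),\omega(y)\}$; $\omega([x,y])\ge\omega(x)+\omega(y)$; $\omega(x^p)=\omega(x)+1$. $G$ is $p$-valuable if it admits a $p$-valuation with respect to which it is complete of finite rank. A closed subgroup $K$ of $G$ is orbital if $\mathbf{N}_G(K)$ is open in $G$; an orbital closed $K$ is isolated orbital if every orbital closed $K'$ with $K\lneq K'$ has $[K':K]=\infty$; the isolator $\mathrm{i}_G(K)$ of an orbital closed $K$ is the closed subgroup generated by all orbital closed $L\ge K$ with $[L:K]<\infty$. An abelian series is a series of closed subgroups $G=G_1\rhd G_2\rhd\cdots$ with $[G_i,G_i]\le G_{i+1}$. *)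

theory Defs
  imports "HOL-Algebra.Algebra" "HOL-Analysis.Abstract_Topology" "HOL-Library.Extended_Real"
begin

text \<open>Group commutator, same convention as the library's derived subgroup.\<close>
definition gcomm :: "('a, 'b) monoid_scheme \<Rightarrow> 'a \<Rightarrow> 'a \<Rightarrow> 'a" where
  "gcomm G x y = x \<otimes>\<^bsub>G\<^esub> y \<otimes>\<^bsub>G\<^esub> inv\<^bsub>G\<^esub> x \<otimes>\<^bsub>G\<^esub> inv\<^bsub>G\<^esub> y"

definition comm_subgroup :: "('a, 'b) monoid_scheme \<Rightarrow> 'a set \<Rightarrow> 'a set \<Rightarrow> 'a set" where
  "comm_subgroup G H K = generate G {gcomm G h k | h k. h \<in> H \<and> k \<in> K}"

definition p_valuation :: "('a, 'b) monoid_scheme \<Rightarrow> nat \<Rightarrow> ('a \<Rightarrow> ereal) \<Rightarrow> bool" where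
  "p_valuation G p \<omega> \<longleftrightarrow>
     (\<forall>x\<in>carrier G. \<omega> x = \<infinity> \<longleftrightarrow> x = \<one>\<^bsub>G\<^esub>) \<and>
     (\<forall>x\<in>carrier G. \<omega> x > ereal (1 / (real p - 1))) \<and>
     (\<forall>x\<in>carrier G. \<forall>y\<in>carrier G. \<omega> (inv\<^bsub>G\<^esub> x \<otimes>\<^bsub>G\<^esub> y) \<ge> min (\<omega> x) (\<omega> y)) \<and>
     (\<forall>x\<in>carrier G. \<forall>y\<in>carrier G. \<omega> (gcomm G x y) \<ge> \<omega> x + \<omega> y) \<and>
     (\<forall>x\<in>carrier G. \<omega> (x [^]\<^bsub>G\<^esub> p) = \<omega> x + 1)"

definition val_open :: "('a, 'b) monoid_scheme \<Rightarrow> ('a \<Rightarrow> ereal) \<Rightarrow> 'a set \<Rightarrow> bool" where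
  "val_open G \<omega> U \<longleftrightarrow> U \<subseteq> carrier G \<and>
     (\<forall>x\<in>U. \<exists>\<nu>::real. {y \<in> carrier G. \<omega> (inv\<^bsub>G\<^esub> x \<otimes>\<^bsub>G\<^esub> y) \<ge> ereal \<nu>} \<subseteq> U)"

definition val_topology :: "('a, 'b) monoid_scheme \<Rightarrow> ('a \<Rightarrow> ereal) \<Rightarrow> 'a topology" where
  "val_topology G \<omega> = topology (val_open G \<omega>)"

definition val_complete :: "('a, 'b) monoid_scheme \<Rightarrow> ('a \<Rightarrow> ereal) \<Rightarrow> bool" where
  "val_complete G \<omega> \<longleftrightarrow>
     (\<forall>s :: nat \<Rightarrow> 'a. (\<forall>n. s n \<in> carrier G) \<and>
        (\<forall>\<nu>::real. \<exists>N. \<forall>m\<ge>N. \<forall>n\<ge>N. \<omega> (inv\<^bsub>G\<^esub> (s m) \<otimes>\<^bsub>G\<^esub> s n) \<ge> ereal \<nu>)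
      \<longrightarrow> (\<exists>y\<in>carrier G. \<forall>\<nu>::real. \<exists>N. \<forall>n\<ge>N. \<omega> (inv\<^bsub>G\<^esub> y \<otimes>\<^bsub>G\<^esub> s n) \<ge> ereal \<nu>))"

text \<open>Finite rank: gr G = (+)_nu G_nu / G_nu+ is finitely generated as an F_p[pi]-module
  (pi acting via x \<mapsto> x^p).  Written out: there are finitely many g_1..g_d such that
  for every nu and every g with omega g \<ge> nu, the class of g in gr_nu G is an
  F_p-combination of the classes of g_i^(p^k_i) with omega(g_i)+k_i = nu.\<close>
definition val_finite_rank :: "('a, 'b) monoid_scheme \<Rightarrow> nat \<Rightarrow> ('a \<Rightarrow> ereal) \<Rightarrow> bool" where
  "val_finite_rank G p \<omega> \<longleftrightarrow>
     (\<exists>gs :: 'a list. set gs \<subseteq> carrier G \<and>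
       (\<forall>g\<in>carrier G. \<forall>\<nu>::real. \<omega> g \<ge> ereal \<nu> \<longrightarrow>
          (\<exists>ks as :: nat list. length ks = length gs \<and> length as = length gs \<and>
             (\<forall>i<length gs. as ! i < p \<and> (as ! i = 0 \<or> \<omega> (gs ! i) + ereal (real (ks ! i)) = ereal \<nu>)) \<and>
             \<omega> (inv\<^bsub>G\<^esub> g \<otimes>\<^bsub>G\<^esub>
                 foldr (\<lambda>i acc. (gs ! i) [^]\<^bsub>G\<^esub> (as ! i * p ^ (ks ! i)) \<otimes>\<^bsub>G\<^esub> acc)
                   [0..<length gs] \<one>\<^bsub>G\<^esub>) > ereal \<nu>)))"

definition p_valued_complete_finite_rank :: "('a, 'b) monoid_scheme \<Rightarrow> nat \<Rightarrow> ('a \<Rightarrow> ereal) \<Rightarrow> bool" where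
  "p_valued_complete_finite_rank G p \<omega> \<longleftrightarrow>
     group G \<and> p_valuation G p \<omega> \<and> val_complete G \<omega> \<and> val_finite_rank G p \<omega>"

definition p_valuable :: "('a, 'b) monoid_scheme \<Rightarrow> nat \<Rightarrow> bool" where
  "p_valuable G p \<longleftrightarrow> (\<exists>\<omega>. p_valued_complete_finite_rank G p \<omega>)"

definition finite_index :: "('a, 'b) monoid_scheme \<Rightarrow> 'a set \<Rightarrow> 'a set \<Rightarrow> bool" where
  "finite_index G K K' \<longleftrightarrow> finite ((\<lambda>x. K #>\<^bsub>G\<^esub> x) ` K')"

definition orbital :: "('a, 'b) monoid_scheme \<Rightarrow> ('a \<Rightarrow> ereal) \<Rightarrow> 'a set \<Rightarrow> bool" where
  "orbital G \<omega> K \<longleftrightarrow> subgroup K G \<and> closedin (val_topology G \<omega>) K \<and>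
     openin (val_topology G \<omega>) (normalizer G K)"

definition isolated_orbital :: "('a, 'b) monoid_scheme \<Rightarrow> ('a \<Rightarrow> ereal) \<Rightarrow> 'a set \<Rightarrow> bool" where
  "isolated_orbital G \<omega> K \<longleftrightarrow> orbital G \<omega> K \<and>
     (\<forall>K'. orbital G \<omega> K' \<and> K \<subset> K' \<longrightarrow> \<not> finite_index G K K')"

definition isolator :: "('a, 'b) monoid_scheme \<Rightarrow> ('a \<Rightarrow> ereal) \<Rightarrow> 'a set \<Rightarrow> 'a set" where
  "isolator G \<omega> K = val_topology G \<omega> closure_of
     generate G (\<Union>{L. orbital G \<omega> L \<and> K \<subseteq> L \<and> finite_index G K L})"

definition characteristic :: "('a, 'b) monoid_scheme \<Rightarrow> 'a set \<Rightarrow> bool" where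
  "characteristic G H \<longleftrightarrow> subgroup H G \<and> (\<forall>\<phi>\<in>auto G. \<phi> ` H = H)"

definition torsion_free :: "('a, 'b) monoid_scheme \<Rightarrow> bool" where
  "torsion_free G \<longleftrightarrow> (\<forall>x\<in>carrier G. \<forall>n::nat. n > 0 \<and> x [^]\<^bsub>G\<^esub> n = \<one>\<^bsub>G\<^esub> \<longrightarrow> x = \<one>\<^bsub>G\<^esub>)"

text \<open>lower_central G i = gamma_i for i \<ge> 1 (gamma_1 = G); the value at 0 is set to G.\<close>
fun lower_central :: "('a, 'b) monoid_scheme \<Rightarrow> nat \<Rightarrow> 'a set" where
  "lower_central G 0 = carrier G"
| "lower_central G (Suc 0) = carrier G"
| "lower_central G (Suc (Suc n)) = comm_subgroup G (lower_central G (Suc n)) (carrier G)"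

definition nilpotent :: "('a, 'b) monoid_scheme \<Rightarrow> bool" where
  "nilpotent G \<longleftrightarrow> (\<exists>c. lower_central G c = {\<one>\<^bsub>G\<^esub>})"

abbreviation derived_series :: "('a, 'b) monoid_scheme \<Rightarrow> nat \<Rightarrow> 'a set" where
  "derived_series G i \<equiv> (derived G ^^ i) (carrier G)"

end

theory Submission
  imports Defs "HOL-Computational_Algebra.Primes" "HOL-Number_Theory.Cong"
begin

text \<open>
  For a closed normal subgroup \<open>K\<close>, the valuation of \<open>G\<close> induces a filtration \<open>v\<close> on \<open>G / K\<close> with
  \<open>v (x\<^sup>p) = v x + 1\<close> for all sufficiently deep \<open>x\<close>, because deep elements of \<open>K\<close> are \<open>p\<close>-th powers of
  elements of \<open>K\<close>. In such a quotient, \<open>(x w)\<^sup>p\<close> and \<open>x\<^sup>p w\<^sup>p\<close> agree to higher order when \<open>w\<close> is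
  deep, so a deep \<open>w\<close> with \<open>(x w)\<^sup>p = x\<^sup>p\<close> is trivial. Since taking commutators raises \<open>v\<close> by a
  fixed amount, induction from deep to shallow elements shows that the torsion elements of
  \<open>G / K\<close> form a finite normal subgroup, and that roots are unique modulo it. Hence the isolator
  of \<open>K\<close> is \<open>{x. \<exists>n. x [^] (p ^ n) \<in> K}\<close>, and \<open>[A, B] \<subseteq> E\<close> implies the same for the isolators. Automorphisms
  are continuous because the \<open>p\<^sup>n\<close>-th powers form a neighbourhood basis of the identity, and a
  torsion-free abelian quotient is \<open>p\<close>-valued by \<open>p\<close>-divisibility of its elements.
\<close>

text \<open>The filtration of \<open>G / K\<close> is kept as a function on \<open>G\<close>:
  \<open>filtered_group\<close> lets \<open>v\<close> be infinite on a whole normal subgroup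
  \<open>level \<infinity>\<close>, here \<open>K\<close>. The obstacle is that
  \<open>v (x [^] p) = v x + 1\<close> fails for shallow \<open>x\<close> as soon as
  \<open>G / K\<close> has torsion. Two numbers control the passage from deep to shallow. A deep
  element has value \<open>b > 1\<close>, so that commutators of two such elements have value at
  least \<open>b + b > b + 1\<close> and disappear from the comparison of p-th powers. The lower
  bound \<open>gap = 1 / (p - 1)\<close> on all values is also the gain of each commutator:
  \<open>p - 1\<close> commutators gain more than 1, which removes the one binomial factor whose
  exponent is prime to \<open>p\<close>; and since all values are positive, finitely many steps of
  size \<open>gap\<close> lead from the deep range to any given element. That deep elements of a
  closed subgroup have p-th roots in it comes from finite rank: p-th powers embed each graded piece
  into the one a degree higher, and the bounded size of the pieces forces these embeddings to become
  onto. Completeness turns the resulting approximate roots into roots.\<close>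

section \<open>Congruences modulo a normal subgroup\<close>

text \<open>As a simp rule this loops with the set comprehensions defining the levels below.\<close>
declare (in subgroup) mem_carrier [simp del]

context group
begin

lemma inv_mult_cancel [simp]:
  assumes "x \<in> carrier G" "y \<in> carrier G"
  shows "inv x \<otimes> (x \<otimes> y) = y" "x \<otimes> (inv x \<otimes> y) = y"
  using assms by (simp_all flip: m_assoc)

lemma gcomm_closed [simp, intro]:
  "x \<in> carrier G \<Longrightarrow> y \<in> carrier G \<Longrightarrow> gcomm G x y \<in> carrier G"
  by (simp add: gcomm_def)

lemma pow_conj:
  assumes "x \<in> carrier G" "y \<in> carrier G"
  shows "(y \<otimes> x \<otimes> inv y) [^] (n::nat) = y \<otimes> x [^] n \<otimes> inv y"
  using assms by (induction n) (simp_all add: m_assoc)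

section \<open>Ordered products and the power of a product\<close>

primrec ordered_prod :: "(nat \<Rightarrow> 'a) \<Rightarrow> nat \<Rightarrow> 'a" where
  "ordered_prod f 0 = \<one>"
| "ordered_prod f (Suc n) = ordered_prod f n \<otimes> f n"

lemma ordered_prod_closed [simp, intro]:
  "(\<And>j. j < n \<Longrightarrow> f j \<in> carrier G) \<Longrightarrow> ordered_prod f n \<in> carrier G"
  by (induction n) auto

lemma ordered_prod_cong:
  "(\<And>j. j < n \<Longrightarrow> f j = g j) \<Longrightarrow> ordered_prod f n = ordered_prod g n"
  by (induction n) auto

lemma ordered_prod_commute:
  assumes "\<And>j. j < n \<Longrightarrow> f j \<in> carrier G" "g \<in> carrier G"
    and "\<And>j. j < n \<Longrightarrow> f j \<otimes> g = g \<otimes> f j"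
  shows "ordered_prod f n \<otimes> g = g \<otimes> ordered_prod f n"
  using assms
proof (induction n)
  case (Suc n)
  have "ordered_prod f (Suc n) \<otimes> g = ordered_prod f n \<otimes> (g \<otimes> f n)"
    using Suc.prems by (simp add: m_assoc)
  also have "\<dots> = g \<otimes> ordered_prod f (Suc n)"
    using Suc by (simp flip: m_assoc)
  finally show ?case .
qed simp

lemma ordered_prod_mult:
  assumes "\<And>j. j < n \<Longrightarrow> f j \<in> carrier G" "\<And>j. j < n \<Longrightarrow> g j \<in> carrier G"
    and "\<And>i j. i < n \<Longrightarrow> j < n \<Longrightarrow> f i \<otimes> g j = g j \<otimes> f i"
  shows "ordered_prod f n \<otimes> ordered_prod g n = ordered_prod (\<lambda>j. f j \<otimes> g j) n"
  using assms
proof (induction n)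
  case (Suc n)
  have "ordered_prod f (Suc n) \<otimes> ordered_prod g (Suc n)
      = ordered_prod f n \<otimes> (f n \<otimes> ordered_prod g n) \<otimes> g n"
    using Suc.prems by (simp add: m_assoc)
  also have "f n \<otimes> ordered_prod g n = ordered_prod g n \<otimes> f n"
    using Suc.prems by (intro ordered_prod_commute [symmetric]) auto
  also have "ordered_prod f n \<otimes> (ordered_prod g n \<otimes> f n) \<otimes> g n
      = (ordered_prod f n \<otimes> ordered_prod g n) \<otimes> (f n \<otimes> g n)"
    using Suc.prems by (simp add: m_assoc)
  finally show ?case
    using Suc by simp
qed simp

lemma ordered_prod_shift:
  assumes "\<And>j. j \<le> n \<Longrightarrow> f j \<in> carrier G"
    and "\<And>i j. i \<le> n \<Longrightarrow> j \<le> n \<Longrightarrow> f i \<otimes> f j = f j \<otimes> f i"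
  shows "ordered_prod (\<lambda>j. f (Suc j)) n \<otimes> f 0 = ordered_prod f (Suc n)"
  using assms
proof (induction n)
  case (Suc n)
  have "ordered_prod (\<lambda>j. f (Suc j)) (Suc n) \<otimes> f 0
      = ordered_prod (\<lambda>j. f (Suc j)) n \<otimes> (f (Suc n) \<otimes> f 0)"
    using Suc.prems by (simp add: m_assoc)
  also have "f (Suc n) \<otimes> f 0 = f 0 \<otimes> f (Suc n)"
    using Suc.prems by simp
  also have "ordered_prod (\<lambda>j. f (Suc j)) n \<otimes> (f 0 \<otimes> f (Suc n))
     = (ordered_prod (\<lambda>j. f (Suc j)) n \<otimes> f 0) \<otimes> f (Suc n)"
    using Suc.prems by (simp add: m_assoc)
  finally show ?case
    using Suc by simp
qed simp

lemma ordered_prod_conj: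
  assumes "\<And>j. j < n \<Longrightarrow> f j \<in> carrier G" "\<And>j. j < n \<Longrightarrow> g j \<in> carrier G" "x \<in> carrier G"
    and "\<And>j. j < n \<Longrightarrow> f j \<otimes> x = x \<otimes> g j"
  shows "ordered_prod f n \<otimes> x = x \<otimes> ordered_prod g n"
  using assms
proof (induction n)
  case (Suc n)
  have "ordered_prod f (Suc n) \<otimes> x = ordered_prod f n \<otimes> (x \<otimes> g n)"
    using Suc.prems by (simp add: m_assoc)
  also have "\<dots> = (ordered_prod f n \<otimes> x) \<otimes> g n"
    using Suc.prems by (simp add: m_assoc)
  also have "\<dots> = x \<otimes> ordered_prod g (Suc n)"
    using Suc by (simp add: m_assoc)
  finally show ?case .
qed simp

lemma pow_intertwine:
  assumes "a \<in> carrier G" "b \<in> carrier G" "x \<in> carrier G" "a \<otimes> x = x \<otimes> b"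
  shows "a [^] (n::nat) \<otimes> x = x \<otimes> b [^] n"
proof (induction n)
  case (Suc n)
  have "a [^] Suc n \<otimes> x = a [^] n \<otimes> (x \<otimes> b)"
    using assms by (simp add: m_assoc)
  also have "\<dots> = (a [^] n \<otimes> x) \<otimes> b"
    using assms by (simp add: m_assoc)
  finally show ?case
    using Suc assms by (simp add: m_assoc)
qed (use assms in simp)

lemma pow_commute:
  assumes "a \<in> carrier G" "b \<in> carrier G" "a \<otimes> b = b \<otimes> a"
  shows "a [^] (m::nat) \<otimes> b [^] (n::nat) = b [^] n \<otimes> a [^] m"
  using assms by (metis nat_pow_closed group_commutes_pow)

text \<open>Here \<open>W (Suc j)\<close> is the commutator of \<open>W j\<close> and \<open>x\<close>, so this is the binomial
  expansion of \<open>1 + \<sigma> + \<dots> + \<sigma>\<^sup>n\<^sup>-\<^sup>1\<close> in powers of \<open>\<sigma> - 1\<close>, where \<open>\<sigma>\<close> is conjugation by \<open>x\<close>.\<close>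
lemma pow_mult_binomial:
  assumes x: "x \<in> carrier G" and W: "\<And>j. W j \<in> carrier G"
    and comm: "\<And>i j. W i \<otimes> W j = W j \<otimes> W i"
    and conj: "\<And>j. W j \<otimes> x = x \<otimes> (W j \<otimes> W (Suc j))"
  shows "n \<le> m \<Longrightarrow> (x \<otimes> W 0) [^] n = x [^] n \<otimes> ordered_prod (\<lambda>j. W j [^] (n choose Suc j)) m"
proof (induction n)
  case 0
  have "ordered_prod (\<lambda>j. \<one>) m = \<one>"
    by (induction m) auto
  then show ?case
    by simp
next
  case (Suc n)
  have pc: "W i [^] (a::nat) \<otimes> W j [^] (b::nat) = W j [^] b \<otimes> W i [^] a" for i j a b
    using pow_commute W comm by blast
  let ?A = "ordered_prod (\<lambda>j. W j [^] (n choose Suc j)) m"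
  let ?B = "ordered_prod (\<lambda>j. W (Suc j) [^] (n choose Suc j)) m"
  let ?C = "ordered_prod (\<lambda>j. W j [^] (n choose j)) m"
  \<comment> \<open>Moving \<open>x\<close> to the left turns every \<open>W j\<close> into
    \<open>W j \<otimes> W (Suc j)\<close>; as all the \<open>W\<close> commute, the second factors
    separate off as \<open>?B\<close>.\<close>
  have 1: "?A \<otimes> x = x \<otimes> (?A \<otimes> ?B)"
  proof -
    have "?A \<otimes> x = x \<otimes> ordered_prod (\<lambda>j. (W j \<otimes> W (Suc j)) [^] (n choose Suc j)) m"
      using x W conj by (intro ordered_prod_conj pow_intertwine) auto
    also have "ordered_prod (\<lambda>j. (W j \<otimes> W (Suc j)) [^] (n choose Suc j)) m
       = ordered_prod (\<lambda>j. W j [^] (n choose Suc j) \<otimes> W (Suc j) [^] (n choose Suc j)) m"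
      using W comm by (intro ordered_prod_cong pow_mult_distrib) auto
    also have "\<dots> = ?A \<otimes> ?B"
      using W pc by (intro ordered_prod_mult [symmetric]) auto
    finally show ?thesis .
  qed
  \<comment> \<open>After the index shift, \<open>W 0\<close> supplies the missing factor with
    exponent \<open>n choose 0\<close>, and the surplus factor at index \<open>m\<close> is trivial
    because \<open>n < m\<close>. Pascal's rule then merges \<open>?A\<close> and
    \<open>?C\<close>.\<close>
  have 2: "?B \<otimes> W 0 = ?C"
  proof -
    have "?B \<otimes> W 0 = ?B \<otimes> W 0 [^] (n choose 0)"
      using W by simp
    also have "\<dots> = ordered_prod (\<lambda>j. W j [^] (n choose j)) (Suc m)"
      using W pc by (intro ordered_prod_shift [of m "\<lambda>j. W j [^] (n choose j)"]) auto
    also have "\<dots> = ?C"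
      using Suc.prems W by (simp add: binomial_eq_0)
    finally show ?thesis .
  qed
  have cl: "?A \<in> carrier G" "?B \<in> carrier G" "?C \<in> carrier G"
    using W by auto
  have "(x \<otimes> W 0) [^] Suc n = x [^] n \<otimes> ?A \<otimes> (x \<otimes> W 0)"
    using Suc by simp
  also have "\<dots> = x [^] n \<otimes> (?A \<otimes> x) \<otimes> W 0"
    using x W cl by (simp add: m_assoc)
  also have "\<dots> = x [^] n \<otimes> x \<otimes> (?A \<otimes> (?B \<otimes> W 0))"
    unfolding 1 using x W cl by (simp add: m_assoc)
  also have "?A \<otimes> (?B \<otimes> W 0) = ?A \<otimes> ?C"
    unfolding 2 ..
  also have "\<dots> = ordered_prod (\<lambda>j. W j [^] (n choose Suc j) \<otimes> W j [^] (n choose j)) m"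
    using W pc by (intro ordered_prod_mult) auto
  also have "\<dots> = ordered_prod (\<lambda>j. W j [^] (Suc n choose Suc j)) m"
    using W by (intro ordered_prod_cong) (simp add: nat_pow_mult add.commute)
  finally show ?case
    by simp
qed

end

text \<open>Cosets are right cosets, as in \<open>FactGroup\<close>, while a valuation measures
  \<open>inv x \<otimes> y\<close>; normality makes both describe the same congruence.\<close>

lemma (in normal) rcos_eq_iff:
  assumes "x \<in> carrier G" "y \<in> carrier G"
  shows "H #> x = H #> y \<longleftrightarrow> inv x \<otimes> y \<in> H"
proof -
  have "H #> x = H #> y \<longleftrightarrow> y \<otimes> inv x \<in> H"
    using assms by (metis rcos_module rcos_self repr_independence is_group is_subgroup)
  also have "\<dots> \<longleftrightarrow> inv x \<otimes> y \<in> H"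
  proof
    assume "y \<otimes> inv x \<in> H"
    from inv_op_closed1 [OF assms(1) this] show "inv x \<otimes> y \<in> H"
      using assms by (simp add: m_assoc)
  next
    assume "inv x \<otimes> y \<in> H"
    from inv_op_closed2 [OF assms(1) this] show "y \<otimes> inv x \<in> H"
      using assms by (simp add: m_assoc)
  qed
  finally show ?thesis .
qed

lemma (in normal) rcos_mult_cong:
  assumes "H #> x = H #> x'" "H #> y = H #> y'"
    and "x \<in> carrier G" "x' \<in> carrier G" "y \<in> carrier G" "y' \<in> carrier G"
  shows "H #> (x \<otimes> y) = H #> (x' \<otimes> y')"
  using assms by (metis rcos_sum)

lemma (in normal) rcos_pow_cong:
  assumes "H #> x = H #> y" "x \<in> carrier G" "y \<in> carrier G"
  shows "H #> (x [^] (n::nat)) = H #> (y [^] n)"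
  using assms by (metis FactGroup_pow)

lemma (in normal) rcos_commute_iff:
  assumes "x \<in> carrier G" "y \<in> carrier G"
  shows "H #> (x \<otimes> y) = H #> (y \<otimes> x) \<longleftrightarrow> gcomm G x y \<in> H"
proof -
  have "gcomm G x y = (x \<otimes> y) \<otimes> inv (y \<otimes> x)"
    using assms by (simp add: gcomm_def inv_mult_group m_assoc)
  moreover have "H #> (y \<otimes> x) = H #> (x \<otimes> y) \<longleftrightarrow> (x \<otimes> y) \<otimes> inv (y \<otimes> x) \<in> H"
    using assms by (metis m_closed rcos_module rcos_self repr_independence is_group is_subgroup)
  ultimately show ?thesis
    by auto
qed

lemma (in normal) rcos_pow_mult:
  assumes "x \<in> carrier G" "y \<in> carrier G" "gcomm G x y \<in> H"
  shows "H #> ((x \<otimes> y) [^] (n::nat)) = H #> (x [^] n \<otimes> y [^] n)"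
proof -
  interpret Q: group "G Mod H"
    by (rule factorgroup_is_group)
  have "(H #> x) \<otimes>\<^bsub>G Mod H\<^esub> (H #> y) = (H #> y) \<otimes>\<^bsub>G Mod H\<^esub> (H #> x)"
    using assms rcos_commute_iff by (simp add: rcos_sum)
  then have "((H #> x) \<otimes>\<^bsub>G Mod H\<^esub> (H #> y)) [^]\<^bsub>G Mod H\<^esub> n
      = (H #> x) [^]\<^bsub>G Mod H\<^esub> n \<otimes>\<^bsub>G Mod H\<^esub> (H #> y) [^]\<^bsub>G Mod H\<^esub> n"
    using assms by (intro Q.pow_mult_distrib) (auto simp: carrier_FactGroup)
  then show ?thesis
    using assms by (simp add: rcos_sum FactGroup_pow)
qed

section \<open>Filtered groups\<close>

text \<open>Weaker than a p-valuation in two respects: the value infinity may occur on a nontrivial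
  subgroup, and p-th powers may gain more than 1. Both can happen for the filtration induced on a
  quotient.\<close>

locale filtered_group = group G for G (structure) +
  fixes p :: nat and v :: "'a \<Rightarrow> ereal"
  assumes prime_p: "Factorial_Ring.prime p"
    and v_one: "v \<one> = \<infinity>"
    and v_gt: "x \<in> carrier G \<Longrightarrow> ereal (1 / (real p - 1)) < v x"
    and v_diff: "x \<in> carrier G \<Longrightarrow> y \<in> carrier G \<Longrightarrow> min (v x) (v y) \<le> v (inv x \<otimes> y)"
    and v_gcomm: "x \<in> carrier G \<Longrightarrow> y \<in> carrier G \<Longrightarrow> v x + v y \<le> v (gcomm G x y)"
    and v_pow: "x \<in> carrier G \<Longrightarrow> v x + 1 \<le> v (x [^] p)"
begin

definition level :: "ereal \<Rightarrow> 'a set" where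
  "level \<mu> = {x \<in> carrier G. \<mu> \<le> v x}"

definition level_gt :: "ereal \<Rightarrow> 'a set" where
  "level_gt \<mu> = {x \<in> carrier G. \<mu> < v x}"

abbreviation gap :: real where
  "gap \<equiv> 1 / (real p - 1)"

lemma gap_pos: "0 < gap"
  using prime_gt_1_nat [OF prime_p] by simp

lemma v_pos: "x \<in> carrier G \<Longrightarrow> 0 < v x"
  using v_gt [of x] gap_pos by (metis ereal_less(2) less_trans)

lemma v_inv: "x \<in> carrier G \<Longrightarrow> v x \<le> v (inv x)"
  using v_diff [of x \<one>] by (simp add: v_one)

lemma v_mult: "x \<in> carrier G \<Longrightarrow> y \<in> carrier G \<Longrightarrow> min (v x) (v y) \<le> v (x \<otimes> y)"
  using v_diff [of "inv x" y] v_inv [of x] by (auto simp: min_def split: if_splits)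

lemma v_conj:
  assumes "x \<in> carrier G" "h \<in> carrier G"
  shows "v h \<le> v (x \<otimes> h \<otimes> inv x)"
proof -
  have "x \<otimes> h \<otimes> inv x = gcomm G x h \<otimes> h"
    using assms by (simp add: gcomm_def m_assoc)
  moreover have "v h \<le> v x + v h"
    using v_pos [of x] assms by (simp add: add_increasing)
  then have "v h \<le> v (gcomm G x h)"
    using v_gcomm [of x h] assms by auto
  ultimately show ?thesis
    using v_mult [of "gcomm G x h" h] assms by auto
qed

lemma normal_level: "level \<mu> \<lhd> G"
  unfolding normal_inv_iff
proof (intro conjI ballI subgroupI)
  show "level \<mu> \<noteq> {}"
    using v_one by (auto simp: level_def)
  show "a \<otimes> b \<in> level \<mu>" if "a \<in> level \<mu>" "b \<in> level \<mu>" for a b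
    using that v_mult [of a b] by (auto simp: level_def min_def split: if_splits)
  show "inv a \<in> level \<mu>" if "a \<in> level \<mu>" for a
    using that v_inv [of a] by (auto simp: level_def)
  show "x \<otimes> h \<otimes> inv x \<in> level \<mu>" if "x \<in> carrier G" "h \<in> level \<mu>" for x h
    using that v_conj [of x h] by (auto simp: level_def)
qed (auto simp: level_def)

lemma normal_level_gt:
  assumes "\<mu> < \<infinity>"
  shows "level_gt \<mu> \<lhd> G"
  unfolding normal_inv_iff
proof (intro conjI ballI subgroupI)
  have "\<one> \<in> level_gt \<mu>"
    using v_one assms by (auto simp: level_gt_def)
  then show "level_gt \<mu> \<noteq> {}"
    by blast
  show "a \<otimes> b \<in> level_gt \<mu>" if "a \<in> level_gt \<mu>" "b \<in> level_gt \<mu>" for a b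
    using that v_mult [of a b] by (auto simp: level_gt_def min_def split: if_splits)
  show "inv a \<in> level_gt \<mu>" if "a \<in> level_gt \<mu>" for a
    using that v_inv [of a] by (auto simp: level_gt_def)
  show "x \<otimes> h \<otimes> inv x \<in> level_gt \<mu>" if "x \<in> carrier G" "h \<in> level_gt \<mu>" for x h
    using that v_conj [of x h] by (auto simp: level_gt_def)
qed (auto simp: level_gt_def)

lemma level_subset_level: "\<mu> \<le> \<mu>' \<Longrightarrow> level \<mu>' \<subseteq> level \<mu>"
  by (auto simp: level_def)

lemma level_infinity_subset: "\<mu> < \<infinity> \<Longrightarrow> level \<infinity> \<subseteq> level_gt \<mu>"
  by (auto simp: level_def level_gt_def)

lemma v_pow_nat: "x \<in> carrier G \<Longrightarrow> v x \<le> v (x [^] (n::nat))"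
proof (induction n)
  case (Suc n)
  then show ?case
    using v_mult [of "x [^] n" x] by (auto simp: min_def split: if_splits)
qed (simp add: v_one)

lemma v_pow_pow: "x \<in> carrier G \<Longrightarrow> v x + ereal (real n) \<le> v (x [^] (p ^ n))"
proof (induction n)
  case (Suc n)
  have "v x + ereal (real (Suc n)) = v x + ereal (real n) + 1"
    by (cases "v x") (auto simp: one_ereal_def)
  also have "\<dots> \<le> v (x [^] (p ^ n)) + 1"
    using Suc by (intro add_right_mono) auto
  also have "\<dots> \<le> v (x [^] (p ^ Suc n))"
    using v_pow [of "x [^] (p ^ n)"] Suc.prems by (simp add: nat_pow_pow mult.commute)
  finally show ?case .
qed simp

text \<open>All values exceed \<open>gap\<close>, so the other entry of the commutator, however
  shallow, contributes a strict gain of \<open>gap\<close>.\<close>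

lemma v_gcomm_gap:
  assumes "x \<in> carrier G" "y \<in> carrier G" "ereal b \<le> v x"
  shows "ereal (b + gap) < v (gcomm G x y)"
proof -
  have "ereal (b + gap) = ereal b + ereal gap"
    by simp
  also have "\<dots> < v x + v y"
    using assms v_gt [of y] by (cases "v x"; cases "v y") auto
  also have "\<dots> \<le> v (gcomm G x y)"
    using assms by (intro v_gcomm)
  finally show ?thesis .
qed

lemma v_gcomm_gap':
  assumes "x \<in> carrier G" "y \<in> carrier G" "ereal b \<le> v y"
  shows "ereal (b + gap) < v (gcomm G x y)"
proof -
  have "ereal (b + gap) = ereal gap + ereal b"
    by simp
  also have "\<dots> < v x + v y"
    using assms v_gt [of x] by (cases "v x"; cases "v y") auto
  also have "\<dots> \<le> v (gcomm G x y)"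
    using assms by (intro v_gcomm)
  finally show ?thesis .
qed

text \<open>Expand \<open>(x \<otimes> w) [^] p\<close> in the iterated commutators
  \<open>W j\<close> of \<open>w\<close> with \<open>x\<close>. Modulo values above
  \<open>b + 1\<close> the \<open>W j\<close> commute, because \<open>1 < b\<close> gives
  \<open>b + b > b + 1\<close>. Of the factors \<open>W j [^] (p choose Suc j)\<close> only the one
  at \<open>j = 0\<close> survives, and it is \<open>w [^] p\<close>.\<close>

lemma pow_mult_level:
  assumes x: "x \<in> carrier G" and w: "w \<in> carrier G" and b: "1 < b" "ereal b \<le> v w"
  shows "level_gt (ereal (b + 1)) #> ((x \<otimes> w) [^] p) = level_gt (ereal (b + 1)) #> (x [^] p \<otimes> w [^] p)"
proof -
  define M where "M = level_gt (ereal (b + 1))"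
  interpret M: normal M G
    unfolding M_def by (rule normal_level_gt) simp
  interpret Q: group "G Mod M"
    by (rule M.factorgroup_is_group)
  have M_I: "y \<in> M" if "y \<in> carrier G" "ereal (b + 1) < v y" for y
    using that by (simp add: M_def level_gt_def)
  \<comment> \<open>The inverses in the commutator make
    \<open>W j \<otimes> x = x \<otimes> (W j \<otimes> W (Suc j))\<close> an exact equation, as
    \<open>pow_mult_binomial\<close> requires.\<close>
  define W where "W = (\<lambda>n. ((\<lambda>y. gcomm G (inv y) (inv x)) ^^ n) w)"
  have W_0: "W 0 = w" and W_Suc: "W (Suc n) = gcomm G (inv (W n)) (inv x)" for n
    by (simp_all add: W_def)
  have W_carrier: "W n \<in> carrier G" for n
    by (induction n) (use x w in \<open>auto simp: W_0 W_Suc\<close>)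
  have W_level: "ereal (b + real n * gap) \<le> v (W n) \<and> (0 < n \<longrightarrow> ereal (b + real n * gap) < v (W n))" for n
  proof (induction n)
    case (Suc n)
    have "ereal (b + real n * gap) \<le> v (inv (W n))"
      using Suc v_inv [OF W_carrier [of n]] by auto
    then have "ereal (b + real n * gap + gap) < v (W (Suc n))"
      unfolding W_Suc using W_carrier x by (intro v_gcomm_gap) auto
    moreover have "b + real n * gap + gap = b + real (Suc n) * gap"
      by (simp add: ring_distribs add_divide_distrib)
    ultimately show ?case
      by (metis less_imp_le)
  qed (use b in \<open>simp add: W_0\<close>)
  have W_b: "ereal b \<le> v (W n)" "0 < n \<Longrightarrow> ereal b < v (W n)" for n
  proof -
    have le: "ereal b \<le> ereal (b + real n * gap)"
      using gap_pos by simp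
    show "ereal b \<le> v (W n)"
      using W_level [of n] le by (meson order_trans)
    show "ereal b < v (W n)" if "0 < n"
      using W_level [of n] le that by (meson le_less_trans)
  qed
  have conj: "W j \<otimes> x = x \<otimes> (W j \<otimes> W (Suc j))" for j
    unfolding W_Suc gcomm_def using W_carrier [of j] x by (simp add: m_assoc)
  have comm: "gcomm G (W i) (W j) \<in> M" for i j
  proof -
    have "ereal (b + 1) < ereal b + ereal b"
      using b by simp
    also have "\<dots> \<le> v (W i) + v (W j)"
      by (intro add_mono W_b)
    also have "\<dots> \<le> v (gcomm G (W i) (W j))"
      by (rule v_gcomm [OF W_carrier W_carrier])
    finally have "ereal (b + 1) < v (gcomm G (W i) (W j))" .
    then show ?thesis
      by (rule M_I [OF gcomm_closed [OF W_carrier W_carrier]])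
  qed
  have p: "1 < p"
    using prime_p by (rule prime_gt_1_nat)
  \<comment> \<open>For \<open>j < p - 1\<close> the exponent is divisible by \<open>p\<close> and
    \<open>W j\<close> already lies strictly above \<open>b\<close>, so a p-th power suffices. At
    \<open>j = p - 1\<close> the exponent is 1, but \<open>p - 1\<close> commutators have gained
    more than \<open>(p - 1) * gap = 1\<close>.\<close>
  have trivial: "(M #> W j) [^]\<^bsub>G Mod M\<^esub> (p choose Suc j) = \<one>\<^bsub>G Mod M\<^esub>" if j: "0 < j" "j < p" for j
  proof (cases "j = p - 1")
    case True
    then have "real j * gap = 1"
      using p by (simp add: of_nat_diff)
    then have "ereal (b + 1) < v (W j)"
      using W_level [of j] j by metis
    then have "W j \<in> M"
      by (rule M_I [OF W_carrier])
    then have "M #> W j = M"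
      by (simp add: M.rcos_const)
    then show ?thesis
      using Q.nat_pow_one by simp
  next
    case False
    then have "p dvd p choose Suc j"
      using j prime_p by (intro dvd_choose_prime) auto
    then obtain k where k: "p choose Suc j = p * k" ..
    have "ereal (b + 1) < v (W j) + 1"
      using W_b(2) [OF j(1)] by (cases "v (W j)") (auto simp: one_ereal_def)
    also have "\<dots> \<le> v (W j [^] p)"
      by (rule v_pow [OF W_carrier])
    finally have "W j [^] p \<in> M"
      by (rule M_I [OF nat_pow_closed [OF W_carrier]])
    then have "M #> (W j [^] p) = M"
      by (simp add: M.rcos_const)
    then have "(M #> W j) [^]\<^bsub>G Mod M\<^esub> p = \<one>\<^bsub>G Mod M\<^esub>"
      using W_carrier by (simp add: M.FactGroup_pow)
    moreover have "M #> W j \<in> carrier (G Mod M)"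
      using W_carrier by (auto simp: carrier_FactGroup)
    ultimately show ?thesis
      unfolding k by (simp only: Q.nat_pow_pow [symmetric] Q.nat_pow_one)
  qed
  have prod: "Q.ordered_prod (\<lambda>j. (M #> W j) [^]\<^bsub>G Mod M\<^esub> (p choose Suc j)) (Suc n) = (M #> w) [^]\<^bsub>G Mod M\<^esub> p"
    if "Suc n \<le> p" for n
    using that
  proof (induction n)
    case 0
    have "(M #> w) [^]\<^bsub>G Mod M\<^esub> p \<in> carrier (G Mod M)"
      using w by (intro Q.nat_pow_closed) (auto simp: carrier_FactGroup)
    then show ?case
      using Q.l_one by (simp add: W_0)
  next
    case (Suc n)
    have "(M #> w) [^]\<^bsub>G Mod M\<^esub> p \<in> carrier (G Mod M)"
      using w by (intro Q.nat_pow_closed) (auto simp: carrier_FactGroup)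
    then show ?case
      using Suc trivial [of "Suc n"] Q.r_one by (simp only: Q.ordered_prod.simps)
  qed
  have "((M #> x) \<otimes>\<^bsub>G Mod M\<^esub> (M #> W 0)) [^]\<^bsub>G Mod M\<^esub> p
      = (M #> x) [^]\<^bsub>G Mod M\<^esub> p \<otimes>\<^bsub>G Mod M\<^esub>
        Q.ordered_prod (\<lambda>j. (M #> W j) [^]\<^bsub>G Mod M\<^esub> (p choose Suc j)) p"
  proof (rule Q.pow_mult_binomial)
    show "(M #> W j) \<otimes>\<^bsub>G Mod M\<^esub> (M #> x)
        = (M #> x) \<otimes>\<^bsub>G Mod M\<^esub> ((M #> W j) \<otimes>\<^bsub>G Mod M\<^esub> (M #> W (Suc j)))" for j
      using conj [of j] W_carrier x by (simp add: M.rcos_sum)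
    show "(M #> W i) \<otimes>\<^bsub>G Mod M\<^esub> (M #> W j) = (M #> W j) \<otimes>\<^bsub>G Mod M\<^esub> (M #> W i)" for i j
      using comm [of i j] W_carrier by (simp add: M.rcos_sum M.rcos_commute_iff)
  qed (use x W_carrier in \<open>auto simp: carrier_FactGroup\<close>)
  also have "Q.ordered_prod (\<lambda>j. (M #> W j) [^]\<^bsub>G Mod M\<^esub> (p choose Suc j)) p = (M #> w) [^]\<^bsub>G Mod M\<^esub> p"
    using prod [of "p - 1"] p by simp
  finally have "M #> ((x \<otimes> w) [^] p) = M #> (x [^] p \<otimes> w [^] p)"
    using x w by (simp add: W_0 M.rcos_sum M.FactGroup_pow)
  then show ?thesis
    by (simp add: M_def)
qed

section \<open>Torsion and roots modulo the elements of infinite value\<close>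

definition torsion :: "'a set" where
  "torsion = {x \<in> carrier G. \<exists>n. x [^] (p ^ n) \<in> level \<infinity>}"

lemma level_infinity_pow_mono:
  assumes "x \<in> carrier G" "x [^] (p ^ m) \<in> level \<infinity>" "m \<le> n"
  shows "x [^] (p ^ n) \<in> level \<infinity>"
proof -
  have "x [^] (p ^ n) = (x [^] (p ^ m)) [^] (p ^ (n - m))"
    using assms by (simp add: nat_pow_pow flip: power_add)
  then show ?thesis
    using assms v_pow_nat [of "x [^] (p ^ m)" "p ^ (n - m)"] by (auto simp: level_def)
qed

end

text \<open>\<open>1 < \<nu>\<close> is what \<open>pow_mult_level\<close> demands of a deep factor.
  The exact gain of p-th powers beyond \<nu> keeps deep elements from being torsion modulo
  \<open>level \<infinity>\<close>.\<close>

locale deep_filtered_group = filtered_group +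
  fixes \<nu> :: real
  assumes deep_gt: "1 < \<nu>"
    and v_pow_deep: "x \<in> carrier G \<Longrightarrow> ereal \<nu> \<le> v x \<Longrightarrow> v (x [^] p) = v x + 1"
begin

interpretation K: normal "level \<infinity>" G
  by (rule normal_level)

text \<open>If \<open>w\<close> had a finite value \<open>b\<close>, the congruence for
  \<open>(x \<otimes> w) [^] p\<close> would put \<open>w [^] p\<close> strictly above
  \<open>b + 1\<close>, against the exact gain of 1.\<close>

lemma deep_quotient_of_pth_roots:
  assumes x: "x \<in> carrier G" and w: "w \<in> carrier G" and deep: "ereal \<nu> \<le> v w"
    and eq: "level \<infinity> #> (x \<otimes> w) [^] p = level \<infinity> #> x [^] p"
  shows "w \<in> level \<infinity>"
proof (rule ccontr)
  assume "w \<notin> level \<infinity>"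
  then obtain b where b: "v w = ereal b"
    using w deep by (cases "v w") (auto simp: level_def)
  then have b1: "1 < b"
    using deep deep_gt by simp
  interpret M: normal "level_gt (ereal (b + 1))" G
    by (rule normal_level_gt) simp
  have "level_gt (ereal (b + 1)) #> x [^] p = level_gt (ereal (b + 1)) #> (x \<otimes> w) [^] p"
    using eq x w level_infinity_subset [of "ereal (b + 1)"]
    by (subst M.rcos_eq_iff; (subst (asm) eq_commute, subst (asm) K.rcos_eq_iff)?) auto
  also have "\<dots> = level_gt (ereal (b + 1)) #> (x [^] p \<otimes> w [^] p)"
    using x w b b1 by (intro pow_mult_level) auto
  finally have "w [^] p \<in> level_gt (ereal (b + 1))"
    using x w by (simp add: M.rcos_eq_iff)
  then show False
    using v_pow_deep [OF w deep] b by (simp add: level_gt_def one_ereal_def)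
qed

lemma deep_quotient_of_roots:
  assumes "x \<in> carrier G" "w \<in> carrier G" "ereal \<nu> \<le> v w"
    and "level \<infinity> #> (x \<otimes> w) [^] (p ^ n) = level \<infinity> #> x [^] (p ^ n)"
  shows "w \<in> level \<infinity>"
  using assms
proof (induction n arbitrary: x w)
  case 0
  then have "level \<infinity> #> x = level \<infinity> #> (x \<otimes> w)"
    by simp
  then show ?case
    using 0 by (simp add: K.rcos_eq_iff)
next
  case (Suc n)
  interpret L: normal "level (ereal \<nu>)" G
    by (rule normal_level)
  \<comment> \<open>Powers respect congruence modulo \<open>level (ereal \<nu>)\<close>, so the
    quotient \<open>w'\<close> of the p-th powers is again deep and the induction hypothesis applies
    to it.\<close>
  define w' where "w' = inv (x [^] p) \<otimes> (x \<otimes> w) [^] p"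
  have w': "w' \<in> carrier G"
    using Suc.prems by (simp add: w'_def)
  have "level (ereal \<nu>) #> x = level (ereal \<nu>) #> (x \<otimes> w)"
    using Suc.prems by (subst L.rcos_eq_iff) (auto simp: level_def)
  then have "level (ereal \<nu>) #> x [^] p = level (ereal \<nu>) #> (x \<otimes> w) [^] p"
    using Suc.prems by (intro L.rcos_pow_cong) auto
  then have "w' \<in> level (ereal \<nu>)"
    using Suc.prems by (simp add: L.rcos_eq_iff w'_def)
  then have "ereal \<nu> \<le> v w'"
    by (simp add: level_def)
  moreover have "x [^] p \<otimes> w' = (x \<otimes> w) [^] p"
    using Suc.prems by (simp add: w'_def)
  ultimately have "w' \<in> level \<infinity>"
    using Suc.prems w' by (intro Suc.IH [of "x [^] p"]) (simp_all add: nat_pow_pow)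
  then have "level \<infinity> #> x [^] p = level \<infinity> #> (x \<otimes> w) [^] p"
    using Suc.prems by (simp add: K.rcos_eq_iff w'_def)
  then show ?case
    using Suc.prems deep_quotient_of_pth_roots by metis
qed

lemma torsion_subset_carrier: "torsion \<subseteq> carrier G"
  by (auto simp: torsion_def)

lemma torsion_inv: "x \<in> torsion \<Longrightarrow> inv x \<in> torsion"
  by (auto simp: torsion_def nat_pow_inv)

lemma torsion_conj: "x \<in> torsion \<Longrightarrow> y \<in> carrier G \<Longrightarrow> y \<otimes> x \<otimes> inv y \<in> torsion"
  using K.inv_op_closed2 by (fastforce simp: torsion_def pow_conj)

lemma level_infinity_subset_torsion: "level \<infinity> \<subseteq> torsion"
proof
  fix x assume "x \<in> level \<infinity>"
  then have "x \<in> carrier G" "x [^] (p ^ 0) \<in> level \<infinity>"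
    by (auto simp: level_def)
  then show "x \<in> torsion"
    unfolding torsion_def by blast
qed

lemma torsion_common_exponent:
  assumes "x \<in> torsion" "y \<in> torsion"
  obtains n where "x [^] (p ^ n) \<in> level \<infinity>" "y [^] (p ^ n) \<in> level \<infinity>"
proof -
  obtain m n where "x \<in> carrier G" "x [^] (p ^ m) \<in> level \<infinity>" "y \<in> carrier G" "y [^] (p ^ n) \<in> level \<infinity>"
    using assms unfolding torsion_def by blast
  then have "x [^] (p ^ max m n) \<in> level \<infinity>" "y [^] (p ^ max m n) \<in> level \<infinity>"
    by (auto intro: level_infinity_pow_mono)
  then show ?thesis
    by (rule that)
qed

text \<open>All values are positive, so enough steps of size \<open>gap\<close> down from \<nu> end
  below any of them. The number of steps is the induction variable of the arguments for shallow
  elements.\<close>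

lemma deep_reach:
  assumes "w \<in> carrier G"
  obtains k :: nat where "ereal (\<nu> - real k * gap) \<le> v w"
proof -
  obtain k :: nat where "\<nu> / gap < real k"
    using reals_Archimedean2 by blast
  then have "\<nu> - real k * gap \<le> 0"
    using gap_pos by (simp add: field_simps)
  then have "ereal (\<nu> - real k * gap) \<le> v w"
    using v_pos [OF assms] by (metis ereal_less_eq(3) less_imp_le order_trans zero_ereal_def)
  then show ?thesis
    by (rule that)
qed

lemma deep_torsion_quotient:
  assumes "x \<in> torsion" "w \<in> carrier G" "x \<otimes> w \<in> torsion" "ereal \<nu> \<le> v w"
  shows "w \<in> level \<infinity>"
proof -
  have x: "x \<in> carrier G"
    using assms torsion_subset_carrier by auto
  obtain n where "x [^] (p ^ n) \<in> level \<infinity>" "(x \<otimes> w) [^] (p ^ n) \<in> level \<infinity>"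
    using torsion_common_exponent assms by blast
  then have "level \<infinity> #> (x \<otimes> w) [^] (p ^ n) = level \<infinity> #> x [^] (p ^ n)"
    by (simp add: K.rcos_const)
  then show ?thesis
    using x assms deep_quotient_of_roots by blast
qed

text \<open>Induction on how many gaps \<open>w\<close> may lie below \<nu>. It treats quotients of
  torsion elements rather than products, because the induction controls the depth of the quotient
  \<open>w\<close>. Modulo the deeper torsion, \<open>x\<close> and \<open>w\<close> commute, so a
  common exponent that kills \<open>x\<close> and \<open>x \<otimes> w\<close> sends
  \<open>w\<close> into the deeper torsion.\<close>

lemma torsion_quotient_aux:
  assumes "ereal (\<nu> - real k * gap) \<le> v w" "x \<in> torsion" "w \<in> carrier G" "x \<otimes> w \<in> torsion"
  shows "w \<in> torsion"
  using assms
proof (induction k arbitrary: x w)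
  case 0
  then show ?case
    using deep_torsion_quotient level_infinity_subset_torsion by fastforce
next
  case (Suc k)
  define c where "c = \<nu> - real k * gap"
  \<comment> \<open>At this stage only the part of \<open>torsion\<close> one gap deeper is known to
    be closed under products; it serves as the modulus.\<close>
  define S where "S = torsion \<inter> level (ereal c)"
  have IH: "w \<in> torsion" if "ereal c \<le> v w" "x \<in> torsion" "w \<in> carrier G" "x \<otimes> w \<in> torsion" for x w
    using Suc.IH that by (simp add: c_def)
  have x: "x \<in> carrier G"
    using Suc.prems torsion_subset_carrier by auto
  interpret L: normal "level (ereal c)" G
    by (rule normal_level)
  have K_S: "level \<infinity> \<subseteq> S"
    using level_infinity_subset_torsion level_subset_level [of "ereal c" \<infinity>] by (auto simp: S_def)
  have S_normal: "S \<lhd> G"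
  proof -
    have "subgroup S G"
    proof (rule subgroupI)
      show "S \<subseteq> carrier G"
        using torsion_subset_carrier by (auto simp: S_def)
      show "S \<noteq> {}"
        using K_S K.one_closed by blast
      show inv: "inv a \<in> S" if "a \<in> S" for a
        using that torsion_inv by (auto simp: S_def)
      show "a \<otimes> b \<in> S" if ab: "a \<in> S" "b \<in> S" for a b
      proof -
        have "a \<otimes> b \<in> level (ereal c)" "a \<in> carrier G" "b \<in> carrier G"
          using ab torsion_subset_carrier by (auto simp: S_def)
        then show ?thesis
          using IH [of "a \<otimes> b" "inv a"] inv [OF ab(1)] ab by (auto simp: S_def level_def)
      qed
    qed
    then show ?thesis
      unfolding normal_inv_iff using torsion_conj L.inv_op_closed2 torsion_subset_carrier
      by (auto simp: S_def)
  qed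
  interpret S: normal S G
    by (rule S_normal)
  have "\<nu> - real (Suc k) * gap + gap = c"
    using gap_pos by (simp add: c_def algebra_simps add_divide_distrib)
  then have gcomm_level: "ereal c < v (gcomm G x w)"
    using v_gcomm_gap' [OF x Suc.prems(3,1)] by metis
  \<comment> \<open>The commutator is itself a quotient of two torsion elements,
    \<open>inv x\<close> and its conjugate by \<open>w\<close>, and it lies one gap deeper, so the
    induction hypothesis covers it.\<close>
  have "inv x \<otimes> gcomm G x w = w \<otimes> inv x \<otimes> inv w"
    using x Suc.prems by (simp add: gcomm_def m_assoc)
  then have "inv x \<otimes> gcomm G x w \<in> torsion"
    using torsion_conj torsion_inv Suc.prems by simp
  then have "gcomm G x w \<in> torsion"
    by (rule IH [OF less_imp_le [OF gcomm_level] torsion_inv [OF Suc.prems(2)] gcomm_closed [OF x Suc.prems(3)]])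
  then have "gcomm G x w \<in> S"
    using gcomm_level gcomm_closed [OF x Suc.prems(3)] by (simp add: S_def level_def)
  then have comm: "S #> (x \<otimes> w) [^] n = S #> (x [^] n \<otimes> w [^] n)" for n :: nat
    using x Suc.prems by (intro S.rcos_pow_mult)
  obtain n where n: "x [^] (p ^ n) \<in> level \<infinity>" "(x \<otimes> w) [^] (p ^ n) \<in> level \<infinity>"
    using torsion_common_exponent Suc.prems(2,4) by blast
  have "S #> x [^] (p ^ n) = S" "S #> (x \<otimes> w) [^] (p ^ n) = S"
    using n K_S S.rcos_const [OF is_group] by blast+
  then have "S #> x [^] (p ^ n) = S #> (x [^] (p ^ n) \<otimes> w [^] (p ^ n))"
    using comm [of "p ^ n"] by metis
  then have "w [^] (p ^ n) \<in> S"
    using x Suc.prems(3) by (simp add: S.rcos_eq_iff)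
  then have "w [^] (p ^ n) \<in> torsion"
    by (simp add: S_def)
  then obtain l where "(w [^] (p ^ n)) [^] (p ^ l) \<in> level \<infinity>"
    unfolding torsion_def by blast
  then have "w [^] (p ^ (n + l)) \<in> level \<infinity>"
    using Suc.prems(3) by (simp add: nat_pow_pow power_add)
  then show ?case
    using Suc.prems(3) unfolding torsion_def by blast
qed

lemma normal_torsion: "torsion \<lhd> G"
proof -
  have mult: "a \<otimes> b \<in> torsion" if "a \<in> torsion" "b \<in> torsion" for a b
  proof -
    have ab: "a \<in> carrier G" "b \<in> carrier G"
      using that torsion_subset_carrier by auto
    obtain k :: nat where "ereal (\<nu> - real k * gap) \<le> v (a \<otimes> b)"
      using ab deep_reach by (metis m_closed)
    \<comment> \<open>The product \<open>a \<otimes> b\<close> is the quotient of the torsion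
      elements \<open>inv a\<close> and \<open>b\<close>.\<close>
    then show ?thesis
      using torsion_quotient_aux [of k "a \<otimes> b" "inv a"] ab that torsion_inv by simp
  qed
  have "subgroup torsion G"
  proof (rule subgroupI)
    show "torsion \<noteq> {}"
      using level_infinity_subset_torsion K.one_closed by blast
  qed (use torsion_subset_carrier torsion_inv mult in auto)
  then show ?thesis
    unfolding normal_inv_iff using torsion_conj by blast
qed

text \<open>With \<open>y = x \<otimes> w\<close>, the elements \<open>x\<close> and
  \<open>y \<otimes> x \<otimes> inv y\<close> have congruent p-th powers, since
  \<open>x [^] p\<close> and \<open>y [^] p\<close> agree and \<open>y\<close> commutes with its own
  power. Their quotient \<open>gcomm G w x\<close> lies one gap deeper than the bound for
  \<open>w\<close>, so by induction \<open>x\<close> and \<open>w\<close> commute modulo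
  \<open>level \<infinity>\<close>. Then \<open>w [^] p\<close> is trivial, and torsion-freeness
  finishes.\<close>

lemma roots_unique_aux:
  assumes tf: "torsion = level \<infinity>"
    and "ereal (\<nu> - real k * gap) \<le> v w" "x \<in> carrier G" "w \<in> carrier G"
    and "level \<infinity> #> (x \<otimes> w) [^] p = level \<infinity> #> x [^] p"
  shows "w \<in> level \<infinity>"
  using assms(2-)
proof (induction k arbitrary: x w)
  case 0
  then show ?case
    using deep_quotient_of_pth_roots by auto
next
  case (Suc k)
  define y where "y = x \<otimes> w"
  have y: "y \<in> carrier G"
    using Suc.prems by (simp add: y_def)
  have "\<nu> - real (Suc k) * gap + gap = \<nu> - real k * gap"
    using gap_pos by (simp add: algebra_simps add_divide_distrib)
  then have gcomm_level: "ereal (\<nu> - real k * gap) < v (gcomm G w x)"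
    using v_gcomm_gap [OF Suc.prems(3,2,1)] by metis
  have "x \<otimes> gcomm G w x = y \<otimes> x \<otimes> inv y"
    using Suc.prems by (simp add: y_def gcomm_def inv_mult_group m_assoc)
  then have "level \<infinity> #> (x \<otimes> gcomm G w x) [^] p = level \<infinity> #> (y \<otimes> x [^] p \<otimes> inv y)"
    using Suc.prems y by (simp add: pow_conj)
  also have "\<dots> = level \<infinity> #> (y \<otimes> y [^] p \<otimes> inv y)"
    using Suc.prems y
    by (intro K.rcos_mult_cong [OF K.rcos_mult_cong [OF refl] refl]) (auto simp: y_def)
  also have "y \<otimes> y [^] p \<otimes> inv y = y [^] p"
    using y pow_conj [of y y p] by (simp add: m_assoc)
  finally have "level \<infinity> #> (x \<otimes> gcomm G w x) [^] p = level \<infinity> #> x [^] p"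
    using Suc.prems by (simp add: y_def)
  then have "gcomm G w x \<in> level \<infinity>"
    using Suc.prems gcomm_level by (intro Suc.IH) auto
  then have "level \<infinity> #> (w \<otimes> x) = level \<infinity> #> (x \<otimes> w)"
    using Suc.prems by (simp add: K.rcos_commute_iff)
  then have "gcomm G x w \<in> level \<infinity>"
    using Suc.prems K.rcos_commute_iff by metis
  then have "level \<infinity> #> (x \<otimes> w) [^] p = level \<infinity> #> (x [^] p \<otimes> w [^] p)"
    using Suc.prems by (intro K.rcos_pow_mult)
  then have "level \<infinity> #> x [^] p = level \<infinity> #> (x [^] p \<otimes> w [^] p)"
    using Suc.prems by simp
  then have "w [^] p \<in> level \<infinity>"
    using Suc.prems by (simp add: K.rcos_eq_iff)
  then have "w [^] (p ^ 1) \<in> level \<infinity>"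
    by simp
  then show ?case
    using Suc.prems tf unfolding torsion_def by blast
qed

lemma roots_unique:
  assumes "torsion = level \<infinity>" "x \<in> carrier G" "y \<in> carrier G"
    and "level \<infinity> #> x [^] (p ^ n) = level \<infinity> #> y [^] (p ^ n)"
  shows "level \<infinity> #> x = level \<infinity> #> y"
  using assms(2-)
proof (induction n)
  case (Suc n)
  define w where "w = inv (x [^] (p ^ n)) \<otimes> y [^] (p ^ n)"
  have w: "w \<in> carrier G"
    using Suc.prems by (simp add: w_def)
  obtain k :: nat where "ereal (\<nu> - real k * gap) \<le> v w"
    using w deep_reach by metis
  moreover have "x [^] (p ^ n) \<otimes> w = y [^] (p ^ n)"
    using Suc.prems by (simp add: w_def)
  moreover have "level \<infinity> #> (y [^] (p ^ n)) [^] p = level \<infinity> #> (x [^] (p ^ n)) [^] p"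
    using Suc.prems by (simp add: nat_pow_pow mult.commute)
  ultimately have "w \<in> level \<infinity>"
    using assms(1) Suc.prems w roots_unique_aux [of k w "x [^] (p ^ n)"] by simp
  then have "level \<infinity> #> x [^] (p ^ n) = level \<infinity> #> y [^] (p ^ n)"
    using Suc.prems by (simp add: K.rcos_eq_iff w_def)
  then show ?case
    using Suc by simp
qed simp

text \<open>If \<open>x [^] (p ^ n)\<close> commutes with \<open>y\<close>, then \<open>x\<close>
  and its conjugate by \<open>y\<close> have congruent \<open>p ^ n\<close>-th powers, so they are
  congruent by uniqueness of roots.\<close>

lemma gcomm_pow_left:
  assumes "torsion = level \<infinity>" "x \<in> carrier G" "y \<in> carrier G" "gcomm G (x [^] (p ^ n)) y \<in> level \<infinity>"
  shows "gcomm G x y \<in> level \<infinity>"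
proof -
  have "level \<infinity> #> (x [^] (p ^ n) \<otimes> y) = level \<infinity> #> (y \<otimes> x [^] (p ^ n))"
    using assms by (simp add: K.rcos_commute_iff)
  then have "level \<infinity> #> (x [^] (p ^ n) \<otimes> y \<otimes> inv y) = level \<infinity> #> (y \<otimes> x [^] (p ^ n) \<otimes> inv y)"
    by (rule K.rcos_mult_cong) (use assms in auto)
  then have "level \<infinity> #> x [^] (p ^ n) = level \<infinity> #> (y \<otimes> x \<otimes> inv y) [^] (p ^ n)"
    unfolding pow_conj [OF assms(2,3)] using assms(2,3) by (simp add: m_assoc)
  then have "level \<infinity> #> x = level \<infinity> #> (y \<otimes> x \<otimes> inv y)"
    by (rule roots_unique [rotated -1]) (use assms in auto)
  then have "level \<infinity> #> (x \<otimes> y) = level \<infinity> #> (y \<otimes> x \<otimes> inv y \<otimes> y)"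
    by (rule K.rcos_mult_cong) (use assms in auto)
  then show ?thesis
    using assms by (simp add: K.rcos_commute_iff m_assoc)
qed

lemma gcomm_pow_right:
  assumes "torsion = level \<infinity>" "x \<in> carrier G" "y \<in> carrier G" "gcomm G x (y [^] (p ^ n)) \<in> level \<infinity>"
  shows "gcomm G x y \<in> level \<infinity>"
  using assms gcomm_pow_left [of y x n] by (metis K.rcos_commute_iff nat_pow_closed)

end

section \<open>Complete valued groups of finite rank\<close>

lemma card_image_eq_card_image:
  assumes "\<And>x y. x \<in> S \<Longrightarrow> y \<in> S \<Longrightarrow> f x = f y \<longleftrightarrow> g x = g y"
  shows "card (f ` S) = card (g ` S)"
proof -
  define h where "h = (\<lambda>u. g (inv_into S f u))"
  have h: "h (f x) = g x" if "x \<in> S" for x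
    using that assms [of "inv_into S f (f x)" x]
    by (simp add: h_def inv_into_into f_inv_into_f)
  have "bij_betw h (f ` S) (g ` S)"
    unfolding bij_betw_def
  proof
    show "inj_on h (f ` S)"
      using h assms by (auto intro!: inj_onI)
    show "h ` f ` S = g ` S"
      using h by (auto simp: image_image)
  qed
  then show ?thesis
    by (rule bij_betw_same_card)
qed

lemma eventually_const_of_bounded_mono:
  fixes f :: "nat \<Rightarrow> nat"
  assumes "\<And>k. a \<le> k \<Longrightarrow> f k \<le> f (Suc k)" "\<And>k. f k \<le> B"
  shows "\<forall>\<^sub>F k in sequentially. f (Suc k) = f k"
proof -
  obtain N where N: "a \<le> N" "\<forall>k. a \<le> k \<longrightarrow> f k \<le> f N"
  proof -
    have "\<exists>N. a \<le> N \<and> (\<forall>k. a \<le> k \<longrightarrow> f k \<le> f N)"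
      by (rule ex_has_greatest_nat [where b = "Suc B" and k = a]) (simp_all add: assms(2) le_imp_less_Suc)
    then show ?thesis
      using that by blast
  qed
  have const: "f k = f N" if "N \<le> k" for k
    using that
  proof (induction k rule: dec_induct)
    case (step k)
    then show ?case
      using assms(1) [of k] N(1) N(2) [rule_format, of "Suc k"] by linarith
  qed simp
  then have "\<forall>k\<ge>N. f (Suc k) = f k"
    using const by (metis le_SucI)
  then show ?thesis
    unfolding eventually_sequentially by blast
qed

locale p_valued_group = group G for G (structure) +
  fixes p :: nat and \<omega> :: "'a \<Rightarrow> ereal"
  assumes prime: "Factorial_Ring.prime p"
    and valuation: "p_valuation G p \<omega>"
    and complete: "val_complete G \<omega>"
    and finite_rank: "val_finite_rank G p \<omega>"
begin

lemma \<omega>_infinity_iff: "x \<in> carrier G \<Longrightarrow> \<omega> x = \<infinity> \<longleftrightarrow> x = \<one>"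
  using valuation by (auto simp: p_valuation_def)

lemma \<omega>_pow: "x \<in> carrier G \<Longrightarrow> \<omega> (x [^] p) = \<omega> x + 1"
  using valuation by (auto simp: p_valuation_def)

sublocale filtered_group G p \<omega>
proof unfold_locales
  show "\<omega> \<one> = \<infinity>"
    by (simp add: \<omega>_infinity_iff)
qed (use prime valuation \<omega>_pow in \<open>auto simp: p_valuation_def\<close>)

lemma \<omega>_real:
  assumes "x \<in> carrier G" "x \<noteq> \<one>"
  obtains r where "\<omega> x = ereal r" "0 < r"
proof (cases "\<omega> x")
  case (real r)
  then show ?thesis
    using v_pos [OF assms(1)] that by simp
qed (use assms \<omega>_infinity_iff v_pos [of x] in auto)

lemma \<omega>_inv: "x \<in> carrier G \<Longrightarrow> \<omega> (inv x) = \<omega> x"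
  using v_inv [of x] v_inv [of "inv x"] by auto

lemma eq_one_if_in_all_levels:
  assumes "g \<in> carrier G" "\<And>\<mu>::real. ereal \<mu> \<le> \<omega> g"
  shows "g = \<one>"
  using assms(2) assms(1) \<omega>_infinity_iff by (metis ereal_top)

text \<open>The degree \<mu> piece of the graded group of \<open>H\<close>, taken inside that of
  \<open>G\<close>: the cosets are those of \<open>level_gt\<close> in all of \<open>G\<close>, so
  the pieces of all subgroups are subsets of one finite set.\<close>

definition graded :: "'a set \<Rightarrow> real \<Rightarrow> 'a set set" where
  "graded H \<mu> = (\<lambda>x. level_gt (ereal \<mu>) #> x) ` (H \<inter> level (ereal \<mu>))"

text \<open>The spanning condition determines a graded class by its coefficients alone, whence a
  bound uniform in the degree. A class whose degree is reached by no generator has only zero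
  coefficients and is trivial, which confines the finite values to finitely many
  progressions.\<close>

lemma finite_rank_consequences:
  obtains gs where "set gs \<subseteq> carrier G"
    and "\<And>g \<mu>. g \<in> carrier G \<Longrightarrow> \<omega> g = ereal \<mu> \<Longrightarrow> \<exists>i<length gs. \<exists>k. \<omega> (gs ! i) + ereal (real k) = ereal \<mu>"
    and "\<And>\<mu>. finite (graded (carrier G) \<mu>) \<and> card (graded (carrier G) \<mu>) \<le> p ^ length gs"
proof -
  obtain gs where gs: "set gs \<subseteq> carrier G" and rank:
    "\<And>g \<mu>. g \<in> carrier G \<Longrightarrow> ereal \<mu> \<le> \<omega> g \<Longrightarrow>
      \<exists>ks as :: nat list. length ks = length gs \<and> length as = length gs \<and>
        (\<forall>i<length gs. as ! i < p \<and> (as ! i = 0 \<or> \<omega> (gs ! i) + ereal (real (ks ! i)) = ereal \<mu>)) \<and>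
        ereal \<mu> < \<omega> (inv g \<otimes> foldr (\<lambda>i acc. (gs ! i) [^] (as ! i * p ^ (ks ! i)) \<otimes> acc) [0..<length gs] \<one>)"
    using finite_rank unfolding val_finite_rank_def by blast
  have foldr_one: "foldr (\<lambda>i acc. (gs ! i) [^] (as ! i * p ^ (ks ! i)) \<otimes> acc) is \<one> = \<one>"
    if "\<forall>i\<in>set is. i < length gs \<and> as ! i = 0" for as ks :: "nat list" and "is"
    using that by (induction "is") auto
  \<comment> \<open>Where a coefficient is nonzero, the exponent \<open>ks ! i\<close> is forced to
    be the difference of \<mu> and the value of \<open>gs ! i\<close>; where it is zero, the rounded
    number is immaterial.\<close>
  define F where "F = (\<lambda>\<mu> as. foldr (\<lambda>i acc. (gs ! i) [^] (as ! i * p ^ nat \<lfloor>\<mu> - real_of_ereal (\<omega> (gs ! i))\<rfloor>) \<otimes> acc) [0..<length gs] \<one>)"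
  have F_carrier: "foldr (\<lambda>i acc. (gs ! i) [^] (e i :: nat) \<otimes> acc) is \<one> \<in> carrier G"
    if "set is \<subseteq> {..<length gs}" for e "is"
    using that
  proof (induction "is")
    case (Cons i "is")
    then have "gs ! i \<in> carrier G"
      using gs nth_mem by auto
    then show ?case
      using Cons by simp
  qed simp
  have foldr_eq: "foldr (\<lambda>i acc. (gs ! i) [^] (as ! i * p ^ (ks ! i)) \<otimes> acc) [0..<length gs] \<one> = F \<mu> as"
    if "\<forall>i<length gs. as ! i < p \<and> (as ! i = 0 \<or> \<omega> (gs ! i) + ereal (real (ks ! i)) = ereal \<mu>)"
    for as ks :: "nat list" and \<mu>
    unfolding F_def
  proof (rule foldr_cong)
    fix i acc
    assume "i \<in> set [0..<length gs]"
    then have i: "as ! i = 0 \<or> \<omega> (gs ! i) + ereal (real (ks ! i)) = ereal \<mu>"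
      using that by auto
    show "(gs ! i) [^] (as ! i * p ^ (ks ! i)) \<otimes> acc
       = (gs ! i) [^] (as ! i * p ^ nat \<lfloor>\<mu> - real_of_ereal (\<omega> (gs ! i))\<rfloor>) \<otimes> acc"
    proof (cases "as ! i = 0")
      case False
      with i have "\<mu> - real_of_ereal (\<omega> (gs ! i)) = real (ks ! i)"
        by (cases "\<omega> (gs ! i)") auto
      then show ?thesis
        by simp
    qed simp
  qed auto
  have vals: "\<exists>i<length gs. \<exists>k. \<omega> (gs ! i) + ereal (real k) = ereal \<mu>"
    if g: "g \<in> carrier G" "\<omega> g = ereal \<mu>" for g \<mu>
  proof (rule ccontr)
    assume no: "\<not> ?thesis"
    obtain ks as :: "nat list" where
      as: "\<forall>i<length gs. as ! i < p \<and> (as ! i = 0 \<or> \<omega> (gs ! i) + ereal (real (ks ! i)) = ereal \<mu>)" and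
      gt: "ereal \<mu> < \<omega> (inv g \<otimes> foldr (\<lambda>i acc. (gs ! i) [^] (as ! i * p ^ (ks ! i)) \<otimes> acc) [0..<length gs] \<one>)"
      using rank [of g \<mu>] g by auto
    have "foldr (\<lambda>i acc. (gs ! i) [^] (as ! i * p ^ (ks ! i)) \<otimes> acc) [0..<length gs] \<one> = \<one>"
      using no as by (intro foldr_one) auto
    then show False
      using gt g by (simp add: \<omega>_inv)
  qed
  have graded: "finite (graded (carrier G) \<mu>) \<and> card (graded (carrier G) \<mu>) \<le> p ^ length gs" for \<mu>
  proof -
    interpret M: normal "level_gt (ereal \<mu>)" G
      by (rule normal_level_gt) simp
    define A where "A = {as :: nat list. set as \<subseteq> {..<p} \<and> length as = length gs}"
    have A: "finite A" "card A = p ^ length gs"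
      unfolding A_def by (simp_all add: finite_lists_length_eq card_lists_length_eq)
    have "graded (carrier G) \<mu> \<subseteq> (\<lambda>as. level_gt (ereal \<mu>) #> F \<mu> as) ` A"
    proof
      fix C assume "C \<in> graded (carrier G) \<mu>"
      then obtain g where g: "g \<in> carrier G" "ereal \<mu> \<le> \<omega> g" "C = level_gt (ereal \<mu>) #> g"
        by (auto simp: graded_def level_def)
      obtain ks as :: "nat list" where len: "length as = length gs" and
        as: "\<forall>i<length gs. as ! i < p \<and> (as ! i = 0 \<or> \<omega> (gs ! i) + ereal (real (ks ! i)) = ereal \<mu>)" and
        gt: "ereal \<mu> < \<omega> (inv g \<otimes> foldr (\<lambda>i acc. (gs ! i) [^] (as ! i * p ^ (ks ! i)) \<otimes> acc) [0..<length gs] \<one>)"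
        using rank [of g \<mu>] g by auto
      have F: "F \<mu> as \<in> carrier G"
        unfolding F_def by (rule F_carrier) auto
      have "inv g \<otimes> F \<mu> as \<in> level_gt (ereal \<mu>)"
        using gt g F unfolding foldr_eq [OF as] by (simp add: level_gt_def)
      then have "C = level_gt (ereal \<mu>) #> F \<mu> as"
        using g F by (simp add: M.rcos_eq_iff)
      moreover have "as \<in> A"
        using len as by (auto simp: A_def in_set_conv_nth)
      ultimately show "C \<in> (\<lambda>as. level_gt (ereal \<mu>) #> F \<mu> as) ` A"
        by blast
    qed
    then show ?thesis
      using A by (metis (no_types, lifting) card_image_le card_mono finite_imageI finite_subset le_trans)
  qed
  show ?thesis
    by (rule that [OF gs vals graded])
qed

text \<open>Each of the finitely many progressions of values starts above 0 and meets a bounded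
  range finitely often. This discreteness replaces compactness when maxima over cosets or limits of
  values are needed.\<close>

lemma finite_values: "finite {\<omega> x | x. x \<in> carrier G \<and> \<omega> x \<le> ereal B}"
proof -
  obtain gs where gs: "set gs \<subseteq> carrier G" and vals:
    "\<And>g \<mu>. g \<in> carrier G \<Longrightarrow> \<omega> g = ereal \<mu> \<Longrightarrow> \<exists>i<length gs. \<exists>k. \<omega> (gs ! i) + ereal (real k) = ereal \<mu>"
    using finite_rank_consequences by metis
  have "{\<omega> x | x. x \<in> carrier G \<and> \<omega> x \<le> ereal B}
      \<subseteq> (\<lambda>(i, k). \<omega> (gs ! i) + ereal (real k)) ` ({..<length gs} \<times> {..nat \<lceil>B\<rceil>})"
  proof clarify
    fix x assume x: "x \<in> carrier G" "\<omega> x \<le> ereal B"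
    then obtain \<mu> where \<mu>: "\<omega> x = ereal \<mu>"
      using v_pos [OF x(1)] by (cases "\<omega> x") auto
    obtain i k where ik: "i < length gs" "\<omega> (gs ! i) + ereal (real k) = ereal \<mu>"
      using vals [OF x(1) \<mu>] by blast
    have "0 < \<omega> (gs ! i)"
      using gs ik(1) by (intro v_pos) (meson nth_mem subsetD)
    then have "real k \<le> B"
      using ik x \<mu> by (cases "\<omega> (gs ! i)") auto
    then have "k \<le> nat \<lceil>B\<rceil>"
      by linarith
    then show "\<omega> x \<in> (\<lambda>(i, k). \<omega> (gs ! i) + ereal (real k)) ` ({..<length gs} \<times> {..nat \<lceil>B\<rceil>})"
      using ik \<mu> by (auto intro!: image_eqI [of _ _ "(i, k)"])
  qed
  then show ?thesis
    by (rule finite_subset) simp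
qed

text \<open>By \<open>pow_mult_level\<close> the p-th powers of \<open>x\<close> and
  \<open>x \<otimes> w\<close> differ by \<open>w [^] p\<close> up to higher order, and the value of
  \<open>w [^] p\<close> is exactly that of \<open>w\<close> plus 1. So the p-th power map is well
  defined and injective from degree \<mu> to degree \<open>\<mu> + 1\<close>.\<close>

lemma pow_cong_graded_iff:
  assumes "x \<in> carrier G" "y \<in> carrier G" "ereal \<mu> \<le> \<omega> (inv x \<otimes> y)" "1 < \<mu>"
  shows "level_gt (ereal (\<mu> + 1)) #> x [^] p = level_gt (ereal (\<mu> + 1)) #> y [^] p
     \<longleftrightarrow> level_gt (ereal \<mu>) #> x = level_gt (ereal \<mu>) #> y"
proof -
  interpret M: normal "level_gt (ereal \<mu>)" G
    by (rule normal_level_gt) simp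
  interpret M': normal "level_gt (ereal (\<mu> + 1))" G
    by (rule normal_level_gt) simp
  define w where "w = inv x \<otimes> y"
  have w: "w \<in> carrier G" "x \<otimes> w = y"
    using assms by (simp_all add: w_def)
  have "level_gt (ereal (\<mu> + 1)) #> y [^] p = level_gt (ereal (\<mu> + 1)) #> (x [^] p \<otimes> w [^] p)"
    using pow_mult_level [of x w \<mu>] assms w by (simp add: w_def)
  then have "level_gt (ereal (\<mu> + 1)) #> x [^] p = level_gt (ereal (\<mu> + 1)) #> y [^] p
      \<longleftrightarrow> level_gt (ereal (\<mu> + 1)) #> x [^] p = level_gt (ereal (\<mu> + 1)) #> (x [^] p \<otimes> w [^] p)"
    by simp
  also have "\<dots> \<longleftrightarrow> w [^] p \<in> level_gt (ereal (\<mu> + 1))"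
    using assms w(1) by (simp add: M'.rcos_eq_iff)
  also have "\<dots> \<longleftrightarrow> w \<in> level_gt (ereal \<mu>)"
    using w(1) \<omega>_pow [OF w(1)] by (cases "\<omega> w") (auto simp: level_gt_def one_ereal_def)
  also have "\<dots> \<longleftrightarrow> level_gt (ereal \<mu>) #> x = level_gt (ereal \<mu>) #> y"
    using assms by (simp add: M.rcos_eq_iff w_def)
  finally show ?thesis .
qed

text \<open>The p-th power map embeds \<open>graded H \<mu>\<close> into
  \<open>graded H (\<mu> + 1)\<close>. Along each of the finitely many progressions of values the
  cardinalities are eventually nondecreasing and bounded, so from some point on the embeddings are
  onto. A preimage of the class of \<open>h\<close> is the approximate root.\<close>

lemma approximate_roots:
  assumes H: "subgroup H G"
  shows "\<exists>\<nu>::real. 2 < \<nu> \<and> (\<forall>h\<in>H. h \<noteq> \<one> \<longrightarrow> ereal \<nu> \<le> \<omega> h \<longrightarrow>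
    (\<exists>z\<in>H. \<omega> h \<le> \<omega> z + 1 \<and> \<omega> h < \<omega> (inv (z [^] p) \<otimes> h)))"
proof -
  interpret H: subgroup H G
    by (rule H)
  obtain gs where gs: "set gs \<subseteq> carrier G" and vals:
    "\<And>g \<mu>. g \<in> carrier G \<Longrightarrow> \<omega> g = ereal \<mu> \<Longrightarrow> \<exists>i<length gs. \<exists>k. \<omega> (gs ! i) + ereal (real k) = ereal \<mu>" and
    graded: "\<And>\<mu>. finite (graded (carrier G) \<mu>) \<and> card (graded (carrier G) \<mu>) \<le> p ^ length gs"
    using finite_rank_consequences by metis
  have graded_H: "finite (graded H \<mu>)" "card (graded H \<mu>) \<le> p ^ length gs" for \<mu>
  proof -
    have "graded H \<mu> \<subseteq> graded (carrier G) \<mu>"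
      using H.subset by (auto simp: graded_def)
    then show "finite (graded H \<mu>)" "card (graded H \<mu>) \<le> p ^ length gs"
      using graded [of \<mu>] by (meson finite_subset card_mono le_trans)+
  qed
  define powers where "powers = (\<lambda>\<mu>. (\<lambda>x. level_gt (ereal (\<mu> + 1)) #> x [^] p) ` (H \<inter> level (ereal \<mu>)))"
  have powers_subset: "powers \<mu> \<subseteq> graded H (\<mu> + 1)" for \<mu>
  proof
    fix C assume "C \<in> powers \<mu>"
    then obtain x where x: "x \<in> H" "x \<in> carrier G" "ereal \<mu> \<le> \<omega> x" "C = level_gt (ereal (\<mu> + 1)) #> x [^] p"
      by (auto simp: powers_def level_def)
    have "ereal (\<mu> + 1) \<le> \<omega> (x [^] p)"
      using x \<omega>_pow [of x] by (cases "\<omega> x") (auto simp: one_ereal_def)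
    moreover have "x [^] n \<in> H" for n :: nat
      using x(1) by (induction n) auto
    ultimately show "C \<in> graded H (\<mu> + 1)"
      using x by (auto simp: graded_def level_def)
  qed
  have card_powers: "card (powers \<mu>) = card (graded H \<mu>)" if "1 < \<mu>" for \<mu>
    unfolding powers_def graded_def
  proof (rule card_image_eq_card_image)
    interpret L: normal "level (ereal \<mu>)" G
      by (rule normal_level)
    fix x y assume xy: "x \<in> H \<inter> level (ereal \<mu>)" "y \<in> H \<inter> level (ereal \<mu>)"
    then have "inv x \<otimes> y \<in> level (ereal \<mu>)"
      by (intro L.m_closed L.m_inv_closed) auto
    then show "level_gt (ereal (\<mu> + 1)) #> x [^] p = level_gt (ereal (\<mu> + 1)) #> y [^] p
     \<longleftrightarrow> level_gt (ereal \<mu>) #> x = level_gt (ereal \<mu>) #> y"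
      using xy that by (intro pow_cong_graded_iff) (auto simp: level_def)
  qed
  have "\<forall>\<^sub>F k in sequentially. card (graded H (c + real (Suc k))) = card (graded H (c + real k))"
    if "0 < c" for c
  proof (rule eventually_const_of_bounded_mono [where a = 1])
    fix k :: nat assume "1 \<le> k"
    then have "1 < c + real k"
      using that by linarith
    from card_powers [OF this] have "card (graded H (c + real k)) \<le> card (graded H (c + real k + 1))"
      using card_mono [OF graded_H(1) powers_subset] by metis
    then show "card (graded H (c + real k)) \<le> card (graded H (c + real (Suc k)))"
      by (simp add: algebra_simps)
  qed (rule graded_H)
  \<comment> \<open>A generator equal to \<open>\<one>\<close> has infinite value, for which
    \<open>real_of_ereal\<close> gives 0; the guard leaves such indices out.\<close>
  then have "\<forall>i\<in>{..<length gs}. \<forall>\<^sub>F k in sequentially. 0 < real_of_ereal (\<omega> (gs ! i)) \<longrightarrow>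
     card (graded H (real_of_ereal (\<omega> (gs ! i)) + real (Suc k))) = card (graded H (real_of_ereal (\<omega> (gs ! i)) + real k))"
    by (auto simp: eventually_sequentially)
  then have "\<forall>\<^sub>F k in sequentially. \<forall>i\<in>{..<length gs}. 0 < real_of_ereal (\<omega> (gs ! i)) \<longrightarrow>
     card (graded H (real_of_ereal (\<omega> (gs ! i)) + real (Suc k))) = card (graded H (real_of_ereal (\<omega> (gs ! i)) + real k))"
    by (intro eventually_ball_finite) auto
  then obtain N where N: "\<And>k i. N \<le> k \<Longrightarrow> i < length gs \<Longrightarrow> 0 < real_of_ereal (\<omega> (gs ! i)) \<Longrightarrow>
     card (graded H (real_of_ereal (\<omega> (gs ! i)) + real (Suc k))) = card (graded H (real_of_ereal (\<omega> (gs ! i)) + real k))"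
    unfolding eventually_sequentially by blast
  define C where "C = (\<Sum>i<length gs. \<bar>real_of_ereal (\<omega> (gs ! i))\<bar>)"
  have C: "real_of_ereal (\<omega> (gs ! i)) \<le> C" if "i < length gs" for i
  proof -
    have "\<bar>real_of_ereal (\<omega> (gs ! i))\<bar> \<le> C"
      unfolding C_def using that by (intro member_le_sum) (auto simp: real_of_ereal_pos)
    then show ?thesis
      by linarith
  qed
  have C0: "0 \<le> C"
    unfolding C_def by (intro sum_nonneg) (auto simp: real_of_ereal_pos)
  show ?thesis
  \<comment> \<open>\<open>C\<close> bounds the start of every progression, so a value of at least
    \<open>C + N + 3\<close> has an index \<open>k > N\<close>, which leaves room for the step from
    \<open>k - 1\<close> to \<open>k\<close>. The 3 also puts \<open>\<mu> = r - 1\<close> above 1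
    and the threshold above 2.\<close>
  proof (intro exI [of _ "C + real N + 3"] conjI ballI impI)
    fix h assume h: "h \<in> H" "h \<noteq> \<one>" "ereal (C + real N + 3) \<le> \<omega> h"
    have hG: "h \<in> carrier G"
      using h H.subset by auto
    then obtain r where r: "\<omega> h = ereal r"
      using h \<omega>_real by metis
    obtain i k where ik: "i < length gs" "\<omega> (gs ! i) + ereal (real k) = ereal r"
      using vals [OF hG r] by blast
    define c where "c = real_of_ereal (\<omega> (gs ! i))"
    have "0 < \<omega> (gs ! i)"
      using gs ik(1) by (intro v_pos) (meson nth_mem subsetD)
    then have c: "\<omega> (gs ! i) = ereal c" "0 < c"
      using ik unfolding c_def by (cases "\<omega> (gs ! i)"; simp)+
    have ck: "c + real k = r"
      using ik c by simp
    have "C + real N + 3 \<le> r" "c \<le> C"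
      using h r C [OF ik(1)] by (auto simp: c_def)
    then have k: "Suc N \<le> k"
      using ck by linarith
    define \<mu> where "\<mu> = r - 1"
    have \<mu>: "1 < \<mu>" "\<mu> + 1 = r"
      using \<open>C + real N + 3 \<le> r\<close> C0 by (auto simp: \<mu>_def)
    have "card (graded H (c + real (Suc (k - 1)))) = card (graded H (c + real (k - 1)))"
      using N [of "k - 1" i] k ik(1) c(2) by (simp add: c_def)
    moreover have "c + real (Suc (k - 1)) = \<mu> + 1" "c + real (k - 1) = \<mu>"
      using k ck by (auto simp: \<mu>_def of_nat_diff)
    ultimately have "card (graded H (\<mu> + 1)) = card (powers \<mu>)"
      using card_powers \<mu> by metis
    then have "powers \<mu> = graded H (\<mu> + 1)"
      using powers_subset graded_H by (intro card_subset_eq) auto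
    moreover have "level_gt (ereal (\<mu> + 1)) #> h \<in> graded H (\<mu> + 1)"
      using h hG r \<mu> by (auto simp: graded_def level_def)
    ultimately have "level_gt (ereal (\<mu> + 1)) #> h \<in> powers \<mu>"
      by simp
    then obtain z where z: "z \<in> H" "z \<in> carrier G" "ereal \<mu> \<le> \<omega> z"
      and eq: "level_gt (ereal (\<mu> + 1)) #> h = level_gt (ereal (\<mu> + 1)) #> z [^] p"
      by (auto simp: powers_def level_def)
    interpret M: normal "level_gt (ereal (\<mu> + 1))" G
      by (rule normal_level_gt) simp
    have "inv (z [^] p) \<otimes> h \<in> level_gt (ereal (\<mu> + 1))"
      using eq [symmetric] z hG by (subst (asm) M.rcos_eq_iff) auto
    then have "\<omega> h < \<omega> (inv (z [^] p) \<otimes> h)"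
      using r \<mu> by (simp add: level_gt_def)
    moreover have "\<omega> h \<le> \<omega> z + 1"
      using z(3) r \<mu> by (cases "\<omega> z") (auto simp: one_ereal_def)
    ultimately show "\<exists>z\<in>H. \<omega> h \<le> \<omega> z + 1 \<and> \<omega> h < \<omega> (inv (z [^] p) \<otimes> h)"
      using z by blast
  qed (use C0 in auto)
qed

text \<open>The topological closure, phrased as approximation to every depth;
  \<open>closure_of_val_topology\<close> proves the agreement.\<close>

definition adherence :: "'a set \<Rightarrow> 'a set" where
  "adherence A = {x \<in> carrier G. \<forall>\<mu>::real. \<exists>a\<in>A. ereal \<mu> \<le> \<omega> (inv x \<otimes> a)}"

text \<open>In an ultrametric it is enough to control consecutive quotients: the cosets of each
  \<open>level\<close> become constant along the sequence.\<close>

lemma convergent_in_closed: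
  assumes H: "H \<subseteq> carrier G" "adherence H \<subseteq> H" and x: "\<And>n. x n \<in> H"
    and cauchy: "\<And>\<mu>::real. \<exists>N. \<forall>n\<ge>N. ereal \<mu> \<le> \<omega> (inv (x n) \<otimes> x (Suc n))"
  shows "\<exists>y\<in>H. \<forall>\<mu>::real. \<exists>N. \<forall>n\<ge>N. ereal \<mu> \<le> \<omega> (inv y \<otimes> x n)"
proof -
  have xG: "x n \<in> carrier G" for n
    using x H by auto
  have "\<exists>N. \<forall>m\<ge>N. \<forall>n\<ge>N. ereal \<mu> \<le> \<omega> (inv (x m) \<otimes> x n)" for \<mu> :: real
  proof -
    interpret L: normal "level (ereal \<mu>)" G
      by (rule normal_level)
    obtain N where N: "\<forall>n\<ge>N. ereal \<mu> \<le> \<omega> (inv (x n) \<otimes> x (Suc n))"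
      using cauchy by blast
    have "level (ereal \<mu>) #> x n = level (ereal \<mu>) #> x N" if "N \<le> n" for n
      using that
    proof (induction n rule: dec_induct)
      case (step n)
      have "inv (x n) \<otimes> x (Suc n) \<in> level (ereal \<mu>)"
        using N step xG by (simp add: level_def)
      then have "level (ereal \<mu>) #> x n = level (ereal \<mu>) #> x (Suc n)"
        using xG by (simp add: L.rcos_eq_iff)
      then show ?case
        using step by simp
    qed simp
    then have "inv (x m) \<otimes> x n \<in> level (ereal \<mu>)" if "N \<le> m" "N \<le> n" for m n
      using that L.rcos_eq_iff [OF xG xG] by metis
    then show ?thesis
      unfolding level_def by blast
  qed
  then have "(\<forall>n. x n \<in> carrier G) \<and> (\<forall>\<mu>::real. \<exists>N. \<forall>m\<ge>N. \<forall>n\<ge>N. ereal \<mu> \<le> \<omega> (inv (x m) \<otimes> x n))"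
    using xG by blast
  with complete [unfolded val_complete_def, THEN spec [of _ x]]
  have "\<exists>y\<in>carrier G. \<forall>\<mu>::real. \<exists>N. \<forall>n\<ge>N. ereal \<mu> \<le> \<omega> (inv y \<otimes> x n)"
    by (rule mp)
  then obtain y where y: "y \<in> carrier G" "\<And>\<mu>::real. \<exists>N. \<forall>n\<ge>N. ereal \<mu> \<le> \<omega> (inv y \<otimes> x n)"
    by blast
  have "\<exists>a\<in>H. ereal \<mu> \<le> \<omega> (inv y \<otimes> a)" for \<mu> :: real
  proof -
    obtain N where "\<forall>n\<ge>N. ereal \<mu> \<le> \<omega> (inv y \<otimes> x n)"
      using y(2) by blast
    then have "ereal \<mu> \<le> \<omega> (inv y \<otimes> x N)"
      by simp
    then show ?thesis
      using x by blast
  qed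
  then have "y \<in> adherence H"
    unfolding adherence_def using y(1) by simp
  then have "y \<in> H"
    using H(2) by (rule rev_subsetD)
  then show ?thesis
    using y(2) by (intro bexI) simp_all
qed

text \<open>Successive approximation with error \<open>r x = inv (x [^] p) \<otimes> h\<close>:
  multiply \<open>x\<close> by an approximate root \<open>z\<close> of the error, and by
  \<open>pow_mult_level\<close> the new error is strictly deeper. Values being discrete, the errors
  tend to infinite value, and so do the factors \<open>z\<close>, which are at most 1 shallower than
  the errors. The limit stays in the closed subgroup \<open>H\<close>.\<close>

lemma deep_elements_are_pth_powers:
  assumes H: "subgroup H G" "adherence H \<subseteq> H"
  shows "\<exists>\<nu>::real. 2 < \<nu> \<and> (\<forall>h\<in>H. ereal \<nu> \<le> \<omega> h \<longrightarrow> (\<exists>x\<in>H. x [^] p = h))"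
proof -
  interpret H: subgroup H G
    by (rule H)
  obtain \<nu> where \<nu>: "2 < \<nu>" and approx:
    "\<And>h. h \<in> H \<Longrightarrow> h \<noteq> \<one> \<Longrightarrow> ereal \<nu> \<le> \<omega> h \<Longrightarrow> \<exists>z\<in>H. \<omega> h \<le> \<omega> z + 1 \<and> \<omega> h < \<omega> (inv (z [^] p) \<otimes> h)"
    using approximate_roots [OF H(1)] by blast
  have "\<exists>x\<in>H. x [^] p = h" if h: "h \<in> H" "ereal \<nu> \<le> \<omega> h" for h
  proof -
    have hG: "h \<in> carrier G"
      using h H.subset by auto
    define r where "r = (\<lambda>x. inv (x [^] p) \<otimes> h)"
    have pow_H: "x [^] n \<in> H" if "x \<in> H" for x and n :: nat
      using that by (induction n) auto
    have r_H: "r x \<in> H" if "x \<in> H" for x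
      unfolding r_def using that h pow_H by auto
    define P where "P = (\<lambda>x. x \<in> H \<and> ereal \<nu> \<le> \<omega> (r x))"
    \<comment> \<open>The second alternative lets the sequence stay constant once the error is
      \<open>\<one>\<close>, whose value cannot increase.\<close>
    define Q where "Q = (\<lambda>x y. \<omega> (r x) \<le> \<omega> (inv x \<otimes> y) + 1 \<and> (\<omega> (r x) < \<omega> (r y) \<or> \<omega> (r x) = \<infinity> \<and> \<omega> (r y) = \<infinity>))"
    have step: "\<exists>y. P y \<and> Q x y" if "P x" for x
    proof (cases "r x = \<one>")
      case True
      have "x \<in> carrier G"
        using that H.subset by (auto simp: P_def)
      then show ?thesis
        using that True by (intro exI [of _ x]) (auto simp: P_def Q_def v_one)
    next
      case False
      have x: "x \<in> H" "x \<in> carrier G" "ereal \<nu> \<le> \<omega> (r x)"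
        using that H.subset by (auto simp: P_def)
      then obtain z where z: "z \<in> H" "\<omega> (r x) \<le> \<omega> z + 1" "\<omega> (r x) < \<omega> (inv (z [^] p) \<otimes> r x)"
        using approx [OF r_H False] by blast
      have rG: "r x \<in> carrier G" "z \<in> carrier G"
        using r_H x z H.subset by auto
      obtain b where b: "\<omega> (r x) = ereal b"
        using \<omega>_real [OF rG(1) False] by metis
      have b2: "2 < b"
        using b x(3) \<nu> by simp
      \<comment> \<open>\<open>z\<close> may be 1 shallower than the error; the threshold 2 on
        errors leaves \<open>b - 1 > 1\<close>, as \<open>pow_mult_level\<close> needs.\<close>
      have "ereal (b - 1) \<le> \<omega> z"
        using z(2) b by (cases "\<omega> z") (auto simp: one_ereal_def)
      then have "level_gt (ereal b) #> (x \<otimes> z) [^] p = level_gt (ereal b) #> (x [^] p \<otimes> z [^] p)"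
        using pow_mult_level [of x z "b - 1"] x rG b2 by simp
      interpret M: normal "level_gt (ereal b)" G
        by (rule normal_level_gt) simp
      have "level_gt (ereal b) #> z [^] p = level_gt (ereal b) #> r x"
        using z(3) rG b by (subst M.rcos_eq_iff) (auto simp: level_gt_def)
      have "level_gt (ereal b) #> (x \<otimes> z) [^] p = level_gt (ereal b) #> (x [^] p \<otimes> z [^] p)"
        by fact
      also have "\<dots> = level_gt (ereal b) #> (x [^] p \<otimes> r x)"
        by (rule M.rcos_mult_cong) (use x rG \<open>level_gt (ereal b) #> z [^] p = level_gt (ereal b) #> r x\<close> in auto)
      also have "x [^] p \<otimes> r x = h"
        using x hG by (simp add: r_def)
      finally have "r (x \<otimes> z) \<in> level_gt (ereal b)"
        unfolding r_def using x rG hG by (subst (asm) M.rcos_eq_iff) auto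
      then have "\<omega> (r x) < \<omega> (r (x \<otimes> z))"
        using b by (simp add: level_gt_def)
      moreover have "inv x \<otimes> (x \<otimes> z) = z"
        using x rG by simp
      ultimately show ?thesis
        using x z by (intro exI [of _ "x \<otimes> z"]) (auto simp: P_def Q_def)
    qed
    have "P \<one>"
      using h hG by (simp add: P_def r_def)
    then have "\<exists>s. \<forall>n. P (s n) \<and> Q (s n) (s (Suc n))"
      by (intro dependent_nat_choice) (use step in blast)+
    then obtain s where s: "\<And>n. P (s n)" "\<And>n. Q (s n) (s (Suc n))"
      by blast
    have s_H: "s n \<in> H" and s_G: "s n \<in> carrier G" for n
      using s(1) [of n] H.subset by (auto simp: P_def)
    have r_G: "r (s n) \<in> carrier G" for n
      using r_H [OF s_H] H.subset by auto
    have r_mono: "\<omega> (r (s m)) \<le> \<omega> (r (s n))" if "m \<le> n" for m n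
    proof (rule lift_Suc_mono_le [of "\<lambda>n. \<omega> (r (s n))", OF _ that])
      show "\<omega> (r (s n)) \<le> \<omega> (r (s (Suc n)))" for n
        using s(2) [of n] by (auto simp: Q_def)
    qed
    have r_lim: "\<exists>N. \<forall>n\<ge>N. ereal B \<le> \<omega> (r (s n))" for B
    proof (rule ccontr)
      assume no: "\<nexists>N. \<forall>n\<ge>N. ereal B \<le> \<omega> (r (s n))"
      have le: "\<omega> (r (s n)) \<le> ereal B" for n
      proof (rule ccontr)
        assume "\<not> \<omega> (r (s n)) \<le> ereal B"
        then have "\<forall>m\<ge>n. ereal B \<le> \<omega> (r (s m))"
          using r_mono by (meson le_cases order_trans)
        then show False
          using no by blast
      qed
      have "\<omega> (r (s n)) < \<omega> (r (s (Suc n)))" for n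
        using s(2) [of n] le [of n] by (auto simp: Q_def)
      then have "strict_mono (\<lambda>n. \<omega> (r (s n)))"
        by (rule strict_mono_Suc_iff [THEN iffD2, rule_format])
      then have "inj (\<lambda>n. \<omega> (r (s n)))"
        by (rule strict_mono_imp_inj_on)
      moreover have "range (\<lambda>n. \<omega> (r (s n))) \<subseteq> {\<omega> x | x. x \<in> carrier G \<and> \<omega> x \<le> ereal B}"
        using le r_G by auto
      ultimately show False
        using finite_values by (meson finite_imageD finite_subset infinite_UNIV_nat)
    qed
    have "\<exists>N. \<forall>n\<ge>N. ereal B \<le> \<omega> (inv (s n) \<otimes> s (Suc n))" for B
    proof -
      obtain N where N: "\<forall>n\<ge>N. ereal (B + 1) \<le> \<omega> (r (s n))"
        using r_lim by blast
      have "ereal B \<le> \<omega> (inv (s n) \<otimes> s (Suc n))" if "N \<le> n" for n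
      proof -
        have "ereal (B + 1) \<le> \<omega> (inv (s n) \<otimes> s (Suc n)) + 1"
          using s(2) [of n] N that by (auto simp: Q_def intro: order_trans)
        then show ?thesis
          by (cases "\<omega> (inv (s n) \<otimes> s (Suc n))") (auto simp: one_ereal_def)
      qed
      then show ?thesis
        by blast
    qed
    then have "\<exists>y\<in>H. \<forall>\<mu>::real. \<exists>N. \<forall>n\<ge>N. ereal \<mu> \<le> \<omega> (inv y \<otimes> s n)"
      by (rule convergent_in_closed [OF H.subset H(2) s_H])
    then obtain y where y: "y \<in> H" "\<And>\<mu>::real. \<exists>N. \<forall>n\<ge>N. ereal \<mu> \<le> \<omega> (inv y \<otimes> s n)"
      by blast
    have yG: "y \<in> carrier G"
      using y H.subset by auto
    have "ereal \<mu> \<le> \<omega> (inv (y [^] p) \<otimes> h)" for \<mu> :: real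
    proof -
      interpret L: normal "level (ereal \<mu>)" G
        by (rule normal_level)
      obtain N1 where N1: "\<forall>n\<ge>N1. ereal \<mu> \<le> \<omega> (inv y \<otimes> s n)"
        using y(2) by blast
      obtain N2 where N2: "\<forall>n\<ge>N2. ereal \<mu> \<le> \<omega> (r (s n))"
        using r_lim by blast
      define n where "n = max N1 N2"
      have "inv y \<otimes> s n \<in> level (ereal \<mu>)" "r (s n) \<in> level (ereal \<mu>)"
        using N1 N2 yG s_G r_G by (auto simp: level_def n_def)
      then have "level (ereal \<mu>) #> y = level (ereal \<mu>) #> s n" "level (ereal \<mu>) #> s n [^] p = level (ereal \<mu>) #> h"
        using yG s_G hG by (simp_all add: L.rcos_eq_iff r_def)
      then have "level (ereal \<mu>) #> y [^] p = level (ereal \<mu>) #> h"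
        using yG s_G L.rcos_pow_cong by metis
      then show ?thesis
        using yG hG by (subst (asm) L.rcos_eq_iff) (auto simp: level_def)
    qed
    then have "inv (y [^] p) \<otimes> h = \<one>"
      using yG hG by (intro eq_one_if_in_all_levels) auto
    then have "y [^] p = h"
      using yG hG by (metis inv_closed inv_equality inv_inv nat_pow_closed)
    then show ?thesis
      using y by blast
  qed
  then show ?thesis
    using \<nu> by blast
qed

text \<open>Each p-th root costs 1 in value, so finitely many can be extracted from a deep enough
  element. With \<open>v_pow_pow\<close> this describes neighbourhoods of \<open>\<one>\<close>
  without the valuation; see \<open>adherence_iff_powers\<close>.\<close>

lemma deep_elements_are_powers:
  "\<exists>\<mu>::real. \<forall>h\<in>carrier G. ereal \<mu> \<le> \<omega> h \<longrightarrow> (\<exists>x\<in>carrier G. x [^] (p ^ n) = h)"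
proof (induction n)
  case (Suc n)
  obtain \<mu> :: real where \<mu>: "\<forall>h\<in>carrier G. ereal \<mu> \<le> \<omega> h \<longrightarrow> (\<exists>x\<in>carrier G. x [^] (p ^ n) = h)"
    using Suc by blast
  have "adherence (carrier G) \<subseteq> carrier G"
    by (auto simp: adherence_def)
  then obtain \<nu> :: real where \<nu>: "\<And>h. h \<in> carrier G \<Longrightarrow> ereal \<nu> \<le> \<omega> h \<Longrightarrow> \<exists>x\<in>carrier G. x [^] p = h"
    using deep_elements_are_pth_powers [OF subgroup_self] by blast
  have "\<exists>x\<in>carrier G. x [^] (p ^ Suc n) = h" if h: "h \<in> carrier G" "ereal (max \<nu> (\<mu> + 1)) \<le> \<omega> h" for h
  proof -
    have h': "ereal \<nu> \<le> \<omega> h" "ereal (\<mu> + 1) \<le> \<omega> h"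
      using h(2) by (meson ereal_less_eq(3) max.cobounded1 max.cobounded2 order_trans)+
    then obtain x where x: "x \<in> carrier G" "x [^] p = h"
      using \<nu> h by blast
    have "ereal \<mu> \<le> \<omega> x"
      using h'(2) \<omega>_pow [OF x(1)] x(2) by (cases "\<omega> x") (auto simp: one_ereal_def)
    then obtain y where "y \<in> carrier G" "y [^] (p ^ n) = x"
      using \<mu> x by blast
    then show ?thesis
      using x by (intro bexI [of _ y]) (auto simp: nat_pow_pow mult.commute)
  qed
  then show ?case
    by blast
qed auto

text \<open>Induction on the number of values below \<mu>. If \<open>m\<close> is the largest of
  them, \<open>level \<mu>\<close> equals \<open>level_gt m\<close>, whose cosets inside
  \<open>level m\<close> form a finite graded piece, and the induction hypothesis bounds the cosets
  of \<open>level m\<close>.\<close>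

lemma finite_index_level: "finite ((\<lambda>x. level (ereal \<mu>) #> x) ` carrier G)"
proof (induction "card {\<omega> x | x. x \<in> carrier G \<and> \<omega> x < ereal \<mu>}" arbitrary: \<mu> rule: less_induct)
  case less
  define A where "A = (\<lambda>\<mu>. {\<omega> x | x. x \<in> carrier G \<and> \<omega> x < ereal \<mu>})"
  have fin: "finite (A \<mu>)" for \<mu>
    by (rule finite_subset [OF _ finite_values [of \<mu>]]) (auto simp: A_def)
  show ?case
  proof (cases "A \<mu> = {}")
    case True
    then have "level (ereal \<mu>) = carrier G"
      by (auto simp: level_def A_def not_less)
    then have "(\<lambda>x. level (ereal \<mu>) #> x) ` carrier G \<subseteq> {carrier G}"
      using subgroup.rcos_const [OF subgroup_self is_group] by auto
    then show ?thesis
      by (rule finite_subset) simp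
  next
    case False
    then have "Max (A \<mu>) \<in> A \<mu>"
      using fin by simp
    then obtain g where g: "g \<in> carrier G" "Max (A \<mu>) = \<omega> g" "\<omega> g < ereal \<mu>"
      by (auto simp: A_def)
    obtain m where m: "\<omega> g = ereal m"
      using g v_pos [of g] by (cases "\<omega> g") auto
    have "m < \<mu>"
      using g m by simp
    have level_eq: "level (ereal \<mu>) = level_gt (ereal m)"
    proof -
      have "ereal \<mu> \<le> \<omega> x" if "x \<in> carrier G" "ereal m < \<omega> x" for x
      proof (rule ccontr)
        assume "\<not> ereal \<mu> \<le> \<omega> x"
        then have "\<omega> x \<in> A \<mu>"
          using that by (auto simp: A_def)
        then have "\<omega> x \<le> ereal m"
          using g m fin by (metis Max_ge)
        then show False
          using that by simp
      qed
      moreover have "ereal m < \<omega> x" if "ereal \<mu> \<le> \<omega> x" for x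
        using \<open>m < \<mu>\<close> that by (metis less_le_trans less_ereal.simps(1))
      ultimately show ?thesis
        by (auto simp: level_def level_gt_def)
    qed
    have "\<omega> x < ereal \<mu>" if "\<omega> x < ereal m" for x
      using that \<open>m < \<mu>\<close> by (metis less_ereal.simps(1) less_trans)
    then have "A m \<subseteq> A \<mu>"
      unfolding A_def by blast
    moreover have "\<omega> g \<in> A \<mu>"
      unfolding A_def using g by blast
    moreover have "\<omega> g \<notin> A m"
      unfolding A_def m by force
    ultimately have "A m \<subset> A \<mu>"
      by blast
    then have "card (A m) < card (A \<mu>)"
      using fin by (intro psubset_card_mono)
    then have IH: "finite ((\<lambda>x. level (ereal m) #> x) ` carrier G)"
      using less unfolding A_def by blast
    interpret L: normal "level (ereal m)" G
      by (rule normal_level)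
    interpret M: normal "level_gt (ereal m)" G
      by (rule normal_level_gt) simp
    define rep where "rep = inv_into (carrier G) (\<lambda>x. level (ereal m) #> x)"
    define R where "R = rep ` ((\<lambda>x. level (ereal m) #> x) ` carrier G)"
    have fin_graded: "finite (graded (carrier G) m)"
      by (rule finite_rank_consequences) blast
    have "(\<lambda>x. level_gt (ereal m) #> x) ` carrier G
        \<subseteq> (\<lambda>(r, Y). (level_gt (ereal m) #> r) <#> Y) ` (R \<times> graded (carrier G) m)"
    proof clarify
      fix x assume x: "x \<in> carrier G"
      define r where "r = rep (level (ereal m) #> x)"
      have r: "r \<in> R" "r \<in> carrier G" "level (ereal m) #> r = level (ereal m) #> x"
        using x unfolding r_def R_def rep_def
        by (blast, blast intro: inv_into_into, intro f_inv_into_f imageI)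
      have "inv r \<otimes> x \<in> level (ereal m)"
        using L.rcos_eq_iff r x by blast
      then have "level_gt (ereal m) #> (inv r \<otimes> x) \<in> graded (carrier G) m"
        using r x unfolding graded_def by blast
      moreover have "level_gt (ereal m) #> x = (level_gt (ereal m) #> r) <#> (level_gt (ereal m) #> (inv r \<otimes> x))"
        using r x by (simp add: M.rcos_sum)
      ultimately show "level_gt (ereal m) #> x
          \<in> (\<lambda>(r, Y). (level_gt (ereal m) #> r) <#> Y) ` (R \<times> graded (carrier G) m)"
        using r(1) by (intro image_eqI [of _ _ "(r, level_gt (ereal m) #> (inv r \<otimes> x))"]) auto
    qed
    then show ?thesis
      unfolding level_eq by (rule finite_subset) (use IH fin_graded in \<open>auto simp: R_def\<close>)
  qed
qed

end

section \<open>Topology\<close>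

lemma (in normal) rcos_inv_cong:
  assumes "H #> x = H #> y" "x \<in> carrier G" "y \<in> carrier G"
  shows "H #> inv x = H #> inv y"
  using assms rcos_inv by metis

lemma (in normal) rcos_gcomm_cong:
  assumes "H #> x = H #> x'" "H #> y = H #> y'"
    and "x \<in> carrier G" "x' \<in> carrier G" "y \<in> carrier G" "y' \<in> carrier G"
  shows "H #> gcomm G x y = H #> gcomm G x' y'"
  unfolding gcomm_def using assms
  by (intro rcos_mult_cong [OF rcos_mult_cong [OF rcos_mult_cong]] rcos_inv_cong m_closed inv_closed)

lemma (in normal) gcomm_mem:
  assumes "x \<in> carrier G" "y \<in> carrier G" "x \<in> H \<or> y \<in> H"
  shows "gcomm G x y \<in> H"
proof -
  have "gcomm G x y = x \<otimes> (y \<otimes> inv x \<otimes> inv y)" "gcomm G x y = (x \<otimes> y \<otimes> inv x) \<otimes> inv y"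
    using assms by (simp_all add: gcomm_def m_assoc)
  moreover have "x \<otimes> (y \<otimes> inv x \<otimes> inv y) \<in> H" if "x \<in> H"
    by (rule subgroup.m_closed [OF is_subgroup that inv_op_closed2 [OF assms(2) m_inv_closed [OF that]]])
  moreover have "(x \<otimes> y \<otimes> inv x) \<otimes> inv y \<in> H" if "y \<in> H"
    by (rule subgroup.m_closed [OF is_subgroup inv_op_closed2 [OF assms(1) that] m_inv_closed [OF that]])
  ultimately show ?thesis
    using assms(3) by metis
qed

context p_valued_group
begin

lemma val_openD:
  assumes "val_open G \<omega> U" "x \<in> U"
  shows "\<exists>\<mu>::real. \<forall>y\<in>carrier G. ereal \<mu> \<le> \<omega> (inv x \<otimes> y) \<longrightarrow> y \<in> U"
proof -
  have "\<forall>x\<in>U. \<exists>\<mu>::real. {y \<in> carrier G. ereal \<mu> \<le> \<omega> (inv x \<otimes> y)} \<subseteq> U"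
    using assms(1) unfolding val_open_def by (rule conjunct2)
  then obtain \<mu> :: real where "{y \<in> carrier G. ereal \<mu> \<le> \<omega> (inv x \<otimes> y)} \<subseteq> U"
    using assms(2) by (meson bspec)
  then show ?thesis
    by blast
qed

lemma val_openI:
  assumes "U \<subseteq> carrier G"
    and "\<And>x. x \<in> U \<Longrightarrow> \<exists>\<mu>::real. \<forall>y\<in>carrier G. ereal \<mu> \<le> \<omega> (inv x \<otimes> y) \<longrightarrow> y \<in> U"
  shows "val_open G \<omega> U"
  unfolding val_open_def
proof (intro conjI ballI)
  fix x assume "x \<in> U"
  then obtain \<mu> :: real where "\<forall>y\<in>carrier G. ereal \<mu> \<le> \<omega> (inv x \<otimes> y) \<longrightarrow> y \<in> U"
    using assms(2) by meson
  then show "\<exists>\<mu>::real. {y \<in> carrier G. ereal \<mu> \<le> \<omega> (inv x \<otimes> y)} \<subseteq> U"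
    by (intro exI [of _ \<mu>]) auto
qed (rule assms(1))

lemma istopology_val_open: "istopology (val_open G \<omega>)"
  unfolding istopology_def
proof (intro conjI allI impI)
  fix S T assume S: "val_open G \<omega> S" and T: "val_open G \<omega> T"
  show "val_open G \<omega> (S \<inter> T)"
  proof (rule val_openI)
    fix x assume "x \<in> S \<inter> T"
    then have x: "x \<in> S" "x \<in> T"
      by auto
    obtain a :: real where a: "\<forall>y\<in>carrier G. ereal a \<le> \<omega> (inv x \<otimes> y) \<longrightarrow> y \<in> S"
      using val_openD [OF S x(1)] ..
    obtain b :: real where b: "\<forall>y\<in>carrier G. ereal b \<le> \<omega> (inv x \<otimes> y) \<longrightarrow> y \<in> T"
      using val_openD [OF T x(2)] ..
    have "ereal a \<le> \<omega> (inv x \<otimes> y) \<and> ereal b \<le> \<omega> (inv x \<otimes> y)"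
      if "ereal (max a b) \<le> \<omega> (inv x \<otimes> y)" for y
      using that by (meson ereal_less_eq(3) max.cobounded1 max.cobounded2 order_trans)
    then show "\<exists>\<mu>::real. \<forall>y\<in>carrier G. ereal \<mu> \<le> \<omega> (inv x \<otimes> y) \<longrightarrow> y \<in> S \<inter> T"
      using a b by (intro exI [of _ "max a b"]) auto
  qed (use S in \<open>auto simp: val_open_def\<close>)
next
  fix \<K> assume K: "\<forall>K\<in>\<K>. val_open G \<omega> K"
  show "val_open G \<omega> (\<Union>\<K>)"
  proof (rule val_openI)
    show "\<Union>\<K> \<subseteq> carrier G"
      using K by (auto simp: val_open_def)
    fix x assume "x \<in> \<Union>\<K>"
    then obtain S where S: "S \<in> \<K>" "x \<in> S"
      by blast
    then obtain \<mu> :: real where "\<forall>y\<in>carrier G. ereal \<mu> \<le> \<omega> (inv x \<otimes> y) \<longrightarrow> y \<in> S"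
      using val_openD K by meson
    then show "\<exists>\<mu>::real. \<forall>y\<in>carrier G. ereal \<mu> \<le> \<omega> (inv x \<otimes> y) \<longrightarrow> y \<in> \<Union>\<K>"
      using S by (intro exI [of _ \<mu>]) auto
  qed
qed

lemma openin_val_topology: "openin (val_topology G \<omega>) U \<longleftrightarrow> val_open G \<omega> U"
  unfolding val_topology_def using istopology_val_open by simp

lemma val_open_carrier: "val_open G \<omega> (carrier G)"
  by (auto simp: val_open_def)

lemma topspace_val_topology: "topspace (val_topology G \<omega>) = carrier G"
proof
  show "topspace (val_topology G \<omega>) \<subseteq> carrier G"
    unfolding topspace_def openin_val_topology by (auto simp: val_open_def)
  show "carrier G \<subseteq> topspace (val_topology G \<omega>)"
    using val_open_carrier openin_subset openin_val_topology by blast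
qed

lemma adherence_iff:
  assumes "A \<subseteq> carrier G"
  shows "x \<in> adherence A \<longleftrightarrow> x \<in> carrier G \<and> (\<forall>\<mu>::real. \<exists>a\<in>A. level (ereal \<mu>) #> x = level (ereal \<mu>) #> a)"
proof -
  have "ereal \<mu> \<le> \<omega> (inv x \<otimes> a) \<longleftrightarrow> level (ereal \<mu>) #> x = level (ereal \<mu>) #> a"
    if "x \<in> carrier G" "a \<in> A" for \<mu> a
  proof -
    interpret L: normal "level (ereal \<mu>)" G
      by (rule normal_level)
    have "a \<in> carrier G"
      using that assms by auto
    with that(1) show ?thesis
      using L.rcos_eq_iff [OF that(1) \<open>a \<in> carrier G\<close>] by (simp add: level_def)
  qed
  then show ?thesis
    unfolding adherence_def by auto
qed

lemma val_open_ball: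
  assumes "x \<in> carrier G"
  shows "val_open G \<omega> {y \<in> carrier G. ereal \<mu> \<le> \<omega> (inv x \<otimes> y)}"
  unfolding val_open_def
proof (intro conjI ballI)
  fix y assume y: "y \<in> {y \<in> carrier G. ereal \<mu> \<le> \<omega> (inv x \<otimes> y)}"
  have "ereal \<mu> \<le> \<omega> (inv x \<otimes> z)" if "z \<in> carrier G" "ereal \<mu> \<le> \<omega> (inv y \<otimes> z)" for z
  proof -
    have "inv x \<otimes> z = (inv x \<otimes> y) \<otimes> (inv y \<otimes> z)"
      using assms y that by (simp add: m_assoc)
    moreover have "min (\<omega> (inv x \<otimes> y)) (\<omega> (inv y \<otimes> z)) \<le> \<omega> ((inv x \<otimes> y) \<otimes> (inv y \<otimes> z))"
      using assms y that by (intro v_mult) auto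
    ultimately show ?thesis
      using y that by (auto simp: min_def split: if_splits)
  qed
  then show "\<exists>\<nu>::real. {z \<in> carrier G. ereal \<nu> \<le> \<omega> (inv y \<otimes> z)} \<subseteq> {z \<in> carrier G. ereal \<mu> \<le> \<omega> (inv x \<otimes> z)}"
    by blast
qed auto

lemma closure_of_val_topology:
  assumes "A \<subseteq> carrier G"
  shows "val_topology G \<omega> closure_of A = adherence A"
proof
  show "val_topology G \<omega> closure_of A \<subseteq> adherence A"
  proof
    fix x assume x: "x \<in> val_topology G \<omega> closure_of A"
    then have xG: "x \<in> carrier G"
      using closure_of_subset_topspace [of "val_topology G \<omega>" A] unfolding topspace_val_topology
      by (rule rev_subsetD)
    have "\<exists>a\<in>A. ereal \<mu> \<le> \<omega> (inv x \<otimes> a)" for \<mu> :: real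
    proof -
      define T where "T = {y \<in> carrier G. ereal \<mu> \<le> \<omega> (inv x \<otimes> y)}"
      have "x \<in> T" "val_open G \<omega> T"
        using xG v_one val_open_ball [OF xG] by (simp_all add: T_def)
      moreover have "\<forall>T. x \<in> T \<and> val_open G \<omega> T \<longrightarrow> (\<exists>y. y \<in> A \<and> y \<in> T)"
        using x unfolding in_closure_of openin_val_topology by (rule conjunct2)
      ultimately obtain a where "a \<in> A" "a \<in> T"
        by blast
      then show ?thesis
        unfolding T_def by (intro bexI [of _ a]) simp_all
    qed
    then show "x \<in> adherence A"
      using xG by (simp add: adherence_def)
  qed
  show "adherence A \<subseteq> val_topology G \<omega> closure_of A"
  proof
    fix x assume x: "x \<in> adherence A"
    have "\<exists>a\<in>A. a \<in> T" if T: "x \<in> T" "val_open G \<omega> T" for T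
    proof -
      obtain \<mu> :: real where "\<forall>y\<in>carrier G. ereal \<mu> \<le> \<omega> (inv x \<otimes> y) \<longrightarrow> y \<in> T"
        using val_openD [OF T(2,1)] ..
      moreover obtain a where "a \<in> A" "ereal \<mu> \<le> \<omega> (inv x \<otimes> a)"
        using x unfolding adherence_def by blast
      ultimately show ?thesis
        using assms by blast
    qed
    then show "x \<in> val_topology G \<omega> closure_of A"
      using x unfolding in_closure_of openin_val_topology topspace_val_topology
      by (auto simp: adherence_def)
  qed
qed

lemma closedin_val_topology:
  "closedin (val_topology G \<omega>) K \<longleftrightarrow> K \<subseteq> carrier G \<and> adherence K \<subseteq> K"
  using closure_of_val_topology closure_of_subset_eq topspace_val_topology by metis

lemma adherence_subset_carrier: "adherence A \<subseteq> carrier G"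
  by (auto simp: adherence_def)

lemma subset_adherence:
  assumes "A \<subseteq> carrier G"
  shows "A \<subseteq> adherence A"
  using assms unfolding adherence_iff [OF assms] subset_iff by blast

lemma adherence_mono: "A \<subseteq> B \<Longrightarrow> adherence A \<subseteq> adherence B"
  unfolding adherence_def by blast

lemma adherence_idem: "A \<subseteq> carrier G \<Longrightarrow> adherence (adherence A) = adherence A"
  using closure_of_val_topology adherence_subset_carrier closure_of_closure_of by metis

lemma normal_adherence:
  assumes "N \<lhd> G"
  shows "adherence N \<lhd> G"
proof -
  interpret N: normal N G
    by (rule assms)
  have *: "x \<in> adherence N \<longleftrightarrow> x \<in> carrier G \<and> (\<forall>\<mu>::real. \<exists>a\<in>N. level (ereal \<mu>) #> x = level (ereal \<mu>) #> a)" for x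
    by (rule adherence_iff [OF N.subset])
  have carrier: "a \<in> carrier G" if "a \<in> N" for a
    using that N.subset by auto
  have L: "level (ereal \<mu>) \<lhd> G" for \<mu>
    by (rule normal_level)
  show ?thesis
    unfolding normal_inv_iff
  proof (intro conjI ballI subgroupI)
    show "adherence N \<subseteq> carrier G"
      by (rule adherence_subset_carrier)
    show "adherence N \<noteq> {}"
      using subset_adherence [OF N.subset] N.one_closed by blast
    show "inv x \<in> adherence N" if "x \<in> adherence N" for x
      using that normal.rcos_inv_cong [OF L] N.m_inv_closed carrier unfolding * by (metis inv_closed)
    show "x \<otimes> y \<in> adherence N" if "x \<in> adherence N" "y \<in> adherence N" for x y
      using that normal.rcos_mult_cong [OF L] N.m_closed carrier unfolding * by (metis m_closed)
    show "g \<otimes> x \<otimes> inv g \<in> adherence N" if gx: "g \<in> carrier G" "x \<in> adherence N" for g x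
      unfolding *
    proof (intro conjI allI)
      fix \<mu> :: real
      obtain a where a: "a \<in> N" "level (ereal \<mu>) #> x = level (ereal \<mu>) #> a"
        using gx(2) unfolding * by blast
      have "level (ereal \<mu>) #> (g \<otimes> x \<otimes> inv g) = level (ereal \<mu>) #> (g \<otimes> a \<otimes> inv g)"
        using that a carrier [OF a(1)]
        by (intro normal.rcos_mult_cong [OF L normal.rcos_mult_cong [OF L refl a(2)] refl]) (auto simp: *)
      then show "\<exists>a\<in>N. level (ereal \<mu>) #> (g \<otimes> x \<otimes> inv g) = level (ereal \<mu>) #> a"
        using N.inv_op_closed2 [OF that(1) a(1)] by blast
    qed (use that in \<open>auto simp: *\<close>)
  qed
qed

text \<open>Commutators are continuous: entries congruent modulo a normal \<open>level\<close> have
  congruent commutators.\<close>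

lemma gcomm_adherence:
  assumes sub: "A \<subseteq> carrier G" "B \<subseteq> carrier G" "E \<subseteq> carrier G"
    and gcomm: "\<And>a b. a \<in> A \<Longrightarrow> b \<in> B \<Longrightarrow> gcomm G a b \<in> E"
    and xy: "x \<in> adherence A" "y \<in> adherence B"
  shows "gcomm G x y \<in> adherence E"
  unfolding adherence_iff [OF sub(3)]
proof (intro conjI allI)
  show "gcomm G x y \<in> carrier G"
    using xy adherence_subset_carrier by blast
  fix \<mu> :: real
  interpret L: normal "level (ereal \<mu>)" G
    by (rule normal_level)
  obtain a b where ab: "a \<in> A" "level (ereal \<mu>) #> x = level (ereal \<mu>) #> a"
    "b \<in> B" "level (ereal \<mu>) #> y = level (ereal \<mu>) #> b"
    using xy unfolding adherence_iff [OF sub(1)] adherence_iff [OF sub(2)] by blast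
  have "level (ereal \<mu>) #> gcomm G x y = level (ereal \<mu>) #> gcomm G a b"
    using ab xy sub adherence_subset_carrier by (intro L.rcos_gcomm_cong) blast+
  then show "\<exists>e\<in>E. level (ereal \<mu>) #> gcomm G x y = level (ereal \<mu>) #> e"
    using gcomm ab by blast
qed

text \<open>Invert \<open>m\<close> modulo \<open>p ^ N\<close>: if
  \<open>m * u = 1 + p ^ N * s\<close>, the element \<open>(x [^] m) [^] u\<close> of
  \<open>K\<close> differs from \<open>x\<close> by a \<open>p ^ N\<close>-th power, which has value
  at least \<open>N\<close>. This is why \<open>isol\<close> can be content with exponents that are
  powers of \<open>p\<close>.\<close>

lemma coprime_root_in_closed:
  assumes K: "subgroup K G" "adherence K \<subseteq> K" and x: "x \<in> carrier G" "x [^] m \<in> K" and "\<not> p dvd m"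
  shows "x \<in> K"
proof -
  interpret K: subgroup K G
    by (rule K)
  have pow_K: "y [^] n \<in> K" if "y \<in> K" for y and n :: nat
    using that by (induction n) auto
  have "\<exists>a\<in>K. ereal \<mu> \<le> \<omega> (inv x \<otimes> a)" for \<mu> :: real
  proof -
    \<comment> \<open>\<open>1 \<le> N\<close> keeps the modulus \<open>p ^ N\<close> above 1, so
      that 1 is a reduced residue.\<close>
    obtain N :: nat where N: "\<mu> \<le> real N" "1 \<le> N"
    proof -
      obtain N :: nat where "\<mu> \<le> real N"
        using real_arch_simple by blast
      then show ?thesis
        using that [of "Suc N"] by simp
    qed
    have "coprime m p"
      using \<open>\<not> p dvd m\<close> prime by (metis coprime_commute prime_imp_coprime)
    then have "coprime m (p ^ N)"
      by simp
    then obtain u where "[m * u = Suc 0] (mod p ^ N)"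
      using cong_solve_coprime_nat by blast
    moreover have "1 < p ^ N"
      using N prime_gt_1_nat [OF prime] by (intro one_less_power) auto
    ultimately have "(m * u) mod p ^ N = 1"
      unfolding cong_def One_nat_def [symmetric] by (metis mod_less)
    then obtain s where s: "m * u = 1 + p ^ N * s"
      by (metis add.commute mult_div_mod_eq)
    have xs: "x [^] (p ^ N * s) = (x [^] (p ^ N)) [^] s"
      using x by (simp add: nat_pow_pow)
    have "(x [^] m) [^] u = x [^] (1 + p ^ N * s)"
      using x(1) by (simp only: nat_pow_pow s)
    also have "\<dots> = x \<otimes> x [^] (p ^ N * s)"
      using x(1) nat_pow_mult [of x 1 "p ^ N * s"] by simp
    finally have "inv x \<otimes> (x [^] m) [^] u = x [^] (p ^ N * s)"
      using x(1) by simp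
    moreover have "ereal \<mu> \<le> \<omega> (x [^] (p ^ N * s))"
    proof -
      have "ereal \<mu> \<le> ereal (real N)"
        using N by simp
      also have "\<dots> \<le> \<omega> x + ereal (real N)"
        using v_pos [OF x(1)] by (cases "\<omega> x") auto
      also have "\<dots> \<le> \<omega> (x [^] (p ^ N))"
        by (rule v_pow_pow [OF x(1)])
      also have "\<dots> \<le> \<omega> ((x [^] (p ^ N)) [^] s)"
        using x by (intro v_pow_nat) auto
      finally show ?thesis
        unfolding xs .
    qed
    ultimately show ?thesis
      using pow_K [OF x(2), of u] by metis
  qed
  then have "x \<in> adherence K"
    using x by (simp add: adherence_def)
  then show ?thesis
    using K by auto
qed

section \<open>The quotient valuation and isolators\<close>

text \<open>The induced filtration on the cosets of \<open>K\<close>, kept as a function on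
  \<open>G\<close>. For closed normal \<open>K\<close> the supremum is a maximum, by
  \<open>quotient_val_attained\<close>.\<close>

definition quotient_val :: "'a set \<Rightarrow> 'a \<Rightarrow> ereal" where
  "quotient_val K x = (SUP k\<in>K. \<omega> (x \<otimes> k))"

definition isol :: "'a set \<Rightarrow> 'a set" where
  "isol K = {x \<in> carrier G. \<exists>n. x [^] (p ^ n) \<in> K}"

end

locale closed_normal_subgroup = p_valued_group + normal K G for K +
  assumes adherence_K: "adherence K \<subseteq> K"
begin

lemma quotient_val_upper:
  assumes "x \<in> carrier G" "y \<in> carrier G" "K #> x = K #> y"
  shows "\<omega> y \<le> quotient_val K x"
proof -
  have "inv x \<otimes> y \<in> K" "x \<otimes> (inv x \<otimes> y) = y"
    using assms by (simp_all add: rcos_eq_iff)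
  then show ?thesis
    unfolding quotient_val_def by (metis SUP_upper)
qed

text \<open>If the values on the coset are bounded, only finitely many occur. Otherwise elements of
  \<open>K\<close> approach \<open>inv x\<close>, so \<open>x\<close> lies in the closed subgroup
  \<open>K\<close> and its coset contains \<open>\<one>\<close>, of infinite value.\<close>

lemma quotient_val_attained:
  assumes "x \<in> carrier G"
  obtains y where "y \<in> carrier G" "K #> x = K #> y" "quotient_val K x = \<omega> y"
proof -
  have carrier: "k \<in> carrier G" if "k \<in> K" for k
    using that subset by auto
  have "\<exists>k\<in>K. quotient_val K x = \<omega> (x \<otimes> k)"
  proof (cases "\<exists>B::real. \<forall>k\<in>K. \<omega> (x \<otimes> k) \<le> ereal B")
    case True
    then obtain B :: real where B: "\<forall>k\<in>K. \<omega> (x \<otimes> k) \<le> ereal B"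
      by blast
    have "(\<lambda>k. \<omega> (x \<otimes> k)) ` K \<subseteq> {\<omega> y | y. y \<in> carrier G \<and> \<omega> y \<le> ereal B}"
      using B assms carrier by blast
    then have fin: "finite ((\<lambda>k. \<omega> (x \<otimes> k)) ` K)"
      using finite_values finite_subset by blast
    have ne: "(\<lambda>k. \<omega> (x \<otimes> k)) ` K \<noteq> {}"
      using one_closed by blast
    have "Max ((\<lambda>k. \<omega> (x \<otimes> k)) ` K) \<in> (\<lambda>k. \<omega> (x \<otimes> k)) ` K"
      using fin ne by (rule Max_in)
    moreover have "quotient_val K x = Max ((\<lambda>k. \<omega> (x \<otimes> k)) ` K)"
      unfolding quotient_val_def using fin ne by (rule Max_Sup [symmetric])
    ultimately show ?thesis
      by auto
  next
    case False
    then have "inv x \<in> adherence K"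
      using assms unfolding adherence_def by (auto simp: not_le) (metis less_imp_le)
    then have "inv x \<in> K"
      using adherence_K by blast
    moreover have "\<omega> (x \<otimes> inv x) = \<infinity>"
      using assms v_one by simp
    ultimately show ?thesis
      unfolding quotient_val_def by (metis SUP_upper ereal_infty_less_eq(1))
  qed
  then obtain k where k: "k \<in> K" "quotient_val K x = \<omega> (x \<otimes> k)"
    by blast
  then have "K #> x = K #> (x \<otimes> k)"
    using assms carrier by (simp add: rcos_eq_iff)
  then show ?thesis
    by (rule that [of "x \<otimes> k", rotated]) (use k assms carrier in auto)
qed

lemma quotient_val_infinity_iff:
  assumes "x \<in> carrier G"
  shows "quotient_val K x = \<infinity> \<longleftrightarrow> x \<in> K"
proof
  obtain y where y: "y \<in> carrier G" "K #> x = K #> y" "quotient_val K x = \<omega> y"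
    by (rule quotient_val_attained [OF assms])
  assume "quotient_val K x = \<infinity>"
  then have "y = \<one>"
    using y \<omega>_infinity_iff by simp
  then have "inv x \<otimes> \<one> \<in> K"
    using y assms rcos_eq_iff one_closed by blast
  then show "x \<in> K"
    using assms m_inv_closed [of "inv x"] by simp
next
  assume "x \<in> K"
  then have "K #> x = K #> \<one>"
    using assms by (simp add: rcos_eq_iff)
  then show "quotient_val K x = \<infinity>"
    using quotient_val_upper [of x \<one>] assms v_one by simp
qed

text \<open>Every axiom is read off from best representatives: congruence modulo \<open>K\<close>
  passes to quotients, commutators and p-th powers, and each representative bounds the value of its
  coset from below.\<close>

lemma filtered_group_quotient_val: "filtered_group G p (quotient_val K)"
proof unfold_locales
  show "Factorial_Ring.prime p"
    by (rule prime)
  show "quotient_val K \<one> = \<infinity>"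
    by (simp add: quotient_val_infinity_iff)
  fix x assume x: "x \<in> carrier G"
  obtain x' where x': "x' \<in> carrier G" "K #> x = K #> x'" "quotient_val K x = \<omega> x'"
    using quotient_val_attained [OF x] by blast
  show "ereal (1 / (real p - 1)) < quotient_val K x"
    using v_gt [OF x'(1)] x' by simp
  have "K #> x [^] p = K #> x' [^] p"
    using x x' by (intro rcos_pow_cong)
  then show "quotient_val K x + 1 \<le> quotient_val K (x [^] p)"
    using quotient_val_upper [of "x [^] p" "x' [^] p"] x x' \<omega>_pow by simp
  fix y assume y: "y \<in> carrier G"
  obtain y' where y': "y' \<in> carrier G" "K #> y = K #> y'" "quotient_val K y = \<omega> y'"
    using quotient_val_attained [OF y] by blast
  have "K #> (inv x \<otimes> y) = K #> (inv x' \<otimes> y')"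
    using x x' y y' by (intro rcos_mult_cong rcos_inv_cong) auto
  then have "\<omega> (inv x' \<otimes> y') \<le> quotient_val K (inv x \<otimes> y)"
    using x x' y y' by (intro quotient_val_upper) auto
  moreover have "min (\<omega> x') (\<omega> y') \<le> \<omega> (inv x' \<otimes> y')"
    using x' y' by (intro v_diff)
  ultimately show "min (quotient_val K x) (quotient_val K y) \<le> quotient_val K (inv x \<otimes> y)"
    unfolding x'(3) y'(3) by (rule order_trans [rotated])
  have "K #> gcomm G x y = K #> gcomm G x' y'"
    using x x' y y' by (intro rcos_gcomm_cong)
  then have "\<omega> (gcomm G x' y') \<le> quotient_val K (gcomm G x y)"
    using x x' y y' by (intro quotient_val_upper) auto
  moreover have "\<omega> x' + \<omega> y' \<le> \<omega> (gcomm G x' y')"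
    using x' y' by (intro v_gcomm)
  ultimately show "quotient_val K x + quotient_val K y \<le> quotient_val K (gcomm G x y)"
    unfolding x'(3) y'(3) by (rule order_trans [rotated])
qed

text \<open>Let \<open>g\<close> be a best representative, of value \<open>s\<close>, and suppose
  the coset of \<open>g [^] p\<close> contains some \<open>y\<close> of value above
  \<open>s + 1\<close>. Then \<open>inv (g [^] p) \<otimes> y\<close> is a deep element of
  \<open>K\<close>, hence equal to \<open>h [^] p\<close> with \<open>h\<close> in \<open>K\<close>
  of value at least \<open>s\<close>. Now \<open>(g \<otimes> h) [^] p\<close> agrees with
  \<open>g [^] p \<otimes> h [^] p = y\<close> above \<open>s + 1\<close>, so
  \<open>g \<otimes> h\<close> has value above \<open>s\<close>, against the choice of
  \<open>g\<close>.\<close>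

lemma deep_filtered_group_quotient_val: "\<exists>\<nu>. deep_filtered_group G p (quotient_val K) \<nu>"
proof -
  interpret q: filtered_group G p "quotient_val K"
    by (rule filtered_group_quotient_val)
  obtain \<nu> :: real where \<nu>: "2 < \<nu>" and roots: "\<And>h. h \<in> K \<Longrightarrow> ereal \<nu> \<le> \<omega> h \<Longrightarrow> \<exists>x\<in>K. x [^] p = h"
    using deep_elements_are_pth_powers [OF is_subgroup adherence_K] by blast
  have "quotient_val K (x [^] p) = quotient_val K x + 1" if x: "x \<in> carrier G" "ereal \<nu> \<le> quotient_val K x" for x
  proof (rule antisym)
    show "quotient_val K x + 1 \<le> quotient_val K (x [^] p)"
      by (rule q.v_pow [OF x(1)])
    show "quotient_val K (x [^] p) \<le> quotient_val K x + 1"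
    proof (rule ccontr)
      assume "\<not> ?thesis"
      then have gt: "quotient_val K x + 1 < quotient_val K (x [^] p)"
        by simp
      obtain g where g: "g \<in> carrier G" "K #> x = K #> g" "quotient_val K x = \<omega> g"
        using quotient_val_attained [OF x(1)] by blast
      obtain y where y: "y \<in> carrier G" "K #> x [^] p = K #> y" "quotient_val K (x [^] p) = \<omega> y"
        using quotient_val_attained [of "x [^] p"] x by blast
      obtain s where s: "\<omega> g = ereal s"
        using gt g x(2) by (cases "\<omega> g") auto
      have s2: "2 < s" "\<nu> \<le> s"
        using s x(2) g(3) \<nu> by auto
      have y_gt: "ereal (s + 1) < \<omega> y"
        using gt g y s by (simp add: one_ereal_def)
      have "K #> g [^] p = K #> y"
        using rcos_pow_cong [OF g(2) x(1) g(1), of p] y by simp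
      then have k: "inv (g [^] p) \<otimes> y \<in> K"
        using g y by (simp add: rcos_eq_iff)
      have "\<omega> (g [^] p) = ereal (s + 1)"
        using \<omega>_pow [OF g(1)] s by (simp add: one_ereal_def)
      then have k_ge: "ereal (s + 1) \<le> \<omega> (inv (g [^] p) \<otimes> y)"
        using v_diff [of "g [^] p" y] g y y_gt by simp
      moreover have "ereal \<nu> \<le> ereal (s + 1)"
        using s2 by simp
      ultimately have "ereal \<nu> \<le> \<omega> (inv (g [^] p) \<otimes> y)"
        by (rule order_trans [rotated])
      then obtain h where h: "h \<in> K" "h [^] p = inv (g [^] p) \<otimes> y"
        using roots k by blast
      have hG: "h \<in> carrier G"
        using h subset by auto
      have "ereal s \<le> \<omega> h"
        using k_ge \<omega>_pow [OF hG] h by (cases "\<omega> h") (auto simp: one_ereal_def)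
      then have "level_gt (ereal (s + 1)) #> (g \<otimes> h) [^] p = level_gt (ereal (s + 1)) #> (g [^] p \<otimes> h [^] p)"
        using s2 g hG by (intro pow_mult_level) auto
      also have "g [^] p \<otimes> h [^] p = y"
        using g y by (simp add: h)
      finally have eq: "level_gt (ereal (s + 1)) #> (g \<otimes> h) [^] p = level_gt (ereal (s + 1)) #> y" .
      interpret M: normal "level_gt (ereal (s + 1))" G
        by (rule normal_level_gt) simp
      have "y \<in> level_gt (ereal (s + 1))"
        using y y_gt by (simp add: level_gt_def)
      then have "level_gt (ereal (s + 1)) #> (g \<otimes> h) [^] p = level_gt (ereal (s + 1))"
        using eq M.rcos_const [OF is_group] by simp
      then have "(g \<otimes> h) [^] p \<in> level_gt (ereal (s + 1))"
        by (rule coset_join1) (use g hG M.is_subgroup M.subset in auto)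
      then have "ereal s < \<omega> (g \<otimes> h)"
        using \<omega>_pow [of "g \<otimes> h"] g hG by (cases "\<omega> (g \<otimes> h)") (auto simp: level_gt_def one_ereal_def)
      moreover have "K #> g = K #> (g \<otimes> h)"
        using g hG h by (simp add: rcos_eq_iff)
      then have "\<omega> (g \<otimes> h) \<le> quotient_val K x"
        using g x hG by (intro quotient_val_upper) auto
      ultimately show False
        using g s by simp
    qed
  qed
  then have "deep_filtered_group G p (quotient_val K) \<nu>"
    using \<nu> by unfold_locales auto
  then show ?thesis ..
qed

lemma quotient_level_infinity: "filtered_group.level G (quotient_val K) \<infinity> = K"
proof -
  interpret q: filtered_group G p "quotient_val K"
    by (rule filtered_group_quotient_val)
  show ?thesis
    using quotient_val_infinity_iff subset by (auto simp: q.level_def)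
qed

lemma quotient_torsion: "filtered_group.torsion G p (quotient_val K) = isol K"
proof -
  interpret q: filtered_group G p "quotient_val K"
    by (rule filtered_group_quotient_val)
  show ?thesis
    by (simp add: q.torsion_def isol_def quotient_level_infinity)
qed

lemma normal_isol: "isol K \<lhd> G"
  using deep_filtered_group_quotient_val deep_filtered_group.normal_torsion quotient_torsion by metis

lemma subset_isol: "K \<subseteq> isol K"
proof
  fix x assume "x \<in> K"
  then have "x \<in> carrier G" "x [^] (p ^ 0) \<in> K"
    using subset by auto
  then show "x \<in> isol K"
    unfolding isol_def by blast
qed

text \<open>A deep quotient of two elements that are torsion modulo \<open>K\<close> lies in
  \<open>K\<close>. Hence cosets of \<open>K\<close> in \<open>isol K\<close> are separated by the
  finitely many cosets of one \<open>level\<close>, which yields both finite index and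
  closedness.\<close>

lemma isol_locally_constant:
  "\<exists>\<nu>::real. \<forall>x\<in>isol K. \<forall>y\<in>isol K. level (ereal \<nu>) #> x = level (ereal \<nu>) #> y \<longrightarrow> inv x \<otimes> y \<in> K"
proof -
  obtain \<nu> where "deep_filtered_group G p (quotient_val K) \<nu>"
    using deep_filtered_group_quotient_val ..
  then interpret q: deep_filtered_group G p "quotient_val K" \<nu> .
  interpret L: normal "level (ereal \<nu>)" G
    by (rule normal_level)
  have "inv x \<otimes> y \<in> K" if xy: "x \<in> isol K" "y \<in> isol K" "level (ereal \<nu>) #> x = level (ereal \<nu>) #> y" for x y
  proof -
    have carrier: "x \<in> carrier G" "y \<in> carrier G"
      using xy by (auto simp: isol_def)
    then have "inv x \<otimes> y \<in> level (ereal \<nu>)"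
      using xy by (simp add: L.rcos_eq_iff)
    then have "ereal \<nu> \<le> \<omega> (inv x \<otimes> y)"
      by (simp add: level_def)
    also have "\<dots> \<le> quotient_val K (inv x \<otimes> y)"
      using carrier by (intro quotient_val_upper) auto
    finally have "ereal \<nu> \<le> quotient_val K (inv x \<otimes> y)" .
    then have "inv x \<otimes> y \<in> q.level \<infinity>"
      using xy carrier unfolding quotient_torsion [symmetric]
      by (intro q.deep_torsion_quotient [of x]) simp_all
    then show ?thesis
      by (simp add: quotient_level_infinity)
  qed
  then show ?thesis
    by blast
qed

lemma finite_index_isol: "finite ((\<lambda>x. K #> x) ` isol K)"
proof -
  obtain \<nu> :: real where \<nu>: "\<And>x y. x \<in> isol K \<Longrightarrow> y \<in> isol K \<Longrightarrow> level (ereal \<nu>) #> x = level (ereal \<nu>) #> y \<Longrightarrow> inv x \<otimes> y \<in> K"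
    using isol_locally_constant by blast
  have sub: "isol K \<subseteq> carrier G"
    by (auto simp: isol_def)
  let ?f = "\<lambda>x. level (ereal \<nu>) #> x"
  have "(\<lambda>x. K #> x) ` isol K \<subseteq> (\<lambda>C. K #> inv_into (isol K) ?f C) ` ?f ` isol K"
  proof
    fix C assume "C \<in> (\<lambda>x. K #> x) ` isol K"
    then obtain x where x: "x \<in> isol K" "C = K #> x"
      by blast
    define y where "y = inv_into (isol K) ?f (?f x)"
    have y: "y \<in> isol K" "?f y = ?f x"
      unfolding y_def using x by (blast intro: inv_into_into, intro f_inv_into_f imageI)
    then have "inv y \<otimes> x \<in> K"
      using \<nu> x by blast
    then have "C = K #> y"
      using x y sub rcos_eq_iff by blast
    then show "C \<in> (\<lambda>C. K #> inv_into (isol K) ?f C) ` ?f ` isol K"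
      using x unfolding y_def by blast
  qed
  moreover have "finite (?f ` isol K)"
    using finite_index_level sub by (meson finite_subset image_mono)
  ultimately show ?thesis
    by (meson finite_imageI finite_subset)
qed

text \<open>Close to \<open>x\<close>, the elements of \<open>isol K\<close> lie in a single coset
  of \<open>K\<close>, by local constancy; so \<open>inv a \<otimes> x\<close> is a limit of
  elements of \<open>K\<close>.\<close>

lemma closed_isol: "adherence (isol K) \<subseteq> isol K"
proof
  fix x assume "x \<in> adherence (isol K)"
  interpret I: normal "isol K" G
    by (rule normal_isol)
  have x: "x \<in> carrier G" "\<And>\<mu>::real. \<exists>a\<in>isol K. level (ereal \<mu>) #> x = level (ereal \<mu>) #> a"
    using \<open>x \<in> adherence (isol K)\<close> unfolding adherence_iff [OF I.subset] by blast+
  obtain \<nu> :: real where \<nu>: "\<And>x y. x \<in> isol K \<Longrightarrow> y \<in> isol K \<Longrightarrow> level (ereal \<nu>) #> x = level (ereal \<nu>) #> y \<Longrightarrow> inv x \<otimes> y \<in> K"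
    using isol_locally_constant by blast
  obtain a where a: "a \<in> isol K" "level (ereal \<nu>) #> x = level (ereal \<nu>) #> a"
    using x by blast
  have aG: "a \<in> carrier G"
    using a I.subset by auto
  interpret N: normal "level (ereal \<nu>)" G
    by (rule normal_level)
  have "\<exists>k\<in>K. level (ereal \<mu>) #> (inv a \<otimes> x) = level (ereal \<mu>) #> k" for \<mu> :: real
  proof -
    \<comment> \<open>\<open>b\<close> has to approximate \<open>x\<close> with precision \<mu> and
      also to share with \<open>a\<close> its coset of \<open>level (ereal \<nu>)\<close>.\<close>
    define \<mu>' where "\<mu>' = max \<mu> \<nu>"
    interpret L: normal "level (ereal \<mu>)" G
      by (rule normal_level)
    interpret L': normal "level (ereal \<mu>')" G
      by (rule normal_level)
    obtain b where b: "b \<in> isol K" "level (ereal \<mu>') #> x = level (ereal \<mu>') #> b"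
      using x by blast
    have bG: "b \<in> carrier G"
      using b I.subset by auto
    have "inv x \<otimes> b \<in> level (ereal \<mu>')"
      using b bG x by (simp add: L'.rcos_eq_iff)
    moreover have "level (ereal \<mu>') \<subseteq> level (ereal \<mu>)" "level (ereal \<mu>') \<subseteq> level (ereal \<nu>)"
      by (intro level_subset_level; simp add: \<mu>'_def)+
    ultimately have "inv x \<otimes> b \<in> level (ereal \<mu>)" "inv x \<otimes> b \<in> level (ereal \<nu>)"
      by blast+
    then have eq: "level (ereal \<mu>) #> x = level (ereal \<mu>) #> b" "level (ereal \<nu>) #> x = level (ereal \<nu>) #> b"
      using x bG by (simp_all add: L.rcos_eq_iff N.rcos_eq_iff)
    then have "inv a \<otimes> b \<in> K"
      using \<nu> a b by metis
    moreover have "level (ereal \<mu>) #> (inv a \<otimes> x) = level (ereal \<mu>) #> (inv a \<otimes> b)"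
      by (rule L.rcos_mult_cong [OF refl eq(1)]) (use aG bG x in auto)
    ultimately show ?thesis
      by blast
  qed
  then have "inv a \<otimes> x \<in> adherence K"
    using aG x unfolding adherence_iff [OF subset] by simp
  then have "inv a \<otimes> x \<in> isol K"
    using adherence_K subset_isol by blast
  then have "a \<otimes> (inv a \<otimes> x) \<in> isol K"
    by (rule I.m_closed [OF a(1)])
  then show "x \<in> isol K"
    using aG x by simp
qed

text \<open>Split the exponent as \<open>m * p ^ b\<close> with \<open>m\<close> prime to
  \<open>p\<close>: the power of \<open>p\<close> is absorbed by the definition of
  \<open>isol\<close>, the factor \<open>m\<close> by \<open>coprime_root_in_closed\<close>.\<close>

lemma root_in_isol:
  assumes "x \<in> carrier G" "0 < n" "x [^] (n::nat) \<in> isol K"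
  shows "x \<in> isol K"
proof -
  obtain b m where m: "n = m * p ^ b" "\<not> p dvd m"
    using prime_power_canonical [OF prime assms(2)] by blast
  obtain j where j: "(x [^] n) [^] (p ^ j) \<in> K"
    using assms(3) unfolding isol_def by blast
  have "n * p ^ j = p ^ (b + j) * m"
    using m by (simp add: power_add)
  then have "(x [^] (p ^ (b + j))) [^] m \<in> K"
    using j assms(1) by (simp add: nat_pow_pow)
  then have "x [^] (p ^ (b + j)) \<in> K"
    by (rule coprime_root_in_closed [OF is_subgroup adherence_K nat_pow_closed [OF assms(1)] _ m(2)])
  then show ?thesis
    using assms(1) unfolding isol_def by blast
qed

lemma closed_normal_isol: "closed_normal_subgroup G p \<omega> (isol K)"
  by (intro closed_normal_subgroup.intro p_valued_group_axioms closed_normal_subgroup_axioms.intro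
      normal_isol closed_isol)

lemma isol_isol: "isol (isol K) = isol K"
proof
  show "isol (isol K) \<subseteq> isol K"
  proof
    fix x assume "x \<in> isol (isol K)"
    then obtain n where n: "x \<in> carrier G" "x [^] (p ^ n) \<in> isol K"
      unfolding isol_def [of "isol K"] by blast
    have "0 < p ^ n"
      using prime_gt_0_nat [OF prime] by simp
    then show "x \<in> isol K"
      by (rule root_in_isol [OF n(1) _ n(2)])
  qed
  show "isol K \<subseteq> isol (isol K)"
    by (rule closed_normal_subgroup.subset_isol [OF closed_normal_isol])
qed

text \<open>For normal subgroups the condition in \<open>orbital\<close> on the normalizer thereby
  becomes openness of \<open>carrier G\<close>.\<close>

lemma normalizer_normal:
  assumes "N \<lhd> G"
  shows "normalizer G N = carrier G"
proof -
  interpret N: normal N G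
    by (rule assms)
  have "g <# N #> inv g = N" if "g \<in> carrier G" for g
  proof -
    have "g <# N = N #> g"
      using N.coset_eq that by simp
    then show ?thesis
      using that N.subset by (simp add: coset_mult_assoc)
  qed
  then show ?thesis
    using N.subset by (auto simp: normalizer_def stabilizer_def)
qed

lemma orbital_isol: "orbital G \<omega> (isol K)"
proof -
  have "subgroup (isol K) G"
    by (rule normal_imp_subgroup [OF normal_isol])
  then show ?thesis
    unfolding orbital_def closedin_val_topology openin_val_topology normalizer_normal [OF normal_isol]
    using closed_isol val_open_carrier subgroup.subset by blast
qed

text \<open>Pigeonhole on the powers of \<open>x\<close>: two of them share a coset of
  \<open>K\<close>, so a positive power of \<open>x\<close> lies in \<open>K\<close>.\<close>

lemma finite_index_imp_subset_isol:
  assumes L: "subgroup L G" and "finite_index G K L"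
  shows "L \<subseteq> isol K"
proof
  fix x assume x: "x \<in> L"
  interpret L: subgroup L G
    by (rule L)
  have xG: "x \<in> carrier G"
    using x L.subset by auto
  have pow_L: "x [^] n \<in> L" for n :: nat
    by (induction n) (use x in auto)
  have "(\<lambda>n::nat. K #> x [^] n) ` UNIV \<subseteq> (\<lambda>x. K #> x) ` L"
    using pow_L by blast
  then have "finite (range (\<lambda>n::nat. K #> x [^] n))"
    using assms(2) unfolding finite_index_def by (rule finite_subset)
  then have "\<not> inj (\<lambda>n::nat. K #> x [^] n)"
    using finite_imageD infinite_UNIV_nat by blast
  then obtain i j :: nat where ij: "i < j" "K #> x [^] i = K #> x [^] j"
    unfolding inj_def by (metis nat_neq_iff)
  then have "inv (x [^] i) \<otimes> x [^] j \<in> K"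
    using xG by (simp add: rcos_eq_iff)
  moreover have "x [^] j = x [^] i \<otimes> x [^] (j - i)"
    using xG ij by (simp add: nat_pow_mult)
  ultimately have "x [^] (j - i) \<in> isol K"
    using xG subset_isol by auto
  then show "x \<in> isol K"
    using root_in_isol [OF xG, of "j - i"] ij(1) by simp
qed

text \<open>\<open>isol K\<close> is itself orbital of finite index over \<open>K\<close> and
  contains every other such subgroup. The union in the definition of \<open>isolator\<close> is
  therefore already a closed subgroup, and neither generation nor closure adds to it.\<close>

lemma isolator_eq_isol: "isolator G \<omega> K = isol K"
proof -
  interpret I: normal "isol K" G
    by (rule normal_isol)
  have "\<Union>{L. orbital G \<omega> L \<and> K \<subseteq> L \<and> finite_index G K L} = isol K"
  proof
    show "\<Union>{L. orbital G \<omega> L \<and> K \<subseteq> L \<and> finite_index G K L} \<subseteq> isol K"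
      using finite_index_imp_subset_isol unfolding orbital_def by blast
    show "isol K \<subseteq> \<Union>{L. orbital G \<omega> L \<and> K \<subseteq> L \<and> finite_index G K L}"
      using orbital_isol subset_isol finite_index_isol unfolding finite_index_def by blast
  qed
  moreover have "generate G (isol K) = isol K"
    using generate_subgroup_incl [OF order_refl I.is_subgroup] generate.incl [of _ "isol K" G] by blast
  moreover have "adherence (isol K) = isol K"
    using closed_isol subset_adherence [OF I.subset] by (rule antisym)
  ultimately show ?thesis
    unfolding isolator_def using closure_of_val_topology [OF I.subset] by simp
qed

text \<open>A subgroup of finite index over \<open>isol K\<close> is contained in
  \<open>isol (isol K)\<close>, which is \<open>isol K\<close> again.\<close>

lemma isolated_orbital_isol: "isolated_orbital G \<omega> (isol K)"
  unfolding isolated_orbital_def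
proof (intro conjI allI impI)
  show "orbital G \<omega> (isol K)"
    by (rule orbital_isol)
  fix K' assume K': "orbital G \<omega> K' \<and> isol K \<subset> K'"
  interpret I: closed_normal_subgroup G p \<omega> "isol K"
    by (rule closed_normal_isol)
  show "\<not> finite_index G (isol K) K'"
    using I.finite_index_imp_subset_isol K' isol_isol unfolding orbital_def by blast
qed

end

context p_valued_group
begin

text \<open>Once roots are unique, commuting with a power of an element implies commuting with the
  element itself; this is applied to the two entries of the commutator in turn.\<close>

lemma gcomm_isol:
  assumes "closed_normal_subgroup G p \<omega> E"
    and gcomm: "\<And>a b. a \<in> A \<Longrightarrow> b \<in> B \<Longrightarrow> gcomm G a b \<in> E"
    and xy: "x \<in> isol A" "y \<in> isol B"
  shows "gcomm G x y \<in> isol E"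
proof -
  interpret E: closed_normal_subgroup G p \<omega> E
    by (rule assms)
  \<comment> \<open>The modulus is \<open>isol E\<close> rather than \<open>E\<close>, because
    uniqueness of roots requires a torsion-free quotient.\<close>
  interpret I: closed_normal_subgroup G p \<omega> "isol E"
    by (rule E.closed_normal_isol)
  obtain \<nu> where "deep_filtered_group G p (quotient_val (isol E)) \<nu>"
    using I.deep_filtered_group_quotient_val ..
  then interpret q: deep_filtered_group G p "quotient_val (isol E)" \<nu> .
  have tf: "q.torsion = q.level \<infinity>"
    by (simp add: I.quotient_torsion I.quotient_level_infinity E.isol_isol)
  obtain m n where mn: "x \<in> carrier G" "x [^] (p ^ m) \<in> A" "y \<in> carrier G" "y [^] (p ^ n) \<in> B"
    using xy unfolding isol_def by blast
  then have "gcomm G (x [^] (p ^ m)) (y [^] (p ^ n)) \<in> q.level \<infinity>"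
    using gcomm E.subset_isol I.quotient_level_infinity by blast
  then have "gcomm G x (y [^] (p ^ n)) \<in> q.level \<infinity>"
    by (rule q.gcomm_pow_left [OF tf mn(1) nat_pow_closed [OF mn(3)]])
  then have "gcomm G x y \<in> q.level \<infinity>"
    by (rule q.gcomm_pow_right [OF tf mn(1) mn(3)])
  then show ?thesis
    by (simp add: I.quotient_level_infinity)
qed

end

section \<open>Abelian quotients\<close>

context comm_group
begin

definition powers :: "nat \<Rightarrow> 'a set" where
  "powers n = (\<lambda>x. x [^] n) ` carrier G"

lemma powers_subset: "powers n \<subseteq> carrier G"
  by (auto simp: powers_def)

lemma one_in_powers: "\<one> \<in> powers n"
  unfolding powers_def by (metis image_eqI nat_pow_one one_closed)

lemma powers_mult: "x \<in> powers n \<Longrightarrow> y \<in> powers n \<Longrightarrow> x \<otimes> y \<in> powers n"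
  unfolding powers_def by (smt (verit) image_iff m_closed nat_pow_distrib)

lemma powers_inv: "x \<in> powers n \<Longrightarrow> inv x \<in> powers n"
  unfolding powers_def by (smt (verit) image_iff inv_closed nat_pow_inv)

lemma powers_antimono:
  assumes "m dvd n"
  shows "powers n \<subseteq> powers m"
proof -
  obtain k where k: "n = k * m"
    using assms by (metis dvd_def mult.commute)
  have "x [^] n = (x [^] k) [^] m" if "x \<in> carrier G" for x
    using that k by (simp add: nat_pow_pow)
  then show ?thesis
    unfolding powers_def by auto
qed

text \<open>The p-adic divisibility, as on a free module over the p-adic integers, shifted by 2 so
  as to exceed \<open>1 / (p - 1)\<close>, which is 1 for \<open>p = 2\<close>. The
  \<open>LEAST\<close> is meaningful as long as only \<open>\<one>\<close> is a
  \<open>p ^ k\<close>-th power for all \<open>k\<close>.\<close>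

definition divisibility_val :: "nat \<Rightarrow> 'a \<Rightarrow> ereal" where
  "divisibility_val p x = (if x = \<one> then \<infinity> else ereal (2 + real (LEAST k. x \<notin> powers (p ^ Suc k))))"

lemma foldr_mult_single:
  assumes "distinct is" "\<And>i. i \<noteq> j \<Longrightarrow> f i = \<one>" "f j \<in> carrier G"
  shows "foldr (\<lambda>i acc. f i \<otimes> acc) is \<one> = (if j \<in> set is then f j else \<one>)"
  using assms
proof (induction "is")
  case (Cons i "is")
  then show ?case
    by (cases "i = j") auto
qed simp

text \<open>Torsion-freeness makes a p-th power exactly one step more divisible, and commutators are
  trivial. For the rank, representatives modulo p-th powers suffice in every degree: if
  \<open>h\<close> and \<open>r\<close> agree up to a p-th power, then \<open>h [^] (p ^ k)\<close>
  and \<open>r [^] (p ^ k)\<close> agree up to a \<open>p ^ Suc k\<close>-th power.\<close>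

lemma p_valuable_if_divisibility_complete:
  assumes prime: "Factorial_Ring.prime p"
    and torsion_free: "\<And>x. x \<in> carrier G \<Longrightarrow> x [^] p = \<one> \<Longrightarrow> x = \<one>"
    and separated: "\<And>x. x \<in> carrier G \<Longrightarrow> (\<And>k. x \<in> powers (p ^ k)) \<Longrightarrow> x = \<one>"
    and reps: "finite R" "R \<subseteq> carrier G" "\<And>x. x \<in> carrier G \<Longrightarrow> \<exists>r\<in>R. inv r \<otimes> x \<in> powers p"
    and complete: "\<And>t :: nat \<Rightarrow> 'a. (\<And>k. t k \<in> carrier G) \<Longrightarrow> (\<And>k. inv (t k) \<otimes> t (Suc k) \<in> powers (p ^ k)) \<Longrightarrow>
      \<exists>y\<in>carrier G. \<forall>k. inv y \<otimes> t k \<in> powers (p ^ k)"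
  shows "p_valuable G p"
proof -
  define d where "d = (\<lambda>x. LEAST k. x \<notin> powers (p ^ Suc k))"
  define v where "v = divisibility_val p"
  have p: "1 < p"
    using prime by (rule prime_gt_1_nat)
  have v_one: "v \<one> = \<infinity>" and v_eq: "x \<noteq> \<one> \<Longrightarrow> v x = ereal (2 + real (d x))" for x
    by (simp_all add: v_def divisibility_val_def d_def)
  have anti: "powers (p ^ l) \<subseteq> powers (p ^ k)" if "k \<le> l" for k l
    using that by (intro powers_antimono le_imp_power_dvd)
  have d_iff: "x \<in> powers (p ^ k) \<longleftrightarrow> k \<le> d x" if x: "x \<in> carrier G" "x \<noteq> \<one>" for x k
  proof -
    obtain l where "x \<notin> powers (p ^ l)"
      using separated x by blast
    moreover have "powers (p ^ Suc l) \<subseteq> powers (p ^ l)"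
      by (rule anti) simp
    ultimately have "x \<notin> powers (p ^ Suc l)"
      by blast
    then have not: "x \<notin> powers (p ^ Suc (d x))"
      unfolding d_def by (rule LeastI)
    show ?thesis
    proof
      assume "x \<in> powers (p ^ k)"
      then show "k \<le> d x"
        using not anti [of "Suc (d x)" k] by (meson not_less_eq_eq subsetD)
    next
      assume "k \<le> d x"
      show "x \<in> powers (p ^ k)"
      proof (cases k)
        case 0
        then show ?thesis
          using x unfolding powers_def by (simp add: image_iff)
      next
        case (Suc j)
        then have "j < (LEAST k. x \<notin> powers (p ^ Suc k))"
          using \<open>k \<le> d x\<close> by (simp add: d_def)
        then have "\<not> x \<notin> powers (p ^ Suc j)"
          by (rule not_less_Least)
        then show ?thesis
          using Suc by simp
      qed
    qed
  qed
  have v_iff: "ereal (2 + real k) \<le> v x \<longleftrightarrow> x \<in> powers (p ^ k)" if "x \<in> carrier G" for x k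
    using d_iff [OF that] one_in_powers v_one v_eq [of x] by (cases "x = \<one>") auto
  have v_iff_ceiling: "ereal \<mu> \<le> v x \<longleftrightarrow> x \<in> powers (p ^ nat \<lceil>\<mu> - 2\<rceil>)" if "x \<in> carrier G" for x \<mu>
  proof (cases "x = \<one>")
    case False
    have "ereal \<mu> \<le> v x \<longleftrightarrow> nat \<lceil>\<mu> - 2\<rceil> \<le> d x"
      using v_eq [OF False] by (simp add: nat_le_iff ceiling_le_iff algebra_simps)
    then show ?thesis
      using d_iff [OF that False] by simp
  qed (use one_in_powers v_one in simp)
  have v_inv: "v (inv x) = v x" if "x \<in> carrier G" for x
  proof -
    have "inv x \<in> powers n \<longleftrightarrow> x \<in> powers n" for n
      using powers_inv [of x n] powers_inv [of "inv x" n] that by auto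
    then show ?thesis
      using that by (simp add: v_def divisibility_val_def)
  qed
  have valuation: "p_valuation G p v"
    unfolding p_valuation_def
  proof (intro conjI ballI)
    fix x assume x: "x \<in> carrier G"
    show "v x = \<infinity> \<longleftrightarrow> x = \<one>"
      using v_one v_eq [of x] by (cases "x = \<one>") simp_all
    have "1 / (real p - 1) \<le> 1"
      using p by (simp add: divide_simps)
    then show "ereal (1 / (real p - 1)) < v x"
      using v_one v_eq [of x] by (cases "x = \<one>") auto
    show "v (x [^] p) = v x + 1"
    proof (cases "x = \<one>")
      case False
      then have xp: "x [^] p \<noteq> \<one>" "x [^] p \<in> carrier G"
        using torsion_free x by auto
      have "x [^] p \<in> powers (p ^ Suc k) \<longleftrightarrow> x \<in> powers (p ^ k)" for k
      proof
        assume "x \<in> powers (p ^ k)"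
        then obtain y where "y \<in> carrier G" "x = y [^] (p ^ k)"
          unfolding powers_def by blast
        then show "x [^] p \<in> powers (p ^ Suc k)"
          unfolding powers_def by (auto simp: nat_pow_pow mult.commute)
      next
        assume "x [^] p \<in> powers (p ^ Suc k)"
        then obtain y where y: "y \<in> carrier G" "x [^] p = (y [^] (p ^ k)) [^] p"
          unfolding powers_def by (auto simp: nat_pow_pow mult.commute)
        then have "(x \<otimes> inv (y [^] (p ^ k))) [^] p = \<one>"
          using x by (simp add: nat_pow_distrib nat_pow_inv)
        then have "x \<otimes> inv (y [^] (p ^ k)) = \<one>"
          by (rule torsion_free [rotated]) (use x y in auto)
        then have "x = y [^] (p ^ k)"
          using x y by (metis inv_closed inv_equality inv_inv nat_pow_closed)
        then show "x \<in> powers (p ^ k)"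
          using y unfolding powers_def by blast
      qed
      then have "Suc k \<le> d (x [^] p) \<longleftrightarrow> k \<le> d x" for k
        unfolding d_iff [OF xp(2,1), symmetric] d_iff [OF x False, symmetric] .
      from this [of "d x"] this [of "Suc (d x)"] have "d (x [^] p) = Suc (d x)"
        by simp
      then show ?thesis
        using v_eq [OF False] v_eq [OF xp(1)] by (simp add: one_ereal_def)
    qed (simp add: v_one)
    fix y assume y: "y \<in> carrier G"
    show "min (v x) (v y) \<le> v (inv x \<otimes> y)"
    proof (cases "inv x \<otimes> y = \<one> \<or> x = \<one> \<or> y = \<one>")
      case True
      then show ?thesis
        using x y v_one v_inv [OF x] by auto
    next
      case False
      then have "inv x \<in> powers (p ^ min (d x) (d y))" "y \<in> powers (p ^ min (d x) (d y))"
        using x y d_iff [OF x] d_iff [OF y] powers_inv by simp_all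
      then have "inv x \<otimes> y \<in> powers (p ^ min (d x) (d y))"
        by (rule powers_mult)
      then have "min (d x) (d y) \<le> d (inv x \<otimes> y)"
        using False x y d_iff by simp
      then show ?thesis
        using False v_eq by (auto simp: min_def split: if_splits)
    qed
    have "gcomm G x y = \<one>"
      using x y by (simp add: gcomm_def m_comm [of x y] m_assoc)
    then show "v x + v y \<le> v (gcomm G x y)"
      by (simp add: v_one)
  qed
  have "val_complete G v"
    unfolding val_complete_def
  proof (intro allI impI)
    fix s :: "nat \<Rightarrow> 'a"
    assume asm: "(\<forall>n. s n \<in> carrier G) \<and> (\<forall>\<mu>::real. \<exists>N. \<forall>m\<ge>N. \<forall>n\<ge>N. ereal \<mu> \<le> v (inv (s m) \<otimes> s n))"
    have s: "s n \<in> carrier G" for n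
      using asm by simp
    have cauchy: "\<exists>N. \<forall>m\<ge>N. \<forall>n\<ge>N. ereal \<mu> \<le> v (inv (s m) \<otimes> s n)" for \<mu> :: real
      using asm by simp
    have "\<exists>N. \<forall>m\<ge>N. \<forall>n\<ge>N. inv (s m) \<otimes> s n \<in> powers (p ^ k)" for k
    proof -
      obtain N where "\<forall>m\<ge>N. \<forall>n\<ge>N. ereal (2 + real k) \<le> v (inv (s m) \<otimes> s n)"
        using cauchy by blast
      then show ?thesis
        using s v_iff by (intro exI [of _ N]) simp
    qed
    then obtain N where N: "\<And>k m n. N k \<le> m \<Longrightarrow> N k \<le> n \<Longrightarrow> inv (s m) \<otimes> s n \<in> powers (p ^ k)"
      by metis
    \<comment> \<open>With partial sums, \<open>M k\<close> and \<open>M (Suc k)\<close> both lie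
      beyond \<open>N k\<close>, so the subsequence \<open>s (M k)\<close> satisfies the hypothesis
      on consecutive quotients.\<close>
    define M where "M = (\<lambda>k. \<Sum>i\<le>k. N i)"
    have M: "N k \<le> M k" for k
      unfolding M_def by (rule member_le_sum) auto
    have M_Suc: "N k \<le> M (Suc k)" for k
      using M [of k] by (simp add: M_def)
    have "\<exists>y\<in>carrier G. \<forall>k. inv y \<otimes> s (M k) \<in> powers (p ^ k)"
      by (rule complete [OF s N [OF M M_Suc]])
    then obtain y where y: "y \<in> carrier G" "\<And>k. inv y \<otimes> s (M k) \<in> powers (p ^ k)"
      by blast
    have "\<exists>N. \<forall>n\<ge>N. ereal \<mu> \<le> v (inv y \<otimes> s n)" for \<mu> :: real
    proof -
      define k where "k = nat \<lceil>\<mu> - 2\<rceil>"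
      have "ereal \<mu> \<le> v (inv y \<otimes> s n)" if "M k \<le> n" for n
      proof -
        have "inv y \<otimes> s n = (inv y \<otimes> s (M k)) \<otimes> (inv (s (M k)) \<otimes> s n)"
          using s y by (simp add: m_assoc)
        moreover have "inv (s (M k)) \<otimes> s n \<in> powers (p ^ k)"
          by (rule N [OF M order_trans [OF M that]])
        ultimately have "inv y \<otimes> s n \<in> powers (p ^ k)"
          using y powers_mult by simp
        then show ?thesis
          using s y v_iff_ceiling by (simp add: k_def)
      qed
      then show ?thesis
        by blast
    qed
    then show "\<exists>y\<in>carrier G. \<forall>\<mu>::real. \<exists>N. \<forall>n\<ge>N. ereal \<mu> \<le> v (inv y \<otimes> s n)"
      using y(1) by (intro bexI [of _ y] allI)
  qed
  moreover have "val_finite_rank G p v"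
  proof -
    obtain gs where gs: "set gs = R"
      using reps(1) finite_list by blast
    have "\<exists>ks as :: nat list. length ks = length gs \<and> length as = length gs \<and>
        (\<forall>i<length gs. as ! i < p \<and> (as ! i = 0 \<or> v (gs ! i) + ereal (real (ks ! i)) = ereal \<mu>)) \<and>
        ereal \<mu> < v (inv g \<otimes> foldr (\<lambda>i acc. (gs ! i) [^] (as ! i * p ^ (ks ! i)) \<otimes> acc) [0..<length gs] \<one>)"
      if g: "g \<in> carrier G" "ereal \<mu> \<le> v g" for g \<mu>
    proof (cases "ereal \<mu> < v g")
      case True
      \<comment> \<open>Strictly above \<mu> the class of \<open>g\<close> in degree \<mu> is
        trivial, and zero coefficients represent it.\<close>
      define zs :: "nat list" where "zs = replicate (length gs) 0"
      have "foldr (\<lambda>i acc. (gs ! i) [^] (zs ! i * p ^ (zs ! i)) \<otimes> acc) [0..<length gs] \<one>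
          = foldr (\<lambda>i acc. \<one> \<otimes> acc) [0..<length gs] \<one>"
        by (rule foldr_cong) (auto simp: zs_def)
      also have "\<dots> = \<one>"
        using foldr_mult_single [of "[0..<length gs]" 0 "\<lambda>i. \<one>"] by simp
      finally have "ereal \<mu> < v (inv g \<otimes> foldr (\<lambda>i acc. (gs ! i) [^] (zs ! i * p ^ (zs ! i)) \<otimes> acc) [0..<length gs] \<one>)"
        using True g v_inv by simp
      then show ?thesis
        using p by (intro exI [of _ zs]) (auto simp: zs_def)
    next
      case False
      then have g_eq: "v g = ereal \<mu>"
        using g by simp
      then have g1: "g \<noteq> \<one>"
        using v_one by auto
      define k where "k = d g"
      have \<mu>: "\<mu> = 2 + real k"
        using g_eq v_eq [OF g1] by (simp add: k_def)
      have "g \<in> powers (p ^ k)"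
        using d_iff [OF g(1) g1] by (simp add: k_def)
      then obtain h where h: "h \<in> carrier G" "g = h [^] (p ^ k)"
        unfolding powers_def by blast
      obtain r where r: "r \<in> R" "inv r \<otimes> h \<in> powers p"
        using reps h by blast
      have rG: "r \<in> carrier G"
        using r reps by blast
      obtain j where j: "j < length gs" "gs ! j = r"
        using r gs by (metis in_set_conv_nth)
      \<comment> \<open>A single generator suffices: the coefficient is 1 at the position of
        \<open>r\<close> and 0 elsewhere, so the constant list \<open>ks\<close> matters at that
        position only.\<close>
      define as :: "nat list" where "as = (replicate (length gs) 0)[j := 1]"
      define ks :: "nat list" where "ks = replicate (length gs) k"
      have as: "as ! i = (if i = j then 1 else 0)" if "i < length gs" for i
        using that j by (simp add: as_def)
      have "foldr (\<lambda>i acc. (gs ! i) [^] (as ! i * p ^ (ks ! i)) \<otimes> acc) [0..<length gs] \<one>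
         = foldr (\<lambda>i acc. (if i = j then r [^] (p ^ k) else \<one>) \<otimes> acc) [0..<length gs] \<one>"
        using j by (intro foldr_cong) (auto simp: as ks_def)
      also have "\<dots> = r [^] (p ^ k)"
        using foldr_mult_single [of "[0..<length gs]" j "\<lambda>i. if i = j then r [^] (p ^ k) else \<one>"] j rG by simp
      finally have foldr: "foldr (\<lambda>i acc. (gs ! i) [^] (as ! i * p ^ (ks ! i)) \<otimes> acc) [0..<length gs] \<one> = r [^] (p ^ k)" .
      obtain z where z: "z \<in> carrier G" "inv r \<otimes> h = z [^] p"
        using r(2) unfolding powers_def by blast
      have "h = r \<otimes> z [^] p"
        using z h rG by (metis inv_mult_cancel(2))
      then have "g = r [^] (p ^ k) \<otimes> (z [^] p) [^] (p ^ k)"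
        using h z rG by (simp add: nat_pow_distrib)
      then have "inv g \<otimes> r [^] (p ^ k) = inv ((z [^] p) [^] (p ^ k))"
        using z rG by (simp add: inv_mult_group m_assoc)
      also have "\<dots> = inv (z [^] (p ^ Suc k))"
        using z by (simp add: nat_pow_pow)
      also have "\<dots> \<in> powers (p ^ Suc k)"
        using z by (intro powers_inv) (auto simp: powers_def)
      finally have mem: "inv g \<otimes> r [^] (p ^ k) \<in> powers (p ^ Suc k)" .
      have "inv g \<otimes> r [^] (p ^ k) \<in> carrier G"
        using g rG by simp
      then have "ereal (2 + real (Suc k)) \<le> v (inv g \<otimes> r [^] (p ^ k))"
        using v_iff mem by blast
      moreover have "ereal \<mu> < ereal (2 + real (Suc k))"
        by (simp add: \<mu>)
      ultimately have gt: "ereal \<mu> < v (inv g \<otimes> r [^] (p ^ k))"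
        by (rule less_le_trans [rotated])
      \<comment> \<open>Were \<open>r\<close> a p-th power, \<open>h\<close> would be one too, and
        \<open>g\<close> would be divisible more than \<open>k\<close> times. So \<open>r\<close>
        has the least value 2, and \<open>v r + k\<close> is exactly \<mu>.\<close>
      have "r \<notin> powers (p ^ 1)"
      proof
        assume "r \<in> powers (p ^ 1)"
        then have "r \<otimes> z [^] p \<in> powers p"
          using z by (intro powers_mult) (auto simp: powers_def)
        then obtain z' where "z' \<in> carrier G" "h = z' [^] p"
          using \<open>h = r \<otimes> z [^] p\<close> unfolding powers_def by blast
        then have "g \<in> powers (p ^ Suc k)"
          unfolding powers_def h(2) by (auto simp: nat_pow_pow)
        then have "Suc k \<le> d g"
          using d_iff [OF g(1) g1, of "Suc k"] by blast
        then show False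
          by (simp add: k_def)
      qed
      moreover from this have r1: "r \<noteq> \<one>"
        using one_in_powers by blast
      ultimately have "d r = 0"
        using d_iff [OF rG r1, of 1] by simp
      then have "v r + ereal (real k) = ereal \<mu>"
        using v_eq [OF r1] \<mu> by simp
      then show ?thesis
        using gt j p by (intro exI [of _ ks] exI [of _ as] conjI)
          (auto simp: foldr as, auto simp: as_def ks_def)
    qed
    then show ?thesis
      unfolding val_finite_rank_def using gs reps(2) by (intro exI [of _ gs]) blast
  qed
  ultimately show ?thesis
    unfolding p_valuable_def p_valued_complete_finite_rank_def
    using valuation is_group by blast
qed

end

section \<open>Torsion-free abelian sections of a valued group\<close>

lemma (in normal) FactGroup_subgroup_pow:
  assumes "subgroup S G" "H \<subseteq> S" "x \<in> S"
  shows "(H #> x) [^]\<^bsub>G\<lparr>carrier := S\<rparr> Mod H\<^esub> (n::nat) = H #> x [^] n"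
proof -
  interpret S: normal H "G\<lparr>carrier := S\<rparr>"
    using assms normal_axioms by (intro normal_restrict_supergroup)
  show ?thesis
    using S.FactGroup_pow [of x n] assms(3) nat_pow_consistent [of x n S] by simp
qed

context p_valued_group
begin

text \<open>The divisibility criterion is fed from \<open>G\<close>: representatives modulo p-th
  powers come from deep elements of \<open>H\<close> being p-th powers in \<open>H\<close>,
  separation from \<open>p ^ k\<close>-th powers becoming arbitrarily deep while \<open>N\<close> is
  closed, and completeness from lifting to convergent products in \<open>H\<close>.\<close>

lemma torsion_free_comm_quotient:
  assumes H: "subgroup H G" "adherence H \<subseteq> H"
    and N: "closed_normal_subgroup G p \<omega> N" "N \<subseteq> H"
    and gcomm: "\<And>x y. x \<in> H \<Longrightarrow> y \<in> H \<Longrightarrow> gcomm G x y \<in> N"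
    and tf: "\<And>x n. x \<in> H \<Longrightarrow> 0 < n \<Longrightarrow> x [^] (n::nat) \<in> N \<Longrightarrow> x \<in> N"
  shows "N \<lhd> G\<lparr>carrier := H\<rparr>" "comm_group (G\<lparr>carrier := H\<rparr> Mod N)"
    "torsion_free (G\<lparr>carrier := H\<rparr> Mod N)" "p_valuable (G\<lparr>carrier := H\<rparr> Mod N) p"
proof -
  interpret N: closed_normal_subgroup G p \<omega> N
    by (rule N)
  interpret H: subgroup H G
    by (rule H)
  define A where "A = G\<lparr>carrier := H\<rparr> Mod N"
  show N_H: "N \<lhd> G\<lparr>carrier := H\<rparr>"
    using H N N.normal_axioms by (intro normal_restrict_supergroup)
  interpret NH: normal N "G\<lparr>carrier := H\<rparr>"
    by (rule N_H)
  interpret A: group A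
    unfolding A_def by (rule NH.factorgroup_is_group)
  have HG: "x \<in> carrier G" if "x \<in> H" for x
    using that H.subset by auto
  have carrier_A: "carrier A = (\<lambda>x. N #> x) ` H"
    by (simp add: A_def carrier_FactGroup)
  have one_A: "\<one>\<^bsub>A\<^esub> = N"
    by (simp add: A_def)
  have mult_A: "(N #> x) \<otimes>\<^bsub>A\<^esub> (N #> y) = N #> (x \<otimes> y)" if "x \<in> H" "y \<in> H" for x y
    using that HG N.rcos_sum by (simp add: A_def set_mult_consistent [symmetric])
  have inv_A: "inv\<^bsub>A\<^esub> (N #> x) = N #> inv x" if "x \<in> H" for x
  proof (rule A.inv_equality)
    show "(N #> inv x) \<otimes>\<^bsub>A\<^esub> (N #> x) = \<one>\<^bsub>A\<^esub>"
      using that HG H.m_inv_closed N.subset by (simp add: mult_A one_A)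
  qed (use that H.m_inv_closed in \<open>auto simp: carrier_A\<close>)
  have pow_A: "(N #> x) [^]\<^bsub>A\<^esub> n = N #> x [^] n" if "x \<in> H" for x and n :: nat
    unfolding A_def using N.FactGroup_subgroup_pow [OF H(1) N(2) that] .
  have pow_H: "x [^] n \<in> H" if "x \<in> H" for x and n :: nat
    using that by (induction n) auto
  have eq_one: "N #> x = N \<longleftrightarrow> x \<in> N" if "x \<in> H" for x
    using that HG coset_join1 [of N x] N.rcos_const [OF is_group, of x] N.subset N.is_subgroup by blast
  have "comm_group A"
  proof (rule A.group_comm_groupI)
    fix C D assume "C \<in> carrier A" "D \<in> carrier A"
    then obtain x y where xy: "x \<in> H" "C = N #> x" "y \<in> H" "D = N #> y"
      by (auto simp: carrier_A)
    then have "N #> (x \<otimes> y) = N #> (y \<otimes> x)"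
      by (simp add: N.rcos_commute_iff HG gcomm)
    then show "C \<otimes>\<^bsub>A\<^esub> D = D \<otimes>\<^bsub>A\<^esub> C"
      using xy by (simp add: mult_A)
  qed
  then show "comm_group (G\<lparr>carrier := H\<rparr> Mod N)"
    by (simp add: A_def)
  interpret A: comm_group A
    by fact
  have tf_A: "C = \<one>\<^bsub>A\<^esub>" if C: "C \<in> carrier A" "0 < n" "C [^]\<^bsub>A\<^esub> n = \<one>\<^bsub>A\<^esub>" for C and n :: nat
  proof -
    obtain x where x: "x \<in> H" "C = N #> x"
      using C by (auto simp: carrier_A)
    then have "x [^] n \<in> N"
      using C(3) eq_one [OF pow_H] by (simp add: pow_A one_A)
    then show ?thesis
      using tf x C(2) eq_one by (simp add: one_A)
  qed
  then show "torsion_free (G\<lparr>carrier := H\<rparr> Mod N)"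
    unfolding torsion_free_def A_def by blast
  have powers_A: "C \<in> A.powers n \<longleftrightarrow> (\<exists>y\<in>H. C = N #> y [^] n)" for C n
    unfolding A.powers_def carrier_A using pow_A by (auto simp: image_iff)
  \<comment> \<open>Elements of \<open>H\<close> in the same coset of a deep \<open>level\<close>
    differ by a p-th power of an element of \<open>H\<close>, and there are finitely many such
    cosets.\<close>
  obtain R where R: "finite R" "R \<subseteq> carrier A" "\<And>C. C \<in> carrier A \<Longrightarrow> \<exists>D\<in>R. inv\<^bsub>A\<^esub> D \<otimes>\<^bsub>A\<^esub> C \<in> A.powers p"
  proof -
    obtain \<nu> :: real where \<nu>: "\<And>h. h \<in> H \<Longrightarrow> ereal \<nu> \<le> \<omega> h \<Longrightarrow> \<exists>x\<in>H. x [^] p = h"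
      using deep_elements_are_pth_powers [OF H] by blast
    interpret L: normal "level (ereal \<nu>)" G
      by (rule normal_level)
    let ?f = "\<lambda>x. level (ereal \<nu>) #> x"
    define R where "R = inv_into H ?f ` ?f ` H"
    have R_H: "R \<subseteq> H"
      unfolding R_def by (auto intro: inv_into_into)
    have "finite (?f ` H)"
      using finite_index_level H.subset by (meson finite_subset image_mono)
    then have "finite ((\<lambda>x. N #> x) ` R)"
      by (simp add: R_def)
    moreover have "(\<lambda>x. N #> x) ` R \<subseteq> carrier A"
      using R_H by (auto simp: carrier_A)
    moreover have "\<exists>D\<in>(\<lambda>x. N #> x) ` R. inv\<^bsub>A\<^esub> D \<otimes>\<^bsub>A\<^esub> C \<in> A.powers p" if C: "C \<in> carrier A" for C
    proof -
      obtain x where x: "x \<in> H" "C = N #> x"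
        using C by (auto simp: carrier_A)
      define r where "r = inv_into H ?f (?f x)"
      have r: "r \<in> R" "r \<in> H"
        using x R_H unfolding r_def R_def by blast+
      have "?f r = ?f x"
        unfolding r_def using x by (intro f_inv_into_f imageI)
      then have "inv r \<otimes> x \<in> level (ereal \<nu>)"
        using r x HG L.rcos_eq_iff by blast
      then have "ereal \<nu> \<le> \<omega> (inv r \<otimes> x)"
        by (simp add: level_def)
      moreover have irx: "inv r \<otimes> x \<in> H"
        using r x H.m_closed H.m_inv_closed by simp
      ultimately obtain z where z: "z \<in> H" "z [^] p = inv r \<otimes> x"
        using \<nu> by blast
      have "inv\<^bsub>A\<^esub> (N #> r) \<otimes>\<^bsub>A\<^esub> C = N #> (inv r \<otimes> x)"
        using r x by (simp add: inv_A mult_A H.m_inv_closed)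
      also have "\<dots> \<in> A.powers p"
        using z(1) unfolding powers_A z(2) [symmetric] by blast
      finally show "\<exists>D\<in>(\<lambda>x. N #> x) ` R. inv\<^bsub>A\<^esub> D \<otimes>\<^bsub>A\<^esub> C \<in> A.powers p"
        using r by blast
    qed
    ultimately show ?thesis
      by (rule that)
  qed
  have "p_valuable A p"
  proof (rule A.p_valuable_if_divisibility_complete [OF prime])
    show "C = \<one>\<^bsub>A\<^esub>" if "C \<in> carrier A" "C [^]\<^bsub>A\<^esub> p = \<one>\<^bsub>A\<^esub>" for C
      using tf_A that prime_gt_0_nat [OF prime] by blast
  next
    fix C assume C: "C \<in> carrier A" "\<And>k. C \<in> A.powers (p ^ k)"
    then obtain x where x: "x \<in> H" "C = N #> x"
      by (auto simp: carrier_A)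
    have "\<exists>a\<in>N. level (ereal \<mu>) #> x = level (ereal \<mu>) #> a" for \<mu> :: real
    proof -
      interpret L: normal "level (ereal \<mu>)" G
        by (rule normal_level)
      obtain k :: nat where k: "\<mu> \<le> real k"
        using real_arch_simple by blast
      obtain y where y: "y \<in> H" "N #> x = N #> y [^] (p ^ k)"
        using C(2) [of k] x by (auto simp: powers_A)
      define a where "a = inv (y [^] (p ^ k)) \<otimes> x"
      have "a \<in> N"
        using y(1) y(2) [symmetric] x HG N.rcos_eq_iff by (simp add: a_def)
      have "ereal \<mu> \<le> \<omega> y + ereal (real k)"
        using k v_pos [OF HG [OF y(1)]] by (cases "\<omega> y") auto
      also have "\<dots> \<le> \<omega> (y [^] (p ^ k))"
        using y HG by (intro v_pow_pow)
      finally have "y [^] (p ^ k) \<in> level (ereal \<mu>)"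
        using y HG by (simp add: level_def)
      then have "level (ereal \<mu>) #> y [^] (p ^ k) = level (ereal \<mu>) #> \<one>"
        using L.rcos_const [OF is_group] L.subset by simp
      then have "level (ereal \<mu>) #> (y [^] (p ^ k) \<otimes> a) = level (ereal \<mu>) #> (\<one> \<otimes> a)"
        by (rule L.rcos_mult_cong [OF _ refl]) (use y x HG in \<open>auto simp: a_def\<close>)
      then have "level (ereal \<mu>) #> x = level (ereal \<mu>) #> a"
        using y x HG by (simp add: a_def)
      then show ?thesis
        using \<open>a \<in> N\<close> by blast
    qed
    then have "x \<in> adherence N"
      using x HG by (simp add: adherence_iff [OF N.subset])
    then have "x \<in> N"
      using N.adherence_K by blast
    then show "C = \<one>\<^bsub>A\<^esub>"
      using x eq_one by (simp add: one_A)
  next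
    show "finite R"
      by (rule R)
    show "R \<subseteq> carrier A"
      by (rule R)
    show "\<exists>D\<in>R. inv\<^bsub>A\<^esub> D \<otimes>\<^bsub>A\<^esub> C \<in> A.powers p" if "C \<in> carrier A" for C
      using that by (rule R)
  next
    fix t :: "nat \<Rightarrow> 'a set"
    assume t: "\<And>k. t k \<in> carrier A" "\<And>k. inv\<^bsub>A\<^esub> t k \<otimes>\<^bsub>A\<^esub> t (Suc k) \<in> A.powers (p ^ k)"
    then have "\<forall>k. \<exists>y\<in>H. inv\<^bsub>A\<^esub> t k \<otimes>\<^bsub>A\<^esub> t (Suc k) = N #> y [^] (p ^ k)"
      by (simp add: powers_A)
    then obtain y where y: "\<And>k. y k \<in> H" "\<And>k. inv\<^bsub>A\<^esub> t k \<otimes>\<^bsub>A\<^esub> t (Suc k) = N #> y k [^] (p ^ k)"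
      by metis
    obtain x0 where x0: "x0 \<in> H" "t 0 = N #> x0"
      using t(1) [of 0] by (auto simp: carrier_A)
    \<comment> \<open>\<open>x\<close> lifts the sequence \<open>t\<close> to \<open>H\<close> by
      partial products of the factors \<open>y k [^] (p ^ k)\<close>, which become deep.
      \<open>z k\<close> is the tail from \<open>k\<close> on with the exponent \<open>p ^ k\<close>
      divided out, so that it converges as well.\<close>
    define x where "x = (\<lambda>n. x0 \<otimes> ordered_prod (\<lambda>k. y k [^] (p ^ k)) n)"
    define z where "z = (\<lambda>k. ordered_prod (\<lambda>j. y (k + j) [^] (p ^ j)))"
    have prod_H: "ordered_prod f n \<in> H" if "\<And>j. f j \<in> H" for f n
      using that by (induction n) auto
    have x_H: "x n \<in> H" and z_H: "z k n \<in> H" for n k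
      unfolding x_def z_def using x0 y pow_H prod_H by auto
    have yp_H: "y k [^] n \<in> H" for k and n :: nat
      using y pow_H by auto
    have x_Suc: "x (Suc n) = x n \<otimes> y n [^] (p ^ n)" for n
      unfolding x_def using x0 y HG by (simp add: m_assoc)
    have z_Suc: "z k (Suc n) = z k n \<otimes> y (k + n) [^] (p ^ n)" for k n
      by (simp add: z_def)
    have t_x: "t n = N #> x n" for n
    proof (induction n)
      case 0
      then show ?case
        using x0 HG by (simp add: x_def)
    next
      case (Suc n)
      have "t (Suc n) = t n \<otimes>\<^bsub>A\<^esub> (inv\<^bsub>A\<^esub> t n \<otimes>\<^bsub>A\<^esub> t (Suc n))"
        using t(1) A.inv_mult_cancel(2) by simp
      also have "\<dots> = (N #> x n) \<otimes>\<^bsub>A\<^esub> (N #> y n [^] (p ^ n))"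
        by (simp only: y(2)) (simp only: Suc.IH)
      also have "\<dots> = N #> x (Suc n)"
        using x_H yp_H by (simp add: mult_A x_Suc)
      finally show ?case .
    qed
    have y_level: "ereal \<mu> \<le> \<omega> (y k [^] (p ^ n))" if "\<mu> \<le> real n" for \<mu> k n
    proof -
      have "ereal \<mu> \<le> \<omega> (y k) + ereal (real n)"
        using that v_pos [OF HG [OF y(1)], of k] by (cases "\<omega> (y k)") auto
      also have "\<dots> \<le> \<omega> (y k [^] (p ^ n))"
        by (rule v_pow_pow [OF HG [OF y(1)]])
      finally show ?thesis .
    qed
    have "\<exists>M. \<forall>n\<ge>M. ereal \<mu> \<le> \<omega> (inv (x n) \<otimes> x (Suc n))" for \<mu>
    proof -
      obtain M :: nat where "\<mu> \<le> real M"
        using real_arch_simple by blast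
      then have "ereal \<mu> \<le> \<omega> (inv (x n) \<otimes> x (Suc n))" if "M \<le> n" for n
        using that y_level [of \<mu> n n] x_H yp_H HG by (simp add: x_Suc)
      then show ?thesis
        by blast
    qed
    from convergent_in_closed [OF H.subset H(2) x_H this]
    obtain u where u: "u \<in> H" "\<And>\<mu>::real. \<exists>M. \<forall>n\<ge>M. ereal \<mu> \<le> \<omega> (inv u \<otimes> x n)"
      by blast
    have "inv\<^bsub>A\<^esub> (N #> u) \<otimes>\<^bsub>A\<^esub> t k \<in> A.powers (p ^ k)" for k
    proof -
      have "\<exists>M. \<forall>n\<ge>M. ereal \<mu> \<le> \<omega> (inv (z k n) \<otimes> z k (Suc n))" for \<mu>
      proof -
        obtain M :: nat where "\<mu> \<le> real M"
          using real_arch_simple by blast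
        then have "ereal \<mu> \<le> \<omega> (inv (z k n) \<otimes> z k (Suc n))" if "M \<le> n" for n
          using that y_level [of \<mu> n "k + n"] z_H yp_H HG by (simp add: z_Suc)
        then show ?thesis
          by blast
      qed
      from convergent_in_closed [OF H.subset H(2) z_H this]
      obtain w where w: "w \<in> H" "\<And>\<mu>::real. \<exists>M. \<forall>n\<ge>M. ereal \<mu> \<le> \<omega> (inv w \<otimes> z k n)"
        by blast
      \<comment> \<open>Elements of \<open>H\<close> commute modulo \<open>N\<close>, so the common
        exponent \<open>p ^ k\<close> can be taken out of the tail one factor at a time.\<close>
      have xz: "N #> x (k + n) = N #> (x k \<otimes> z k n [^] (p ^ k))" for n
      proof (induction n)
        case 0
        then show ?case
          using x_H HG by (simp add: z_def)
      next
        case (Suc n)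
        define e where "e = y (k + n) [^] (p ^ n)"
        have e: "e \<in> H"
          by (simp add: e_def yp_H)
        have e_pow: "y (k + n) [^] (p ^ (k + n)) = e [^] (p ^ k)"
          using HG [OF y(1)] by (simp add: e_def nat_pow_pow power_add mult.commute)
        have "N #> z k (Suc n) [^] (p ^ k) = N #> (z k n [^] (p ^ k) \<otimes> e [^] (p ^ k))"
          unfolding z_Suc e_def [symmetric] using z_H e HG gcomm by (intro N.rcos_pow_mult) auto
        then have "N #> (x k \<otimes> z k (Suc n) [^] (p ^ k)) = N #> (x k \<otimes> (z k n [^] (p ^ k) \<otimes> e [^] (p ^ k)))"
          by (rule N.rcos_mult_cong [OF refl]) (use x_H z_H e HG in auto)
        also have "x k \<otimes> (z k n [^] (p ^ k) \<otimes> e [^] (p ^ k)) = (x k \<otimes> z k n [^] (p ^ k)) \<otimes> e [^] (p ^ k)"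
          using x_H z_H e HG by (simp add: m_assoc)
        also have "N #> \<dots> = N #> (x (k + n) \<otimes> e [^] (p ^ k))"
          by (rule N.rcos_mult_cong [OF Suc.IH [symmetric] refl]) (use x_H z_H e HG in auto)
        finally show ?case
          by (simp add: x_Suc e_pow)
      qed
      have uG: "u \<in> carrier G" and wG: "w \<in> carrier G"
        using u w HG by auto
      \<comment> \<open>\<open>q\<close> is the limit form of \<open>xz\<close>. Closedness of
        \<open>N\<close> carries the congruences to the limit, so \<open>u\<close> is congruent to
        \<open>x k \<otimes> w [^] (p ^ k)\<close>, and the quotient of \<open>u\<close> and
        \<open>x k\<close> becomes a \<open>p ^ k\<close>-th power modulo \<open>N\<close>.\<close>
      define q where "q = x k \<otimes> w [^] (p ^ k)"
      have qG: "q \<in> carrier G"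
        using x_H wG HG by (simp add: q_def)
      have "\<exists>a\<in>N. level (ereal \<mu>) #> (inv q \<otimes> u) = level (ereal \<mu>) #> a" for \<mu> :: real
      proof -
        interpret L: normal "level (ereal \<mu>)" G
          by (rule normal_level)
        obtain M1 where M1: "\<forall>n\<ge>M1. ereal \<mu> \<le> \<omega> (inv u \<otimes> x n)"
          using u(2) by blast
        obtain M2 where M2: "\<forall>n\<ge>M2. ereal \<mu> \<le> \<omega> (inv w \<otimes> z k n)"
          using w(2) by blast
        define n where "n = max M1 M2"
        have "inv u \<otimes> x (k + n) \<in> level (ereal \<mu>)" "inv w \<otimes> z k n \<in> level (ereal \<mu>)"
          using M1 M2 uG wG HG [OF x_H] HG [OF z_H] by (simp_all add: level_def n_def)
        then have eq: "level (ereal \<mu>) #> u = level (ereal \<mu>) #> x (k + n)" "level (ereal \<mu>) #> w = level (ereal \<mu>) #> z k n"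
          using uG wG HG [OF x_H] HG [OF z_H] by (simp_all add: L.rcos_eq_iff)
        define q' where "q' = x k \<otimes> z k n [^] (p ^ k)"
        have q'G: "q' \<in> carrier G"
          using HG [OF x_H] HG [OF z_H] by (simp add: q'_def)
        have "level (ereal \<mu>) #> w [^] (p ^ k) = level (ereal \<mu>) #> z k n [^] (p ^ k)"
          by (rule L.rcos_pow_cong [OF eq(2) wG HG [OF z_H]])
        then have "level (ereal \<mu>) #> q = level (ereal \<mu>) #> q'"
          unfolding q_def q'_def
          by (rule L.rcos_mult_cong [OF refl]) (use wG HG [OF x_H] HG [OF z_H] in auto)
        then have "level (ereal \<mu>) #> inv q = level (ereal \<mu>) #> inv q'"
          by (rule L.rcos_inv_cong [OF _ qG q'G])
        then have "level (ereal \<mu>) #> (inv q \<otimes> u) = level (ereal \<mu>) #> (inv q' \<otimes> x (k + n))"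
          by (rule L.rcos_mult_cong [OF _ eq(1)]) (use qG q'G uG HG [OF x_H] in auto)
        moreover have "inv q' \<otimes> x (k + n) \<in> N"
          using xz [of n] q'G HG [OF x_H] N.rcos_eq_iff [of q' "x (k + n)"] by (simp add: q'_def)
        ultimately show ?thesis
          by blast
      qed
      then have "inv q \<otimes> u \<in> adherence N"
        using qG uG by (simp add: adherence_iff [OF N.subset])
      then have "inv q \<otimes> u \<in> N"
        using N.adherence_K by blast
      then have "N #> q = N #> u"
        using N.rcos_eq_iff [OF qG uG] by simp
      then have "N #> inv u = N #> inv q"
        using N.rcos_inv_cong [OF _ qG uG] by simp
      then have "N #> (inv u \<otimes> x k) = N #> (inv q \<otimes> x k)"
        by (rule N.rcos_mult_cong [OF _ refl]) (use uG qG HG [OF x_H] in auto)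
      also have "inv q \<otimes> x k = (inv w) [^] (p ^ k)"
        using wG HG [OF x_H] by (simp add: q_def inv_mult_group m_assoc nat_pow_inv)
      finally have "inv\<^bsub>A\<^esub> (N #> u) \<otimes>\<^bsub>A\<^esub> t k = N #> (inv w) [^] (p ^ k)"
        using u x_H H.m_inv_closed by (simp add: t_x inv_A mult_A)
      then show ?thesis
        using w(1) H.m_inv_closed by (auto simp: powers_A)
    qed
    then show "\<exists>U\<in>carrier A. \<forall>k. inv\<^bsub>A\<^esub> U \<otimes>\<^bsub>A\<^esub> t k \<in> A.powers (p ^ k)"
      using u(1) by (intro bexI [of _ "N #> u"]) (auto simp: carrier_A)
  qed
  then show "p_valuable (G\<lparr>carrier := H\<rparr> Mod N) p"
    by (simp add: A_def)
qed

end

section \<open>Central and derived series\<close>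

context group
begin

text \<open>The hypotheses say that \<open>b\<close> and \<open>g\<close> move \<open>x\<close> by factors \<open>c\<close> and \<open>e\<close> such that \<open>b g\<close> and
  \<open>g b\<close> conjugate \<open>x\<close> to the same element; this replaces the Hall--Witt identity.\<close>
lemma gcomm_commutes_conj:
  assumes carrier: "b \<in> carrier G" "g \<in> carrier G" "x \<in> carrier G"
    and c: "c \<in> carrier G" "b \<otimes> x = c \<otimes> x \<otimes> b" "c \<otimes> g = g \<otimes> c"
    and e: "e \<in> carrier G" "g \<otimes> x = e \<otimes> x \<otimes> g" "e \<otimes> b = b \<otimes> e"
    and ce: "c \<otimes> e = e \<otimes> c"
  defines "y \<equiv> g \<otimes> b \<otimes> x \<otimes> inv (g \<otimes> b)"
  shows "gcomm G b g \<otimes> y = y \<otimes> gcomm G b g"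
proof -
  have "b \<otimes> g \<otimes> x = b \<otimes> e \<otimes> x \<otimes> g"
    using carrier e by (simp add: m_assoc)
  also have "\<dots> = e \<otimes> (b \<otimes> x) \<otimes> g"
    using carrier e(1) e(3) [symmetric] by (simp add: m_assoc)
  also have "\<dots> = e \<otimes> c \<otimes> x \<otimes> b \<otimes> g"
    using carrier c(1,2) e(1) by (simp add: m_assoc)
  finally have 1: "b \<otimes> g \<otimes> x = e \<otimes> c \<otimes> x \<otimes> (b \<otimes> g)"
    using carrier c(1) e(1) by (simp add: m_assoc)
  have "g \<otimes> b \<otimes> x = g \<otimes> c \<otimes> x \<otimes> b"
    using carrier c by (simp add: m_assoc)
  also have "\<dots> = c \<otimes> (g \<otimes> x) \<otimes> b"
    using carrier c(1) c(3) [symmetric] by (simp add: m_assoc)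
  also have "\<dots> = c \<otimes> e \<otimes> x \<otimes> g \<otimes> b"
    using carrier c(1) e(1,2) by (simp add: m_assoc)
  finally have 2: "g \<otimes> b \<otimes> x = e \<otimes> c \<otimes> x \<otimes> (g \<otimes> b)"
    unfolding ce using carrier c(1) e(1) by (simp add: m_assoc)
  have y: "y = e \<otimes> c \<otimes> x"
    unfolding y_def 2 using carrier c(1) e(1) by (simp add: m_assoc)
  have comm: "gcomm G b g = (b \<otimes> g) \<otimes> inv (g \<otimes> b)"
    using carrier by (simp add: gcomm_def inv_mult_group m_assoc)
  have "gcomm G b g \<otimes> y = (b \<otimes> g) \<otimes> (inv (g \<otimes> b) \<otimes> (g \<otimes> b)) \<otimes> x \<otimes> inv (g \<otimes> b)"
    unfolding comm y_def using carrier by (simp only: m_assoc m_closed inv_closed)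
  also have "\<dots> = (b \<otimes> g \<otimes> x) \<otimes> inv (g \<otimes> b)"
    using carrier by (simp add: m_assoc)
  also have "\<dots> = y \<otimes> gcomm G b g"
    unfolding 1 y comm using carrier c(1) e(1) by (simp add: m_assoc)
  finally show ?thesis .
qed

lemma comm_subgroup_subset:
  assumes "subgroup N G" "\<And>h k. h \<in> H \<Longrightarrow> k \<in> K \<Longrightarrow> gcomm G h k \<in> N"
  shows "comm_subgroup G H K \<subseteq> N"
  unfolding comm_subgroup_def using assms by (intro generate_subgroup_incl) auto

lemma gcomm_in_comm_subgroup: "h \<in> H \<Longrightarrow> k \<in> K \<Longrightarrow> gcomm G h k \<in> comm_subgroup G H K"
  unfolding comm_subgroup_def by (intro generate.incl) blast

lemma gcomm_conj:
  assumes "x \<in> carrier G" "y \<in> carrier G" "g \<in> carrier G"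
  shows "g \<otimes> gcomm G x y \<otimes> inv g = gcomm G (g \<otimes> x \<otimes> inv g) (g \<otimes> y \<otimes> inv g)"
  using assms by (simp add: gcomm_def inv_mult_group m_assoc)

lemma normal_comm_subgroup:
  assumes H: "H \<lhd> G" and K: "K \<lhd> G"
  shows "comm_subgroup G H K \<lhd> G"
proof -
  interpret H: normal H G
    by (rule H)
  interpret K: normal K G
    by (rule K)
  have carrier: "h \<in> H \<Longrightarrow> h \<in> carrier G" "k \<in> K \<Longrightarrow> k \<in> carrier G" for h k
    using H.subset K.subset by auto
  show ?thesis
    unfolding comm_subgroup_def
  proof (rule normal_generateI)
    show "{gcomm G h k |h k. h \<in> H \<and> k \<in> K} \<subseteq> carrier G"
      using carrier by auto
    fix z g assume "z \<in> {gcomm G h k |h k. h \<in> H \<and> k \<in> K}" and g: "g \<in> carrier G"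
    then obtain h k where hk: "z = gcomm G h k" "h \<in> H" "k \<in> K"
      by blast
    then have "g \<otimes> z \<otimes> inv g = gcomm G (g \<otimes> h \<otimes> inv g) (g \<otimes> k \<otimes> inv g)"
      using g carrier gcomm_conj by simp
    moreover have "g \<otimes> h \<otimes> inv g \<in> H" "g \<otimes> k \<otimes> inv g \<in> K"
      using hk g H.inv_op_closed2 K.inv_op_closed2 by simp_all
    ultimately show "g \<otimes> z \<otimes> inv g \<in> {gcomm G h k |h k. h \<in> H \<and> k \<in> K}"
      by blast
  qed
qed

lemma normal_carrier: "carrier G \<lhd> G"
  unfolding normal_inv_iff using subgroup_self by simp

lemma lower_central_Suc: "1 \<le> i \<Longrightarrow> lower_central G (Suc i) = comm_subgroup G (lower_central G i) (carrier G)"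
  by (cases i) simp_all

lemma normal_lower_central: "lower_central G i \<lhd> G"
proof (induction i)
  case (Suc i)
  then show ?case
    by (cases "i = 0") (simp_all add: lower_central_Suc normal_carrier normal_comm_subgroup)
qed (simp add: normal_carrier)

lemma lower_central_Suc_subset: "lower_central G (Suc i) \<subseteq> lower_central G i"
proof (cases "i = 0")
  case False
  interpret N: normal "lower_central G i" G
    by (rule normal_lower_central)
  show ?thesis
    using False N.gcomm_mem N.subset
    by (simp add: lower_central_Suc) (intro comm_subgroup_subset N.is_subgroup N.gcomm_mem; blast)
qed simp

end

lemma (in normal) rcos_gcomm:
  assumes "x \<in> carrier G" "y \<in> carrier G"
  shows "gcomm (G Mod H) (H #> x) (H #> y) = H #> gcomm G x y"
proof -
  interpret Q: group "G Mod H"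
    by (rule factorgroup_is_group)
  interpret hom: group_hom G "G Mod H" "\<lambda>x. H #> x"
    by (intro group_hom.intro group_hom_axioms.intro is_group Q.is_group r_coset_hom_Mod)
  show ?thesis
    using assms by (simp add: gcomm_def)
qed

lemma (in normal) gcomm_sym:
  assumes "x \<in> carrier G" "y \<in> carrier G" "gcomm G x y \<in> H"
  shows "gcomm G y x \<in> H"
  using assms rcos_commute_iff by metis

context group
begin

text \<open>The preimage of the centralizer of the image of \<open>A\<close> in
  \<open>G / N\<close>. Being a subgroup, it contains a whole \<open>comm_subgroup\<close> once it
  contains the generating commutators.\<close>

lemma centralizer_mod_subgroup:
  assumes N: "N \<lhd> G" and A: "A \<subseteq> carrier G"
  shows "subgroup {z \<in> carrier G. \<forall>a\<in>A. gcomm G z a \<in> N} G"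
proof -
  interpret N: normal N G
    by (rule N)
  have iff: "gcomm G z a \<in> N \<longleftrightarrow> N #> (z \<otimes> a) = N #> (a \<otimes> z)" if "z \<in> carrier G" "a \<in> A" for z a
    using that A N.rcos_commute_iff by blast
  have A': "a \<in> carrier G" if "a \<in> A" for a
    using that A by auto
  show ?thesis
  proof (rule subgroupI)
    have "gcomm G \<one> a \<in> N" if "a \<in> A" for a
      using that A' by (simp add: gcomm_def)
    then show "{z \<in> carrier G. \<forall>a\<in>A. gcomm G z a \<in> N} \<noteq> {}"
      by blast
    fix z assume "z \<in> {z \<in> carrier G. \<forall>a\<in>A. gcomm G z a \<in> N}"
    then have z: "z \<in> carrier G" "\<And>a. a \<in> A \<Longrightarrow> N #> (z \<otimes> a) = N #> (a \<otimes> z)"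
      using iff by auto
    have "N #> (inv z \<otimes> a) = N #> (a \<otimes> inv z)" if "a \<in> A" for a
    proof -
      have "N #> (z \<otimes> a \<otimes> inv z) = N #> (a \<otimes> z \<otimes> inv z)"
        by (rule N.rcos_mult_cong [OF z(2) refl]) (use that z A' in auto)
      then have "N #> (inv z \<otimes> (z \<otimes> a \<otimes> inv z)) = N #> (inv z \<otimes> (a \<otimes> z \<otimes> inv z))"
        by (rule N.rcos_mult_cong [OF refl]) (use that z A' in auto)
      then show ?thesis
        using that z A' by (simp add: m_assoc)
    qed
    then show "inv z \<in> {z \<in> carrier G. \<forall>a\<in>A. gcomm G z a \<in> N}"
      using z(1) iff by simp
    fix w assume "w \<in> {z \<in> carrier G. \<forall>a\<in>A. gcomm G z a \<in> N}"
    then have w: "w \<in> carrier G" "\<And>a. a \<in> A \<Longrightarrow> N #> (w \<otimes> a) = N #> (a \<otimes> w)"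
      using iff by auto
    have "N #> (z \<otimes> w \<otimes> a) = N #> (a \<otimes> (z \<otimes> w))" if "a \<in> A" for a
    proof -
      have "N #> (z \<otimes> (w \<otimes> a)) = N #> (z \<otimes> (a \<otimes> w))"
        by (rule N.rcos_mult_cong [OF refl w(2)]) (use that z w A' in auto)
      moreover have "N #> ((z \<otimes> a) \<otimes> w) = N #> ((a \<otimes> z) \<otimes> w)"
        by (rule N.rcos_mult_cong [OF z(2) refl]) (use that z w A' in auto)
      ultimately show ?thesis
        using that z w A' by (simp add: m_assoc)
    qed
    then show "z \<otimes> w \<in> {z \<in> carrier G. \<forall>a\<in>A. gcomm G z a \<in> N}"
      using z(1) w(1) iff by simp
  qed blast
qed

text \<open>Modulo \<open>lower_central G (i + Suc j)\<close> the commutator \<open>c\<close> of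
  \<open>b\<close> and \<open>x\<close> is central, by the induction hypothesis at \<open>i\<close>,
  and the commutator \<open>e\<close> of \<open>g\<close> and \<open>x\<close> commutes with
  \<open>b\<close>, by the hypothesis at \<open>Suc i\<close>; hence \<open>i\<close> stays
  arbitrary in the induction on \<open>j\<close>. These are the commutation relations that
  \<open>gcomm_commutes_conj\<close> needs.\<close>

lemma gcomm_lower_central:
  assumes "1 \<le> i" "1 \<le> j" "a \<in> lower_central G i" "b \<in> lower_central G j"
  shows "gcomm G b a \<in> lower_central G (i + j)"
  using assms(2,1,3,4)
proof (induction j arbitrary: i a b rule: dec_induct)
  case base
  interpret N: normal "lower_central G (Suc i)" G
    by (rule normal_lower_central)
  have "a \<in> carrier G" "b \<in> carrier G"
    using base normal.axioms(1) [OF normal_lower_central] subgroup.subset by blast+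
  moreover have "gcomm G a b \<in> lower_central G (Suc i)"
    using base \<open>b \<in> carrier G\<close> by (simp add: lower_central_Suc gcomm_in_comm_subgroup)
  ultimately show ?case
    using N.gcomm_sym by simp
next
  case (step j)
  define N where "N = lower_central G (i + Suc j)"
  interpret N: normal N G
    unfolding N_def by (rule normal_lower_central)
  interpret A: normal "lower_central G i" G
    by (rule normal_lower_central)
  interpret B: normal "lower_central G j" G
    by (rule normal_lower_central)
  interpret Q: group "G Mod N"
    by (rule N.factorgroup_is_group)
  have carrier: "a \<in> carrier G" if "a \<in> lower_central G k" for a k
    using that normal.axioms(1) [OF normal_lower_central] subgroup.subset by blast
  have i1: "1 \<le> Suc i"
    by simp
  have key: "gcomm G (gcomm G b g) a \<in> N"
    if a: "a \<in> lower_central G i" and b: "b \<in> lower_central G j" and g: "g \<in> carrier G" for a b g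
  proof -
    have aG: "a \<in> carrier G" and bG: "b \<in> carrier G"
      using a b carrier by auto
    \<comment> \<open>Chosen so that the conjugate of \<open>x\<close> by
      \<open>g \<otimes> b\<close>, the element \<open>y\<close> of
      \<open>gcomm_commutes_conj\<close>, is \<open>a\<close>.\<close>
    define x where "x = inv (g \<otimes> b) \<otimes> a \<otimes> (g \<otimes> b)"
    have xA: "x \<in> lower_central G i"
      unfolding x_def using a g bG by (intro A.inv_op_closed1) auto
    have xG: "x \<in> carrier G"
      using xA carrier by auto
    define c where "c = gcomm G b x"
    define e where "e = gcomm G g x"
    have c: "c \<in> lower_central G (i + j)"
      unfolding c_def using step.IH [OF step.prems(1) xA b] .
    have "gcomm G x g \<in> lower_central G (Suc i)"
      using xA g step.prems(1) by (simp add: lower_central_Suc gcomm_in_comm_subgroup)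
    then have e: "e \<in> lower_central G (Suc i)"
      unfolding e_def using normal.gcomm_sym [OF normal_lower_central xG g] by blast
    have cG: "c \<in> carrier G" and eG: "e \<in> carrier G"
      using c e carrier by auto
    have "1 \<le> i + j"
      using step.prems(1) by simp
    then have c_central: "gcomm G c h \<in> N" if "h \<in> carrier G" for h
      unfolding N_def using c that by (simp add: lower_central_Suc gcomm_in_comm_subgroup)
    have "gcomm G b e \<in> lower_central G (Suc i + j)"
      using step.IH [OF i1 e b] .
    then have eb: "gcomm G e b \<in> N"
      using N.gcomm_sym [OF bG eG] by (simp add: N_def)
    have comm_Q: "(N #> u) \<otimes>\<^bsub>G Mod N\<^esub> (N #> w) = (N #> w) \<otimes>\<^bsub>G Mod N\<^esub> (N #> u)"
      if "gcomm G u w \<in> N" "u \<in> carrier G" "w \<in> carrier G" for u w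
      using that N.rcos_commute_iff by (simp add: N.rcos_sum)
    have Q: "N #> u \<in> carrier (G Mod N)" if "u \<in> carrier G" for u
      using that by (auto simp: carrier_FactGroup)
    have bx: "b \<otimes> x = c \<otimes> x \<otimes> b" and gx: "g \<otimes> x = e \<otimes> x \<otimes> g"
      using bG xG g by (simp_all add: c_def e_def gcomm_def m_assoc)
    have conj: "g \<otimes> b \<otimes> x \<otimes> inv (g \<otimes> b) = a"
      using aG bG g by (simp add: x_def m_assoc inv_mult_group)
    have "N #> a = (N #> g) \<otimes>\<^bsub>G Mod N\<^esub> (N #> b) \<otimes>\<^bsub>G Mod N\<^esub> (N #> x) \<otimes>\<^bsub>G Mod N\<^esub>
        inv\<^bsub>G Mod N\<^esub> ((N #> g) \<otimes>\<^bsub>G Mod N\<^esub> (N #> b))"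
    proof (rule Q.inv_solve_right [THEN iffD2])
      have "N #> (a \<otimes> (g \<otimes> b)) = N #> (g \<otimes> b \<otimes> x)"
        using aG bG g by (simp add: x_def m_assoc inv_mult_group)
      then show "(N #> g) \<otimes>\<^bsub>G Mod N\<^esub> (N #> b) \<otimes>\<^bsub>G Mod N\<^esub> (N #> x)
          = (N #> a) \<otimes>\<^bsub>G Mod N\<^esub> ((N #> g) \<otimes>\<^bsub>G Mod N\<^esub> (N #> b))"
        using aG bG g xG by (simp add: N.rcos_sum)
    qed (use aG bG g xG Q in \<open>auto simp: N.rcos_sum\<close>)
    moreover have "gcomm (G Mod N) (N #> b) (N #> g) \<otimes>\<^bsub>G Mod N\<^esub> ((N #> g) \<otimes>\<^bsub>G Mod N\<^esub> (N #> b) \<otimes>\<^bsub>G Mod N\<^esub> (N #> x) \<otimes>\<^bsub>G Mod N\<^esub>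
        inv\<^bsub>G Mod N\<^esub> ((N #> g) \<otimes>\<^bsub>G Mod N\<^esub> (N #> b))) =
      ((N #> g) \<otimes>\<^bsub>G Mod N\<^esub> (N #> b) \<otimes>\<^bsub>G Mod N\<^esub> (N #> x) \<otimes>\<^bsub>G Mod N\<^esub>
        inv\<^bsub>G Mod N\<^esub> ((N #> g) \<otimes>\<^bsub>G Mod N\<^esub> (N #> b))) \<otimes>\<^bsub>G Mod N\<^esub> gcomm (G Mod N) (N #> b) (N #> g)"
    proof (rule Q.gcomm_commutes_conj)
      show "(N #> b) \<otimes>\<^bsub>G Mod N\<^esub> (N #> x) = (N #> c) \<otimes>\<^bsub>G Mod N\<^esub> (N #> x) \<otimes>\<^bsub>G Mod N\<^esub> (N #> b)"
        using bG cG xG bx by (simp add: N.rcos_sum)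
      show "(N #> g) \<otimes>\<^bsub>G Mod N\<^esub> (N #> x) = (N #> e) \<otimes>\<^bsub>G Mod N\<^esub> (N #> x) \<otimes>\<^bsub>G Mod N\<^esub> (N #> g)"
        using g eG xG gx by (simp add: N.rcos_sum)
      show "(N #> c) \<otimes>\<^bsub>G Mod N\<^esub> (N #> g) = (N #> g) \<otimes>\<^bsub>G Mod N\<^esub> (N #> c)"
        by (rule comm_Q [OF c_central [OF g] cG g])
      show "(N #> e) \<otimes>\<^bsub>G Mod N\<^esub> (N #> b) = (N #> b) \<otimes>\<^bsub>G Mod N\<^esub> (N #> e)"
        by (rule comm_Q [OF eb eG bG])
      show "(N #> c) \<otimes>\<^bsub>G Mod N\<^esub> (N #> e) = (N #> e) \<otimes>\<^bsub>G Mod N\<^esub> (N #> c)"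
        by (rule comm_Q [OF c_central [OF eG] cG eG])
    qed (use bG g xG cG eG Q in auto)
    ultimately have "(N #> gcomm G b g) \<otimes>\<^bsub>G Mod N\<^esub> (N #> a) = (N #> a) \<otimes>\<^bsub>G Mod N\<^esub> (N #> gcomm G b g)"
      unfolding N.rcos_gcomm [OF bG g] by simp
    then have "N #> (gcomm G b g \<otimes> a) = N #> (a \<otimes> gcomm G b g)"
      using bG g aG by (simp add: N.rcos_sum)
    then show ?thesis
      using bG g aG N.rcos_commute_iff by simp
  qed
  have "lower_central G (Suc j) \<subseteq> {z \<in> carrier G. \<forall>a\<in>lower_central G i. gcomm G z a \<in> N}"
    unfolding lower_central_Suc [OF step.hyps(1)]
  proof (rule comm_subgroup_subset)
    show "subgroup {z \<in> carrier G. \<forall>a\<in>lower_central G i. gcomm G z a \<in> N} G"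
      by (rule centralizer_mod_subgroup [OF N.normal_axioms A.subset])
    show "gcomm G h k \<in> {z \<in> carrier G. \<forall>a\<in>lower_central G i. gcomm G z a \<in> N}"
      if "h \<in> lower_central G j" "k \<in> carrier G" for h k
      using that key carrier [OF that(1)] by simp
  qed
  then show ?case
    using step.prems(2,3) unfolding N_def by blast
qed

lemma normal_derived_series: "derived_series G i \<lhd> G"
  by (induction i) (simp_all add: normal_carrier derived_is_normal)

lemma gcomm_derived:
  assumes "x \<in> H" "y \<in> H"
  shows "gcomm G x y \<in> derived G H"
  unfolding derived_def gcomm_def using assms by (intro generate.incl) blast

lemma derived_series_Suc_subset: "derived_series G (Suc i) \<subseteq> derived_series G i"
  using derived_incl [OF order_refl] normal_imp_subgroup [OF normal_derived_series] by simp

end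

section \<open>Invariance under automorphisms\<close>

lemma image_comm_subgroup:
  assumes "group_hom G H f" "A \<subseteq> carrier G" "B \<subseteq> carrier G"
  shows "f ` comm_subgroup G A B = comm_subgroup H (f ` A) (f ` B)"
proof -
  interpret group_hom G H f
    by (rule assms)
  have gcomm: "f (gcomm G a b) = gcomm H (f a) (f b)" if "a \<in> A" "b \<in> B" for a b
    using that assms(2,3) by (auto simp: gcomm_def subset_iff)
  have "f ` {gcomm G a b | a b. a \<in> A \<and> b \<in> B} = {gcomm H a b | a b. a \<in> f ` A \<and> b \<in> f ` B}"
    using gcomm by (auto 0 4 simp: image_iff)
  moreover have "{gcomm G a b | a b. a \<in> A \<and> b \<in> B} \<subseteq> carrier G"
    using assms(2,3) by auto
  then have "generate H (f ` {gcomm G a b | a b. a \<in> A \<and> b \<in> B}) = f ` generate G {gcomm G a b | a b. a \<in> A \<and> b \<in> B}"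
    by (rule generate_img)
  ultimately show ?thesis
    unfolding comm_subgroup_def by simp
qed

lemma (in group) auto_image:
  assumes "\<phi> \<in> auto G"
  shows "group_hom G G \<phi>" "bij_betw \<phi> (carrier G) (carrier G)"
    "\<phi> ` lower_central G i = lower_central G i" "\<phi> ` derived_series G i = derived_series G i"
proof -
  show hom: "group_hom G G \<phi>"
    using assms is_group by (auto simp: auto_def group_hom_def group_hom_axioms_def)
  show bij: "bij_betw \<phi> (carrier G) (carrier G)"
    using assms by (auto simp: auto_def Bij_def)
  interpret group_hom G G \<phi>
    by (rule hom)
  have carrier: "\<phi> ` carrier G = carrier G"
    using bij by (rule bij_betw_imp_surj_on)
  show "\<phi> ` lower_central G i = lower_central G i"
  proof (induction i)
    case (Suc i)
    show ?case
    proof (cases "i = 0")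
      case False
      have "\<phi> ` comm_subgroup G (lower_central G i) (carrier G)
          = comm_subgroup G (\<phi> ` lower_central G i) (\<phi> ` carrier G)"
        by (rule image_comm_subgroup [OF hom subgroup.subset [OF normal_imp_subgroup [OF normal_lower_central]] order_refl])
      then show ?thesis
        using False Suc.IH carrier by (simp add: lower_central_Suc)
    qed (use carrier in simp)
  qed (use carrier in simp)
  show "\<phi> ` derived_series G i = derived_series G i"
  proof (induction i)
    case (Suc i)
    have "\<phi> ` derived G (derived_series G i) = derived G (\<phi> ` derived_series G i)"
      by (rule derived_img [OF exp_of_derived_in_carrier [OF order_refl], symmetric])
    then show ?case
      using Suc by simp
  qed (use carrier in simp)
qed

context p_valued_group
begin

text \<open>\<open>p ^ n\<close>-th powers become arbitrarily deep, and deep elements are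
  \<open>p ^ n\<close>-th powers, so the closure is expressed by group operations alone. Abstract
  automorphisms therefore respect it, with no continuity assumed.\<close>

lemma adherence_iff_powers:
  "x \<in> adherence A \<longleftrightarrow> x \<in> carrier G \<and> (\<forall>n. \<exists>a\<in>A. \<exists>y\<in>carrier G. inv x \<otimes> a = y [^] (p ^ n))"
  if A: "A \<subseteq> carrier G"
proof -
  have "(\<forall>\<mu>::real. \<exists>a\<in>A. ereal \<mu> \<le> \<omega> (inv x \<otimes> a)) \<longleftrightarrow> (\<forall>n. \<exists>a\<in>A. \<exists>y\<in>carrier G. inv x \<otimes> a = y [^] (p ^ n))"
    if x: "x \<in> carrier G"
  proof (intro iffI allI)
    fix n :: nat assume *: "\<forall>\<mu>::real. \<exists>a\<in>A. ereal \<mu> \<le> \<omega> (inv x \<otimes> a)"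
    obtain \<mu> :: real where \<mu>: "\<forall>h\<in>carrier G. ereal \<mu> \<le> \<omega> h \<longrightarrow> (\<exists>y\<in>carrier G. y [^] (p ^ n) = h)"
      using deep_elements_are_powers by blast
    obtain a where a: "a \<in> A" "ereal \<mu> \<le> \<omega> (inv x \<otimes> a)"
      using * by blast
    then have "inv x \<otimes> a \<in> carrier G"
      using x A by auto
    then show "\<exists>a\<in>A. \<exists>y\<in>carrier G. inv x \<otimes> a = y [^] (p ^ n)"
      using \<mu> a by metis
  next
    fix \<mu> :: real assume *: "\<forall>n. \<exists>a\<in>A. \<exists>y\<in>carrier G. inv x \<otimes> a = y [^] (p ^ n)"
    obtain n :: nat where n: "\<mu> \<le> real n"
      using real_arch_simple by blast
    obtain a y where a: "a \<in> A" "y \<in> carrier G" "inv x \<otimes> a = y [^] (p ^ n)"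
      using * by blast
    have "ereal \<mu> \<le> \<omega> y + ereal (real n)"
      using n v_pos [OF a(2)] by (cases "\<omega> y") auto
    also have "\<dots> \<le> \<omega> (y [^] (p ^ n))"
      by (rule v_pow_pow [OF a(2)])
    finally show "\<exists>a\<in>A. ereal \<mu> \<le> \<omega> (inv x \<otimes> a)"
      unfolding a(3) [symmetric] using a(1) by blast
  qed
  then show ?thesis
    unfolding adherence_def by blast
qed

lemma auto_image_adherence:
  assumes "\<phi> \<in> auto G" and A: "A \<subseteq> carrier G" "\<phi> ` A = A"
  shows "\<phi> ` adherence A = adherence A"
proof -
  interpret \<phi>: group_hom G G \<phi>
    using assms by (intro auto_image)
  have bij: "bij_betw \<phi> (carrier G) (carrier G)"
    using assms by (intro auto_image)
  have A': "a \<in> carrier G" if "a \<in> A" for a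
    using that A by auto
  have iff: "\<phi> x \<in> adherence A \<longleftrightarrow> x \<in> adherence A" if x: "x \<in> carrier G" for x
  proof -
    have eq: "inv (\<phi> x) \<otimes> \<phi> a = \<phi> y [^] n \<longleftrightarrow> inv x \<otimes> a = y [^] n" if "a \<in> A" "y \<in> carrier G" for a y and n :: nat
    proof -
      have "inv (\<phi> x) \<otimes> \<phi> a = \<phi> (inv x \<otimes> a)" "\<phi> y [^] n = \<phi> (y [^] n)"
        using that x A' by (simp_all add: \<phi>.hom_nat_pow)
      moreover have "inv x \<otimes> a \<in> carrier G" "y [^] n \<in> carrier G"
        using that x A' by simp_all
      ultimately show ?thesis
        using bij unfolding bij_betw_def inj_on_def by metis
    qed
    have "(\<exists>a\<in>A. \<exists>y\<in>carrier G. inv (\<phi> x) \<otimes> a = y [^] n) \<longleftrightarrow> (\<exists>a\<in>\<phi> ` A. \<exists>y\<in>\<phi> ` carrier G. inv (\<phi> x) \<otimes> a = y [^] n)" for n :: nat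
      using A(2) bij_betw_imp_surj_on [OF bij] by simp
    also have "\<dots> n \<longleftrightarrow> (\<exists>a\<in>A. \<exists>y\<in>carrier G. inv x \<otimes> a = y [^] n)" for n :: nat
      using eq by simp
    finally show ?thesis
      using x by (simp add: adherence_iff_powers [OF A(1)])
  qed
  have surj: "\<phi> ` carrier G = carrier G"
    using bij by (rule bij_betw_imp_surj_on)
  show ?thesis
  proof
    show "\<phi> ` adherence A \<subseteq> adherence A"
      using iff adherence_subset_carrier by blast
    show "adherence A \<subseteq> \<phi> ` adherence A"
    proof
      fix z assume z: "z \<in> adherence A"
      then obtain x where "x \<in> carrier G" "z = \<phi> x"
        using surj adherence_subset_carrier by blast
      then show "z \<in> \<phi> ` adherence A"
        using z iff by blast
    qed
  qed
qed

lemma auto_image_isol: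
  assumes "\<phi> \<in> auto G" and K: "K \<subseteq> carrier G" "\<phi> ` K = K"
  shows "\<phi> ` isol K = isol K"
proof -
  interpret \<phi>: group_hom G G \<phi>
    using assms by (intro auto_image)
  have bij: "bij_betw \<phi> (carrier G) (carrier G)"
    using assms by (intro auto_image)
  have "\<phi> y \<in> K \<longleftrightarrow> y \<in> K" if "y \<in> carrier G" for y
    using that K bij unfolding bij_betw_def inj_on_def by (metis image_iff subsetD)
  then have iff: "\<phi> x \<in> isol K \<longleftrightarrow> x \<in> isol K" if "x \<in> carrier G" for x
    using that unfolding isol_def by (simp flip: \<phi>.hom_nat_pow)
  have surj: "\<phi> ` carrier G = carrier G"
    using bij by (rule bij_betw_imp_surj_on)
  show ?thesis
  proof
    show "\<phi> ` isol K \<subseteq> isol K"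
      using iff unfolding isol_def by blast
    show "isol K \<subseteq> \<phi> ` isol K"
    proof
      fix z assume z: "z \<in> isol K"
      then have "z \<in> carrier G"
        by (simp add: isol_def)
      then obtain x where "x \<in> carrier G" "z = \<phi> x"
        using surj by blast
      then show "z \<in> \<phi> ` isol K"
        using z iff by blast
    qed
  qed
qed

section \<open>Isolators of closures of normal subgroups\<close>

lemma closed_normal_adherence:
  assumes "A \<lhd> G"
  shows "closed_normal_subgroup G p \<omega> (adherence A)"
  using normal_adherence [OF assms] adherence_idem [OF subgroup.subset [OF normal_imp_subgroup [OF assms]]]
  by (intro closed_normal_subgroup.intro p_valued_group_axioms closed_normal_subgroup_axioms.intro) auto

lemma isolator_closure:
  assumes "A \<lhd> G"
  shows "isolator G \<omega> (val_topology G \<omega> closure_of A) = isol (adherence A)"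
  unfolding closure_of_val_topology [OF subgroup.subset [OF normal_imp_subgroup [OF assms]]]
  by (rule closed_normal_subgroup.isolator_eq_isol [OF closed_normal_adherence [OF assms]])

text \<open>A commutator inclusion passes to closures by continuity and from there to isolators by
  uniqueness of roots.\<close>

lemma gcomm_isol_adherence:
  assumes A: "A \<lhd> G" and B: "B \<lhd> G" and E: "E \<lhd> G"
    and gcomm: "\<And>a b. a \<in> A \<Longrightarrow> b \<in> B \<Longrightarrow> gcomm G a b \<in> E"
    and xy: "x \<in> isol (adherence A)" "y \<in> isol (adherence B)"
  shows "gcomm G x y \<in> isol (adherence E)"
proof (rule gcomm_isol [OF closed_normal_adherence [OF E] _ xy])
  have sub: "A \<subseteq> carrier G" "B \<subseteq> carrier G" "E \<subseteq> carrier G"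
    using assms(1-3) by (auto dest!: normal_imp_subgroup subgroup.subset)
  show "gcomm G a b \<in> adherence E" if "a \<in> adherence A" "b \<in> adherence B" for a b
    by (rule gcomm_adherence [OF sub gcomm that])
qed

lemma isol_mono: "K \<subseteq> K' \<Longrightarrow> isol K \<subseteq> isol K'"
  unfolding isol_def by blast

text \<open>Shared by both series, with \<open>A\<close> and \<open>B\<close> two consecutive terms
  of either.\<close>

lemma isol_step:
  assumes A: "A \<lhd> G" and B: "B \<lhd> G" "B \<subseteq> A"
    and gcomm: "\<And>x y. x \<in> A \<Longrightarrow> y \<in> A \<Longrightarrow> gcomm G x y \<in> B"
    and auto: "\<And>\<phi>. \<phi> \<in> auto G \<Longrightarrow> \<phi> ` A = A"
  defines "H \<equiv> isol (adherence A)" and "N \<equiv> isol (adherence B)"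
  shows "isolated_orbital G \<omega> H \<and> characteristic G H \<and> N \<lhd> G\<lparr>carrier := H\<rparr> \<and>
    comm_group (G\<lparr>carrier := H\<rparr> Mod N) \<and> torsion_free (G\<lparr>carrier := H\<rparr> Mod N) \<and>
    p_valuable (G\<lparr>carrier := H\<rparr> Mod N) p"
proof -
  interpret A: closed_normal_subgroup G p \<omega> "adherence A"
    by (rule closed_normal_adherence [OF A])
  interpret B: closed_normal_subgroup G p \<omega> "adherence B"
    by (rule closed_normal_adherence [OF B(1)])
  have A_carrier: "A \<subseteq> carrier G"
    by (rule subgroup.subset [OF normal_imp_subgroup [OF A]])
  have H: "subgroup H G"
    unfolding H_def by (rule normal_imp_subgroup [OF A.normal_isol])
  have "characteristic G H"
    unfolding characteristic_def using H auto_image_isol [OF _ adherence_subset_carrier auto_image_adherence [OF _ A_carrier auto]]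
    by (simp add: H_def)
  moreover have "N \<subseteq> H"
    unfolding H_def N_def by (intro isol_mono adherence_mono B)
  moreover have "gcomm G x y \<in> N" if "x \<in> H" "y \<in> H" for x y
    using that unfolding H_def N_def by (intro gcomm_isol_adherence [OF A A B(1) gcomm])
  moreover have "x \<in> N" if "x \<in> H" "0 < n" "x [^] (n::nat) \<in> N" for x n
    unfolding N_def
    using B.root_in_isol [of x n] that subgroup.subset [OF H] by (auto simp: N_def)
  moreover have "adherence H \<subseteq> H" "closed_normal_subgroup G p \<omega> N" "isolated_orbital G \<omega> H"
    unfolding H_def N_def by (rule A.closed_isol B.closed_normal_isol A.isolated_orbital_isol)+
  ultimately show ?thesis
    using torsion_free_comm_quotient [of H N] H by simp
qed

lemma isol_adherence_carrier: "isol (adherence (carrier G)) = carrier G"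
proof
  show "carrier G \<subseteq> isol (adherence (carrier G))"
    using closed_normal_subgroup.subset_isol [OF closed_normal_adherence [OF normal_carrier]]
      subset_adherence [OF order_refl] by blast
qed (auto simp: isol_def)

text \<open>Only \<open>\<one>\<close> has infinite value, so its singleton is closed; and p-th
  powers gain exactly 1, so an element of finite value never reaches \<open>\<one>\<close> by taking
  p-th powers.\<close>

lemma isol_adherence_one: "isol (adherence {\<one>}) = {\<one>}"
proof -
  have "x = \<one>" if x: "x \<in> adherence {\<one>}" for x
  proof -
    have "x \<in> carrier G" "\<And>\<mu>::real. ereal \<mu> \<le> \<omega> (inv x)"
      using x by (auto simp: adherence_def)
    then have "inv x = \<one>"
      by (intro eq_one_if_in_all_levels) auto
    then show ?thesis
      using \<open>x \<in> carrier G\<close> by simp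
  qed
  then have adh: "adherence {\<one>} = {\<one>}"
    using subset_adherence [of "{\<one>}"] by auto
  have "x = \<one>" if "x \<in> carrier G" "x [^] (p ^ n) = \<one>" for x n
    using that
  proof (induction n)
    case (Suc n)
    then have "(x [^] (p ^ n)) [^] p = \<one>"
      by (simp add: nat_pow_pow mult.commute)
    then have "\<omega> (x [^] (p ^ n)) + 1 = \<infinity>"
      using \<omega>_pow [of "x [^] (p ^ n)"] Suc.prems v_one by simp
    then have "x [^] (p ^ n) = \<one>"
      using \<omega>_infinity_iff [of "x [^] (p ^ n)"] Suc.prems by (cases "\<omega> (x [^] (p ^ n))") auto
    then show ?case
      using Suc by blast
  qed simp
  then show ?thesis
    unfolding adh isol_def by auto
qed

lemma subset_isol_adherence: "A \<lhd> G \<Longrightarrow> A \<subseteq> isol (adherence A)"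
  using subset_adherence closed_normal_subgroup.subset_isol [OF closed_normal_adherence]
    subgroup.subset [OF normal_imp_subgroup] by (metis order_trans)

section \<open>The isolated lower central and derived series\<close>

lemma isolated_lower_central_series:
  assumes GL_def: "\<And>i. GL i = isolator G \<omega> (val_topology G \<omega> closure_of lower_central G i)"
  shows "\<forall>i\<ge>1. isolated_orbital G \<omega> (GL i) \<and> characteristic G (GL i) \<and>
        GL (Suc i) \<lhd> G\<lparr>carrier := GL i\<rparr> \<and>
        comm_group (G\<lparr>carrier := GL i\<rparr> Mod GL (Suc i)) \<and>
        torsion_free (G\<lparr>carrier := GL i\<rparr> Mod GL (Suc i)) \<and>
        p_valuable (G\<lparr>carrier := GL i\<rparr> Mod GL (Suc i)) p" (is ?quotients)
    and "GL 1 = carrier G" (is ?first)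
    and "GL (Suc i) \<subseteq> GL i"
    and "\<lbrakk>1 \<le> i; 1 \<le> j\<rbrakk> \<Longrightarrow> comm_subgroup G (GL i) (GL j) \<subseteq> GL (i + j)"
    and "(\<exists>r\<ge>1. GL r = {\<one>}) \<longleftrightarrow> nilpotent G" (is ?nilpotent)
proof -
  have GL: "GL i = isol (adherence (lower_central G i))" for i
    unfolding GL_def by (rule isolator_closure [OF normal_lower_central])
  have subset: "lower_central G i \<subseteq> carrier G" for i
    by (rule subgroup.subset [OF normal_imp_subgroup [OF normal_lower_central]])
  have gcomm: "gcomm G x y \<in> lower_central G (Suc i)"
    if "1 \<le> i" "x \<in> lower_central G i" "y \<in> lower_central G i" for x y i
    unfolding lower_central_Suc [OF that(1)] using that(2,3) subset by (intro gcomm_in_comm_subgroup) blast+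
  show ?quotients
    unfolding GL
    by (intro allI impI, rule isol_step [OF normal_lower_central normal_lower_central
          lower_central_Suc_subset gcomm auto_image(3)])
  show ?first
    unfolding GL by (simp add: isol_adherence_carrier)
  show "GL (Suc i) \<subseteq> GL i"
    unfolding GL by (intro isol_mono adherence_mono lower_central_Suc_subset)
  show "comm_subgroup G (GL i) (GL j) \<subseteq> GL (i + j)" if ij: "1 \<le> i" "1 \<le> j"
    unfolding GL
  proof (rule comm_subgroup_subset)
    show "subgroup (isol (adherence (lower_central G (i + j)))) G"
      using closed_normal_subgroup.normal_isol [OF closed_normal_adherence [OF normal_lower_central]]
      by (rule normal_imp_subgroup)
    fix h k assume hk: "h \<in> isol (adherence (lower_central G i))" "k \<in> isol (adherence (lower_central G j))"
    have "gcomm G a b \<in> lower_central G (i + j)" if "a \<in> lower_central G i" "b \<in> lower_central G j" for a b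
      using gcomm_lower_central [OF ij(2,1) that(2,1)] by (simp add: add.commute)
    then show "gcomm G h k \<in> isol (adherence (lower_central G (i + j)))"
      by (rule gcomm_isol_adherence [OF normal_lower_central normal_lower_central normal_lower_central _ hk])
  qed
  show ?nilpotent
  proof
    assume "\<exists>r\<ge>1. GL r = {\<one>}"
    then obtain r where "GL r = {\<one>}"
      by blast
    then have "lower_central G r \<subseteq> {\<one>}"
      using subset_isol_adherence [OF normal_lower_central, of r] by (simp add: GL)
    moreover have "\<one> \<in> lower_central G r"
      by (rule subgroup.one_closed [OF normal_imp_subgroup [OF normal_lower_central]])
    ultimately show "nilpotent G"
      unfolding nilpotent_def by blast
  next
    assume "nilpotent G"
    then obtain c where c: "lower_central G c = {\<one>}"
      unfolding nilpotent_def by blast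
    \<comment> \<open>\<open>c\<close> may be 0, where \<open>lower_central\<close> is
      \<open>carrier G\<close> by convention; passing to \<open>Suc c\<close> secures
      \<open>r \<ge> 1\<close>.\<close>
    have "lower_central G (Suc c) = {\<one>}"
      using c lower_central_Suc_subset [of c]
        subgroup.one_closed [OF normal_imp_subgroup [OF normal_lower_central [of "Suc c"]]] by auto
    then have "GL (Suc c) = {\<one>}"
      unfolding GL by (simp only: isol_adherence_one)
    then show "\<exists>r\<ge>1. GL r = {\<one>}"
      by (intro exI [of _ "Suc c"]) simp
  qed
qed

lemma isolated_derived_series:
  assumes GD_def: "\<And>i. GD i = isolator G \<omega> (val_topology G \<omega> closure_of derived_series G i)"
  shows "\<forall>i. isolated_orbital G \<omega> (GD i) \<and> characteristic G (GD i) \<and>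
        GD (Suc i) \<lhd> G\<lparr>carrier := GD i\<rparr> \<and>
        comm_group (G\<lparr>carrier := GD i\<rparr> Mod GD (Suc i)) \<and>
        torsion_free (G\<lparr>carrier := GD i\<rparr> Mod GD (Suc i)) \<and>
        p_valuable (G\<lparr>carrier := GD i\<rparr> Mod GD (Suc i)) p" (is ?quotients)
    and "GD 0 = carrier G" (is ?first)
    and "comm_subgroup G (GD i) (GD i) \<subseteq> GD (Suc i)"
    and "(\<exists>r. GD r = {\<one>}) \<longleftrightarrow> solvable G" (is ?solvable)
proof -
  have GD: "GD i = isol (adherence (derived_series G i))" for i
    unfolding GD_def by (rule isolator_closure [OF normal_derived_series])
  have gcomm: "gcomm G x y \<in> derived_series G (Suc i)" if "x \<in> derived_series G i" "y \<in> derived_series G i" for x y i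
    using that by (simp add: gcomm_derived)
  show ?quotients
    unfolding GD
    by (rule allI, rule isol_step [OF normal_derived_series normal_derived_series derived_series_Suc_subset gcomm auto_image(4)])
  show ?first
    unfolding GD by (simp add: isol_adherence_carrier)
  show "comm_subgroup G (GD i) (GD i) \<subseteq> GD (Suc i)"
    unfolding GD
  proof (rule comm_subgroup_subset)
    show "subgroup (isol (adherence (derived_series G (Suc i)))) G"
      using closed_normal_subgroup.normal_isol [OF closed_normal_adherence [OF normal_derived_series]]
      by (rule normal_imp_subgroup)
    fix h k assume hk: "h \<in> isol (adherence (derived_series G i))" "k \<in> isol (adherence (derived_series G i))"
    show "gcomm G h k \<in> isol (adherence (derived_series G (Suc i)))"
      by (rule gcomm_isol_adherence [OF normal_derived_series normal_derived_series normal_derived_series gcomm hk])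
  qed
  show ?solvable
    unfolding solvable_iff_trivial_derived_seq
  proof
    assume "\<exists>r. GD r = {\<one>}"
    then obtain r where "GD r = {\<one>}"
      by blast
    then have "derived_series G r \<subseteq> {\<one>}"
      using subset_isol_adherence [OF normal_derived_series, of r] by (simp add: GD)
    moreover have "\<one> \<in> derived_series G r"
      by (rule subgroup.one_closed [OF normal_imp_subgroup [OF normal_derived_series]])
    ultimately show "\<exists>n. derived_series G n = {\<one>}"
      by blast
  next
    assume "\<exists>n. derived_series G n = {\<one>}"
    then obtain n where "derived_series G n = {\<one>}"
      by blast
    then have "GD n = {\<one>}"
      unfolding GD by (simp only: isol_adherence_one)
    then show "\<exists>r. GD r = {\<one>}"
      by blast
  qed
qed

end

theorem theoremB:
  fixes G :: "('a, 'b) monoid_scheme" and p :: nat and \<omega> :: "'a \<Rightarrow> ereal"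
  assumes "Factorial_Ring.prime p"
    and "p_valued_complete_finite_rank G p \<omega>"
  defines "GL \<equiv> \<lambda>i. isolator G \<omega> (val_topology G \<omega> closure_of lower_central G i)"
    and "GD \<equiv> \<lambda>i. isolator G \<omega> (val_topology G \<omega> closure_of derived_series G i)"
  shows
    "(\<forall>i\<ge>1. isolated_orbital G \<omega> (GL i) \<and> characteristic G (GL i) \<and>
        GL (Suc i) \<lhd> G\<lparr>carrier := GL i\<rparr> \<and>
        comm_group (G\<lparr>carrier := GL i\<rparr> Mod GL (Suc i)) \<and>
        torsion_free (G\<lparr>carrier := GL i\<rparr> Mod GL (Suc i)) \<and>
        p_valuable (G\<lparr>carrier := GL i\<rparr> Mod GL (Suc i)) p)
   \<and> (\<forall>i. isolated_orbital G \<omega> (GD i) \<and> characteristic G (GD i) \<and>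
        GD (Suc i) \<lhd> G\<lparr>carrier := GD i\<rparr> \<and>
        comm_group (G\<lparr>carrier := GD i\<rparr> Mod GD (Suc i)) \<and>
        torsion_free (G\<lparr>carrier := GD i\<rparr> Mod GD (Suc i)) \<and>
        p_valuable (G\<lparr>carrier := GD i\<rparr> Mod GD (Suc i)) p)
   \<and> (nilpotent G \<longrightarrow>
        GL 1 = carrier G \<and>
        (\<forall>i\<ge>1. GL (Suc i) \<subseteq> GL i) \<and>
        (\<forall>i\<ge>1. comm_subgroup G (carrier G) (GL i) \<subseteq> GL (Suc i)) \<and>
        (\<forall>i\<ge>1. \<forall>j\<ge>1. comm_subgroup G (GL i) (GL j) \<subseteq> GL (i + j)) \<and>
        (\<exists>r\<ge>1. GL r = {\<one>\<^bsub>G\<^esub>}))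
   \<and> ((\<exists>r\<ge>1. GL r = {\<one>\<^bsub>G\<^esub>}) \<longrightarrow> nilpotent G)
   \<and> (solvable G \<longrightarrow>
        GD 0 = carrier G \<and>
        (\<forall>i. closedin (val_topology G \<omega>) (GD i) \<and> GD (Suc i) \<lhd> G\<lparr>carrier := GD i\<rparr> \<and>
             comm_subgroup G (GD i) (GD i) \<subseteq> GD (Suc i)) \<and>
        (\<exists>r. GD r = {\<one>\<^bsub>G\<^esub>}))
   \<and> ((\<exists>r. GD r = {\<one>\<^bsub>G\<^esub>}) \<longrightarrow> solvable G)"
proof -
  interpret p_valued_group G p \<omega>
    using assms(1,2)
    by (simp add: p_valued_group_def p_valued_group_axioms_def p_valued_complete_finite_rank_def)
  have "GL i = isolator G \<omega> (val_topology G \<omega> closure_of lower_central G i)" for i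
    by (simp add: GL_def)
  note GL = isolated_lower_central_series [OF this]
  have "GD i = isolator G \<omega> (val_topology G \<omega> closure_of derived_series G i)" for i
    by (simp add: GD_def)
  note GD = isolated_derived_series [OF this]
  \<comment> \<open>\<open>carrier G\<close> is \<open>GL 1\<close>, so this is the strongly central
    inclusion with first index 1.\<close>
  have "comm_subgroup G (carrier G) (GL i) \<subseteq> GL (Suc i)" if "1 \<le> i" for i
    using GL(4) [OF order_refl that] unfolding GL(2) by simp
  moreover have "closedin (val_topology G \<omega>) (GD i)" for i
    using GD(1) by (simp add: isolated_orbital_def orbital_def)
  ultimately show ?thesis
    using GL GD by (intro conjI impI) blast+
qed

end
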